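(* There are constants $C(\xi)$ (depending on $\xi$) and $C,C_1,C_2$ independent of $\xi$ such that the following hold for real $\xi\neq0$: (i) for all $\xi\neq0,\pm\sqrt\pi$ and all $f,g\in L^2_w(\mathbb{R})$, $$\Big|\int_{\mathbb{R}}(\mathcal{B}_\xi f)(\lambda)\overline{(\mathcal{U}_\xi g)(\lambda)}\,w(\lambda)\,d\lambda\Big|\le C(\xi)\,\|f\|_{L^2_w}\|g\|_{L^2_w};$$ (ii) for all $\xi\ne0$ and all $f,g\in H^1_w(\mathbb{R})$, $$\Big|\int_{\mp}(\mathcal{B}_\xi f)(\lambda)\overline{(\mathcal{U}_\xi g)(\lambda)}\,w(\lambda)\,d\lambda\Big|\le C\,\|f\|_{H^1_w}\|g\|_{H^1_w};$$ (iii) for all $\xi\neq0$, all $g\in H^1_w(\mathbb{R})$ and all $f\in L^2_w(\mathbb{R})$, $$\|\mathcal{U}_\xi g\|_{H^{-1}_w}\le C_1\|g\|_{H^1_w},\qquad \|\mathcal{B}_\xi f\|_{L^2_w}\le C_2\|f\|_{L^2_w}.$$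
   Context: Let $w(v)=e^{-v^2}/\sqrt{\pi}$, $L^2_w=L^2_w(\mathbb{R})$ with $(f,g)_{L^2_w}=\int f\bar g\,w\,dv$; $H^1_w=\{f\in L^2_w:f'\in L^2_w\}$ with $\|f\|_{H^1_w}^2=\|f\|^2_{L^2_w}+\|f'\|^2_{L^2_w}$; $H^{-1}_w$ is its dual with respect to the $L^2_w$ pairing. $\omega(\lambda,\xi)=1-\int_{\mathbb{R}}\frac{w(v)\,dv}{iv\xi+1+\lambda}$ for $\mathrm{Re}\,\lambda\ne-1$. For $\xi\neq0$, $\lambda\in\mathbb{R}$: $\omega_+(-1-i\lambda\xi,\xi)=\lim_{\delta\to0^+}\omega(-1+\delta-i\lambda\xi,\xi)$ and $\omega_-(-1+i\lambda\xi,-\xi)=\lim_{\delta\to0^+}\omega(-1-\delta+i\lambda\xi,-\xi)$. The first vanishes for some real $\lambda$ only if $\xi=\pm\sqrt\pi$, and then only at $\lambda=0$; the second never vanishes. For $h\in L^2(\mathbb{R})$ let $(\hat{\mathcal S}_\pm h)(\lambda)=\lim_{\eta\to0^\pm}\int_{\mathbb{R}}\frac{h(z)}{z-(\lambda+i\eta)}\,dz$. Then $$(\mathcal U_\xi f)(\lambda)=f(\lambda)-\frac{1}{i\xi\,\overline{\omega_+(-1-i\lambda\xi,\xi)}}\,(\hat{\mathcal S}_{-\mathrm{sgn}\,\xi}(fw))(\lambda),\qquad (\mathcal B_\xi f)(\lambda)=f(\lambda)+\frac{1}{i\xi\,\overline{\omega_-(-1+i\lambda\xi,-\xi)}}\,(\hat{\mathcal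 S}_{-\mathrm{sgn}\,\xi}(fw))(\lambda).$$ The integral $\int_{\mp}$ means $\int_-$ for $\xi>0$ and $\int_+$ for $\xi<0$. For $\xi\neq0,\pm\sqrt\pi$ it is the ordinary integral over $\mathbb{R}$; for $\xi=\pm\sqrt\pi$ (corresponding signs) it is the regularized integral $\int_{\mp}h\,\overline{\mathcal U_\xi g}\,w\,d\lambda:=\lim_{b\to0^\pm}\int_{\mathbb{R}}\frac{\lambda}{\lambda-ib}\,h(\lambda)\,\overline{(\mathcal U_\xi g)(\lambda)}\,w(\lambda)\,d\lambda$. The norm $\|\mathcal U_\xi g\|_{H^{-1}_w}$ is the supremum of $\big|\int_{\mp}h\,\overline{\mathcal U_\xi g}\,w\,d\lambda\big|$ over $h\in H^1_w$ with $\|h\|_{H^1_w}\le1$. *)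

theory Defs
  imports "HOL-Analysis.Analysis"
begin

definition w :: "real \<Rightarrow> real" where
  "w v = exp (- v\<^sup>2) / sqrt pi"


subsection \<open>Weighted Lebesgue and Sobolev spaces\<close>

text \<open>Elements are Lebesgue measurable functions rather than classes modulo null sets; all norms
  and operators below are invariant (almost everywhere) under changes on null sets.\<close>

definition L2w :: "(real \<Rightarrow> complex) set" where
  "L2w = {f. f \<in> borel_measurable lebesgue \<and> integrable lebesgue (\<lambda>v. (cmod (f v))\<^sup>2 * w v)}"

definition norm_L2w :: "(real \<Rightarrow> complex) \<Rightarrow> real" where
  "norm_L2w f = sqrt (LINT v|lebesgue. (cmod (f v))\<^sup>2 * w v)"

definition test_function :: "(real \<Rightarrow> real) \<Rightarrow> bool" where
  "test_function \<phi> \<longleftrightarrow>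
     (\<forall>n x. (deriv ^^ n) \<phi> differentiable (at x)) \<and> (\<exists>R. \<forall>x. \<bar>x\<bar> > R \<longrightarrow> \<phi> x = 0)"

definition is_weak_deriv :: "(real \<Rightarrow> complex) \<Rightarrow> (real \<Rightarrow> complex) \<Rightarrow> bool" where
  "is_weak_deriv f f' \<longleftrightarrow>
     (\<forall>\<phi>. test_function \<phi> \<longrightarrow>
        (LINT x|lebesgue. f x * of_real (deriv \<phi> x)) = - (LINT x|lebesgue. f' x * of_real (\<phi> x)))"

definition H1w :: "(real \<Rightarrow> complex) set" where
  "H1w = {f \<in> L2w. \<exists>f' \<in> L2w. is_weak_deriv f f'}"

text \<open>The weak derivative is unique up to null sets, so the choice does not affect the norm.\<close>

definition weak_deriv :: "(real \<Rightarrow> complex) \<Rightarrow> real \<Rightarrow> complex" where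
  "weak_deriv f = (SOME f'. f' \<in> L2w \<and> is_weak_deriv f f')"

definition norm_H1w :: "(real \<Rightarrow> complex) \<Rightarrow> real" where
  "norm_H1w f = sqrt ((norm_L2w f)\<^sup>2 + (norm_L2w (weak_deriv f))\<^sup>2)"


subsection \<open>The function \<open>\<omega>\<close> and its boundary values on \<open>Re \<mu> = -1\<close>\<close>

definition omega :: "complex \<Rightarrow> real \<Rightarrow> complex" where
  "omega \<mu> \<xi> = 1 - (LINT v|lebesgue. of_real (w v) / (\<i> * of_real v * of_real \<xi> + 1 + \<mu>))"

definition omega_plus :: "complex \<Rightarrow> real \<Rightarrow> complex" where
  "omega_plus \<mu> \<xi> = Lim (at_right 0) (\<lambda>\<delta>::real. omega (\<mu> + of_real \<delta>) \<xi>)"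

definition omega_minus :: "complex \<Rightarrow> real \<Rightarrow> complex" where
  "omega_minus \<mu> \<xi> = Lim (at_right 0) (\<lambda>\<delta>::real. omega (\<mu> - of_real \<delta>) \<xi>)"


subsection \<open>The operators \<open>\<U>\<^sub>\<xi>\<close> and \<open>\<B>\<^sub>\<xi>\<close>\<close>

text \<open>For \<open>s \<noteq> 0\<close>, the filter of one-sided approach to \<open>0\<close> from the side on which \<open>s\<close> lies.\<close>

definition at_zero_side :: "real \<Rightarrow> real filter" where
  "at_zero_side s = (if s > 0 then at_right 0 else at_left 0)"

text \<open>\<open>S_hat 1\<close> and \<open>S_hat (- 1)\<close> are the boundary operators with subscript plus and minus. The limit
  is taken pointwise; for \<open>h\<close> in \<open>L\<^sup>2\<close> it exists for almost every \<open>l\<close>, and \<open>S_hat s h\<close> is a fixed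
  junk value on the exceptional null set.\<close>

definition S_hat :: "real \<Rightarrow> (real \<Rightarrow> complex) \<Rightarrow> real \<Rightarrow> complex" where
  "S_hat s h l =
     Lim (at_zero_side s)
       (\<lambda>\<eta>. LINT z|lebesgue. h z / (of_real z - (of_real l + \<i> * of_real \<eta>)))"

definition U_op :: "real \<Rightarrow> (real \<Rightarrow> complex) \<Rightarrow> real \<Rightarrow> complex" where
  "U_op \<xi> f l = f l -
     1 / (\<i> * of_real \<xi> * cnj (omega_plus (- 1 - \<i> * of_real l * of_real \<xi>) \<xi>))
       * S_hat (- sgn \<xi>) (\<lambda>v. f v * of_real (w v)) l"

definition B_op :: "real \<Rightarrow> (real \<Rightarrow> complex) \<Rightarrow> real \<Rightarrow> complex" where
  "B_op \<xi> f l = f l +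
     1 / (\<i> * of_real \<xi> * cnj (omega_minus (- 1 + \<i> * of_real l * of_real \<xi>) (- \<xi>)))
       * S_hat (- sgn \<xi>) (\<lambda>v. f v * of_real (w v)) l"


subsection \<open>The regularized pairing and the dual norm\<close>

definition reg_integrand ::
    "real \<Rightarrow> (real \<Rightarrow> complex) \<Rightarrow> (real \<Rightarrow> complex) \<Rightarrow> real \<Rightarrow> complex" where
  "reg_integrand b h k l =
     of_real l / (of_real l - \<i> * of_real b) * h l * cnj (k l) * of_real (w l)"

text \<open>The integral with subscript \<open>\<mp>\<close>: at \<open>\<xi> = sqrt pi\<close> the limit is \<open>b \<rightarrow> 0+\<close>, at \<open>\<xi> = - sqrt pi\<close> it
  is \<open>b \<rightarrow> 0-\<close>.\<close>

definition reg_pairing ::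
    "real \<Rightarrow> (real \<Rightarrow> complex) \<Rightarrow> (real \<Rightarrow> complex) \<Rightarrow> complex" where
  "reg_pairing \<xi> h k =
     (if \<xi> = sqrt pi \<or> \<xi> = - sqrt pi
      then Lim (at_zero_side \<xi>) (\<lambda>b. LINT l|lebesgue. reg_integrand b h k l)
      else (LINT l|lebesgue. h l * cnj (k l) * of_real (w l)))"

text \<open>Since \<open>Lim\<close> and \<open>LINT\<close> are total, existence of the limit and integrability are recorded
  separately.\<close>

definition reg_pairing_exists ::
    "real \<Rightarrow> (real \<Rightarrow> complex) \<Rightarrow> (real \<Rightarrow> complex) \<Rightarrow> bool" where
  "reg_pairing_exists \<xi> h k \<longleftrightarrow>
     (if \<xi> = sqrt pi \<or> \<xi> = - sqrt pi
      then (\<forall>\<^sub>F b in at_zero_side \<xi>. integrable lebesgue (reg_integrand b h k)) \<and>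
           (\<exists>L. ((\<lambda>b. LINT l|lebesgue. reg_integrand b h k l) \<longlongrightarrow> L) (at_zero_side \<xi>))
      else integrable lebesgue (\<lambda>l. h l * cnj (k l) * of_real (w l)))"

text \<open>The dual norm of \<open>k\<close> as a functional on \<open>H1w\<close>; it depends on \<open>\<xi>\<close> through the pairing. The
  supremum is taken in \<open>ennreal\<close> so that an unbounded functional has norm \<open>\<infinity>\<close>.\<close>

definition norm_Hminus1w :: "real \<Rightarrow> (real \<Rightarrow> complex) \<Rightarrow> ennreal" where
  "norm_Hminus1w \<xi> k =
     (SUP h \<in> {h \<in> H1w. norm_H1w h \<le> 1}. ennreal (cmod (reg_pairing \<xi> h k)))"

end

theory Submission
  imports Defs "HOL-Probability.Probability" "HOL-Real_Asymp.Real_Asymp"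
begin

text \<open>If \<open>f \<in> L2w\<close>, then \<open>h = f w\<close> is integrable and square integrable. The \<open>L\<^sup>2\<close> inner products of
  \<open>l \<mapsto> \<integral> h z / (z - l - \<i> a) dz\<close> and \<open>l \<mapsto> \<integral> h z / (z - l - \<i> b) dz\<close>, \<open>a, b > 0\<close>, are nonnegative,
  depend on \<open>a + b\<close> only and are controlled by the Poisson kernel; together with the weak type
  inequality of Hardy and Littlewood this yields boundary values almost everywhere, with \<open>L\<^sup>2\<close> norm
  bounded by that of \<open>h\<close>. If \<open>f \<in> H1w\<close>, then \<open>h\<close> lies in the unweighted Sobolev space, and \<open>h\<close> and
  its boundary values are Hoelder continuous of exponent \<open>1 / 2\<close>.

  The boundary values of \<open>\<omega>\<close> are explicit: those of the transform of \<open>w\<close> are \<open>H \<plusminus> \<i> pi w\<close> with a real odd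
  function \<open>H\<close> that solves \<open>H' l = - 2 - 2 l H l\<close>. Consequently the multipliers in both operators are
  bounded by a constant times \<open>1 + \<bar>l\<bar>\<close>, uniformly in \<open>\<xi>\<close>, which \<open>sqrt w\<close> absorbs, except for a simple
  pole of the multiplier of \<open>U_op\<close> on the imaginary axis, which reaches the real line at
  \<open>\<bar>\<xi>\<bar> = sqrt pi\<close>. The pairing with this pole is uniformly bounded and has the required limits because
  the other factors are Hoelder continuous.\<close>

section \<open>Cauchy kernels\<close>

text \<open>The boundary operators are pointwise limits, so their existence almost everywhere has to
  be settled before any norm estimate makes sense. If \<open>M a\<close> is the squared norm of the
  transform at height \<open>a\<close>, the inner product rule gives squared distance
  \<open>M a + M b - 2 M ((a + b) / 2)\<close> between two heights. As \<open>M\<close> is monotone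
  and bounded, this yields a Cauchy property, which a maximal inequality makes pointwise.

  Uniformity in \<open>\<xi>\<close> is the second obstacle: the bound of \<open>U_op\<close> on
  \<open>L2w\<close> degenerates with \<open>pole \<xi>\<close>. In the pairing, the value of the
  other factors at 0 is subtracted; the remainder is absolutely integrable, and the bare pole over a
  symmetric interval gives \<open>2 \<i> arctan (1 / (4 c))\<close>, bounded whatever
  \<open>c\<close> is. Ordinary and regularized pairing are one computation: if the pole sits at 0,
  then \<open>l / (l - \<i> b)\<close> times \<open>1 / l\<close> is
  \<open>1 / (l - \<i> b)\<close>, a simple pole off the line. For \<open>B_op \<xi> f\<close> only
  membership in \<open>L2w\<close> and Hoelder continuity of its product with \<open>w\<close> near
  0 are used, not membership in \<open>H1w\<close>.\<close>

lemma integral_FTC_real_line: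
  fixes f F :: "real \<Rightarrow> 'a::euclidean_space"
  assumes F: "\<And>x. (F has_vector_derivative f x) (at x)"
    and f: "\<And>x. isCont f x" and int: "integrable lborel f"
    and A: "(F \<longlongrightarrow> A) at_bot" and B: "(F \<longlongrightarrow> B) at_top"
  shows "(LINT x|lborel. f x) = B - A"
proof -
  have "(LBINT x=-\<infinity>..\<infinity>. f x) = B - A"
    by (rule interval_integral_FTC_integrable[where F = F])
      (use assms in \<open>auto simp: set_integrable_def ereal_tendsto_simps einterval_def simp del: comp_apply\<close>)
  then show ?thesis
    by (simp add: interval_lebesgue_integral_def set_lebesgue_integral_def einterval_def)
qed

lemma
  fixes a :: real
  assumes "a \<noteq> 0"
  shows integrable_inverse_square_plus: "integrable lborel (\<lambda>x. 1 / (x\<^sup>2 + a\<^sup>2))"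
    and integral_inverse_square_plus: "(LINT x|lborel. 1 / (x\<^sup>2 + a\<^sup>2)) = pi / \<bar>a\<bar>"
proof -
  define b where "b = \<bar>a\<bar>"
  have b: "b > 0" "a\<^sup>2 = b\<^sup>2" using assms by (auto simp: b_def)
  have pos: "x\<^sup>2 + b\<^sup>2 > 0" for x :: real
    using b by (simp add: add_nonneg_pos)
  have D: "((\<lambda>x. arctan (x / b) / b) has_real_derivative 1 / (x\<^sup>2 + b\<^sup>2)) (at x)" for x
  proof -
    have "1 / (1 + (x / b)\<^sup>2) / b / b = 1 / (x\<^sup>2 + b\<^sup>2)"
    proof -
      have "(1 + (x / b)\<^sup>2) * b * b = x\<^sup>2 + b\<^sup>2"
        using b(1) by (simp add: power_divide field_simps power2_eq_square)
      then show ?thesis by (simp add: mult.assoc)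
    qed
    then show ?thesis
      using b by (auto intro!: derivative_eq_intros simp: divide_inverse mult_ac)
  qed
  have "((\<lambda>x. arctan (x / b)) \<longlongrightarrow> - (pi / 2)) at_bot" "((\<lambda>x. arctan (x / b)) \<longlongrightarrow> pi / 2) at_top"
    using b by real_asymp+
  then have lim1: "((\<lambda>x. arctan (x / b) / b) \<longlongrightarrow> (- (pi / 2)) / b) at_bot"
    and lim2: "((\<lambda>x. arctan (x / b) / b) \<longlongrightarrow> (pi / 2) / b) at_top"
    using b by (intro tendsto_divide tendsto_const; simp)+
  have "isCont (\<lambda>x. 1 / (x\<^sup>2 + b\<^sup>2)) x" for x
    using pos[of x] by (auto intro!: continuous_intros)
  note I = interval_integral_FTC_nonneg[of "-\<infinity>" "\<infinity>" "\<lambda>x. arctan (x / b) / b" "\<lambda>x. 1 / (x\<^sup>2 + b\<^sup>2)",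
      unfolded ereal_tendsto_simps, OF _ D this _ lim1 lim2]
  show "integrable lborel (\<lambda>x. 1 / (x\<^sup>2 + a\<^sup>2))"
    using I(1) by (simp add: set_integrable_def einterval_def b(2))
  show "(LINT x|lborel. 1 / (x\<^sup>2 + a\<^sup>2)) = pi / \<bar>a\<bar>"
    using I(2) by (simp add: interval_lebesgue_integral_def set_lebesgue_integral_def einterval_def b(2) flip: b_def)
qed

text \<open>The Cauchy kernel at the point \<open>l + \<i> a\<close> is
  \<open>cauchy_kernel a (z - l)\<close>: the parameter \<open>a\<close> is the height above the
  real line and may have either sign.\<close>

definition cauchy_kernel :: "real \<Rightarrow> real \<Rightarrow> complex" where
  "cauchy_kernel a x = 1 / (of_real x - \<i> * of_real a)"

lemma cauchy_kernel_denom_nonzero: "a \<noteq> 0 \<Longrightarrow> of_real x - \<i> * of_real a \<noteq> (0::complex)"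
  by (auto simp: complex_eq_iff)

lemma norm_cauchy_kernel_sq: "(cmod (cauchy_kernel a x))\<^sup>2 = 1 / (x\<^sup>2 + a\<^sup>2)"
  by (simp add: cauchy_kernel_def norm_divide power_divide cmod_power2)

lemma norm_cauchy_kernel_le: "a \<noteq> 0 \<Longrightarrow> cmod (cauchy_kernel a x) \<le> 1 / \<bar>a\<bar>"
proof -
  assume "a \<noteq> 0"
  moreover have "\<bar>a\<bar> \<le> cmod (of_real x - \<i> * of_real a)"
    using abs_Im_le_cmod[of "of_real x - \<i> * of_real a"] by simp
  ultimately show ?thesis
    by (simp add: cauchy_kernel_def norm_divide frac_le)
qed

lemma cnj_cauchy_kernel: "cnj (cauchy_kernel a x) = cauchy_kernel (- a) x"
  by (simp add: cauchy_kernel_def)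

lemma cauchy_kernel_minus: "cauchy_kernel a (- x) = - cauchy_kernel (- a) x"
proof -
  have "of_real (- x) - \<i> * of_real a = - (of_real x - \<i> * of_real (- a))" by simp
  then show ?thesis
    unfolding cauchy_kernel_def by (metis divide_minus_right)
qed

lemma borel_measurable_cauchy_kernel [measurable]: "cauchy_kernel a \<in> borel_measurable borel"
  unfolding cauchy_kernel_def[abs_def] by measurable

lemma borel_measurable_cauchy_kernel2 [measurable]:
  "(\<lambda>(a, x). cauchy_kernel a x) \<in> borel_measurable (borel \<Otimes>\<^sub>M borel)"
  unfolding cauchy_kernel_def[abs_def] by measurable

lemma
  assumes "a \<noteq> 0"
  shows integrable_norm_cauchy_kernel_sq: "integrable lborel (\<lambda>x. (cmod (cauchy_kernel a (z - x)))\<^sup>2)"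
    and integral_norm_cauchy_kernel_sq:
      "(LINT x|lborel. (cmod (cauchy_kernel a (z - x)))\<^sup>2) = pi / \<bar>a\<bar>"
  using lborel_integrable_real_affine_iff[of "-1" "\<lambda>x. 1 / (x\<^sup>2 + a\<^sup>2)" z]
    integrable_inverse_square_plus[OF assms]
    lborel_integral_real_affine[of "-1" "\<lambda>x. 1 / (x\<^sup>2 + a\<^sup>2)" z]
    integral_inverse_square_plus[OF assms]
  by (auto simp: norm_cauchy_kernel_sq)

lemma integrable_mult_of_square_integrable:
  fixes f g :: "'a \<Rightarrow> 'b::{real_normed_field, second_countable_topology, banach}"
  assumes [measurable]: "f \<in> borel_measurable M" "g \<in> borel_measurable M"
    and "integrable M (\<lambda>x. (norm (f x))\<^sup>2)" "integrable M (\<lambda>x. (norm (g x))\<^sup>2)"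
  shows "integrable M (\<lambda>x. f x * g x)"
proof (rule Bochner_Integration.integrable_bound)
  show "integrable M (\<lambda>x. (norm (f x))\<^sup>2 + (norm (g x))\<^sup>2)"
    using assms by auto
  have "norm (f x) * norm (g x) \<le> (norm (f x))\<^sup>2 + (norm (g x))\<^sup>2" for x
    using sum_squares_bound[of "norm (f x)" "norm (g x)"]
      zero_le_mult_iff[of "norm (f x)" "norm (g x)"] norm_ge_zero[of "f x"] norm_ge_zero[of "g x"]
    by linarith
  then show "AE x in M. norm (f x * g x) \<le> norm ((norm (f x))\<^sup>2 + (norm (g x))\<^sup>2)"
    by (auto simp: norm_mult)
qed simp

text \<open>The real part of the primitive is a logarithm of a modulus and the imaginary part an
  \<open>arctan\<close>, so that no branch of the complex logarithm has to be chosen.\<close>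

lemma has_vector_derivative_log_primitive:
  assumes "Im \<alpha> \<noteq> 0"
  shows "((\<lambda>l. of_real (ln ((l - Re \<alpha>)\<^sup>2 + (Im \<alpha>)\<^sup>2) / 2) + \<i> * of_real (arctan ((l - Re \<alpha>) / Im \<alpha>)))
    has_vector_derivative 1 / (of_real l - \<alpha>)) (at l)"
proof -
  define q where "q = (l - Re \<alpha>)\<^sup>2 + (Im \<alpha>)\<^sup>2"
  have q: "q > 0" using assms by (simp add: q_def add_nonneg_pos)
  have D1: "((\<lambda>l. ln ((l - Re \<alpha>)\<^sup>2 + (Im \<alpha>)\<^sup>2) / 2) has_real_derivative (l - Re \<alpha>) / q) (at l)"
    using q by (auto intro!: derivative_eq_intros simp: q_def field_split_simps)
  have "1 / (1 + ((l - Re \<alpha>) / Im \<alpha>)\<^sup>2) / Im \<alpha> = Im \<alpha> / q"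
  proof -
    have "1 + ((l - Re \<alpha>) / Im \<alpha>)\<^sup>2 = q / (Im \<alpha>)\<^sup>2"
      using assms by (simp add: q_def power_divide field_simps)
    then have "1 / (1 + ((l - Re \<alpha>) / Im \<alpha>)\<^sup>2) = (Im \<alpha>)\<^sup>2 / q"
      by simp
    then show ?thesis
      using assms by (simp add: power2_eq_square)
  qed
  then have D2: "((\<lambda>l. arctan ((l - Re \<alpha>) / Im \<alpha>)) has_real_derivative Im \<alpha> / q) (at l)"
    using assms by (auto intro!: derivative_eq_intros simp: divide_inverse mult_ac)
  have "1 / (of_real l - \<alpha>) = of_real ((l - Re \<alpha>) / q) + \<i> * of_real (Im \<alpha> / q)"
    by (simp add: complex_eq_iff Re_divide Im_divide q_def power2_eq_square)
  then show ?thesis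
    using has_vector_derivative_add[OF has_vector_derivative_of_real[OF D1]
        has_vector_derivative_mult_right[OF has_vector_derivative_of_real[OF D2], of \<i>]] by simp
qed

text \<open>Partial fractions reduce the integrand to two simple fractions with known primitives. At
  both ends of the line the logarithms cancel, and each \<open>arctan\<close> contributes a jump of
  \<open>pi\<close> with the sign of the imaginary part. This is the residue theorem for two simple
  poles, without contours.\<close>

lemma integral_cauchy_product:
  assumes "Im \<alpha> \<noteq> 0" "Im \<beta> \<noteq> 0" "\<alpha> \<noteq> \<beta>"
  shows "(LINT l|lborel. 1 / ((of_real l - \<alpha>) * (of_real l - \<beta>)))
    = \<i> * pi * (sgn (Im \<beta>) - sgn (Im \<alpha>)) / (\<beta> - \<alpha>)"
proof -
  define F where "F = (\<lambda>\<alpha> l. complex_of_real (ln ((l - Re \<alpha>)\<^sup>2 + (Im \<alpha>)\<^sup>2) / 2)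
    + \<i> * of_real (arctan ((l - Re \<alpha>) / Im \<alpha>)))"
  have nz: "of_real l - \<alpha> \<noteq> 0" "of_real l - \<beta> \<noteq> 0" for l
    using assms(1,2) by (auto simp: complex_eq_iff)
  have eq: "(1 / (of_real l - \<beta>) - 1 / (of_real l - \<alpha>)) / (\<beta> - \<alpha>)
    = 1 / ((of_real l - \<alpha>) * (of_real l - \<beta>))" for l
  proof -
    have "1 / B - 1 / A = (A - B) / (A * B)" if "A \<noteq> 0" "B \<noteq> 0" for A B :: complex
      using that by (simp add: field_simps)
    from this[OF nz[of l]] show ?thesis
      using assms(3) by simp
  qed
  have D: "((\<lambda>l. (F \<beta> l - F \<alpha> l) / (\<beta> - \<alpha>)) has_vector_derivative
      1 / ((of_real l - \<alpha>) * (of_real l - \<beta>))) (at l)" for l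
    unfolding eq[symmetric]
    using assms unfolding F_def
    by (intro has_vector_derivative_divide has_vector_derivative_diff
        has_vector_derivative_log_primitive)
  have cont: "isCont (\<lambda>l. 1 / ((of_real l - \<alpha>) * (of_real l - \<beta>))) l" for l
    using nz by (auto intro!: continuous_intros)
  have sq: "integrable lborel (\<lambda>l. (cmod (1 / (of_real l - \<gamma>)))\<^sup>2)" if "Im \<gamma> \<noteq> 0" for \<gamma>
  proof -
    have "(cmod (1 / (of_real l - \<gamma>)))\<^sup>2 = (cmod (cauchy_kernel (- Im \<gamma>) (Re \<gamma> - l)))\<^sup>2" for l
      unfolding norm_cauchy_kernel_sq by (simp add: norm_divide power_divide cmod_power2 power2_commute)
    then show ?thesis
      using integrable_norm_cauchy_kernel_sq[of "- Im \<gamma>" "Re \<gamma>"] that by simp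
  qed
  have int: "integrable lborel (\<lambda>l. 1 / ((of_real l - \<alpha>) * (of_real l - \<beta>)))"
    using integrable_mult_of_square_integrable[of "\<lambda>l. 1 / (of_real l - \<alpha>)" lborel "\<lambda>l. 1 / (of_real l - \<beta>)"]
      sq assms by simp
  have R: "((\<lambda>l. ln ((l - x)\<^sup>2 + y\<^sup>2) / 2 - ln ((l - x')\<^sup>2 + y'\<^sup>2) / 2) \<longlongrightarrow> 0) at_top"
    "((\<lambda>l. ln ((l - x)\<^sup>2 + y\<^sup>2) / 2 - ln ((l - x')\<^sup>2 + y'\<^sup>2) / 2) \<longlongrightarrow> 0) at_bot"
    for x y x' y' :: real
    by real_asymp+
  have T: "((\<lambda>l. arctan ((l - x) / y)) \<longlongrightarrow> sgn y * pi / 2) at_top"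
    "((\<lambda>l. arctan ((l - x) / y)) \<longlongrightarrow> - (sgn y * pi / 2)) at_bot" if "y \<noteq> 0" for x y :: real
    using that by (cases "y > 0"; simp add: sgn_if; real_asymp)+
  have lim: "((\<lambda>l. (F \<beta> l - F \<alpha> l) / (\<beta> - \<alpha>)) \<longlongrightarrow>
      (of_real 0 + \<i> * (of_real (sgn (Im \<beta>) * pi / 2) - of_real (sgn (Im \<alpha>) * pi / 2))) / (\<beta> - \<alpha>)) at_top"
    "((\<lambda>l. (F \<beta> l - F \<alpha> l) / (\<beta> - \<alpha>)) \<longlongrightarrow>
      (of_real 0 + \<i> * (of_real (- (sgn (Im \<beta>) * pi / 2)) - of_real (- (sgn (Im \<alpha>) * pi / 2)))) / (\<beta> - \<alpha>)) at_bot"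
  proof -
    have F: "F \<beta> l - F \<alpha> l = of_real (ln ((l - Re \<beta>)\<^sup>2 + (Im \<beta>)\<^sup>2) / 2 - ln ((l - Re \<alpha>)\<^sup>2 + (Im \<alpha>)\<^sup>2) / 2)
      + \<i> * (of_real (arctan ((l - Re \<beta>) / Im \<beta>)) - of_real (arctan ((l - Re \<alpha>) / Im \<alpha>)))" for l
      by (simp add: F_def algebra_simps)
    show "((\<lambda>l. (F \<beta> l - F \<alpha> l) / (\<beta> - \<alpha>)) \<longlongrightarrow>
      (of_real 0 + \<i> * (of_real (sgn (Im \<beta>) * pi / 2) - of_real (sgn (Im \<alpha>) * pi / 2))) / (\<beta> - \<alpha>)) at_top"
      "((\<lambda>l. (F \<beta> l - F \<alpha> l) / (\<beta> - \<alpha>)) \<longlongrightarrow>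
      (of_real 0 + \<i> * (of_real (- (sgn (Im \<beta>) * pi / 2)) - of_real (- (sgn (Im \<alpha>) * pi / 2)))) / (\<beta> - \<alpha>)) at_bot"
      unfolding F using assms by (intro tendsto_intros R T; simp)+
  qed
  show ?thesis
  proof -
    have "(of_real 0 + \<i> * (of_real (p / 2) - of_real (q / 2))) / d
        - (of_real 0 + \<i> * (of_real (- (p / 2)) - of_real (- (q / 2)))) / d
      = \<i> * (of_real p - of_real q) / d" for p q :: real and d :: complex
      by (cases "d = 0") (simp_all add: field_simps)
    from this[of "sgn (Im \<beta>) * pi" "sgn (Im \<alpha>) * pi" "\<beta> - \<alpha>"]
    show ?thesis
      unfolding integral_FTC_real_line[OF D cont int lim(2) lim(1)]
      by (simp add: algebra_simps)
  qed
qed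

text \<open>The confluent case \<open>\<alpha> = \<beta>\<close> of the previous integral, where
  dividing by \<open>\<beta> - \<alpha>\<close> is impossible; here the primitive is rational and
  vanishes at both ends.\<close>

lemma integral_cauchy_square:
  assumes "Im \<alpha> \<noteq> 0"
  shows "(LINT l|lborel. 1 / ((of_real l - \<alpha>) * (of_real l - \<alpha>))) = 0"
proof -
  have nz: "of_real l - \<alpha> \<noteq> 0" for l
    using assms by (auto simp: complex_eq_iff)
  have "((\<lambda>l. - (1 / (of_real l - \<alpha>))) has_vector_derivative
      1 / ((of_real l - \<alpha>) * (of_real l - \<alpha>))) (at l)" for l
  proof -
    have "((\<lambda>z. - (1 / (z - \<alpha>))) has_field_derivative 1 / ((of_real l - \<alpha>) * (of_real l - \<alpha>))) (at (of_real l))"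
      using nz[of l] by (auto intro!: derivative_eq_intros simp: field_simps)
    then show ?thesis
      by (rule has_vector_derivative_real_field)
  qed
  moreover have "isCont (\<lambda>l. 1 / ((of_real l - \<alpha>) * (of_real l - \<alpha>))) l" for l
    using nz by (auto intro!: continuous_intros)
  moreover have "integrable lborel (\<lambda>l. 1 / ((of_real l - \<alpha>) * (of_real l - \<alpha>)))"
  proof -
    have "(cmod (1 / (of_real l - \<alpha>)))\<^sup>2 = (cmod (cauchy_kernel (- Im \<alpha>) (Re \<alpha> - l)))\<^sup>2" for l
      unfolding norm_cauchy_kernel_sq by (simp add: norm_divide power_divide cmod_power2 power2_commute)
    then have "integrable lborel (\<lambda>l. (cmod (1 / (of_real l - \<alpha>)))\<^sup>2)"
      using integrable_norm_cauchy_kernel_sq[of "- Im \<alpha>" "Re \<alpha>"] assms by simp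
    then show ?thesis
      using integrable_mult_of_square_integrable[of "\<lambda>l. 1 / (of_real l - \<alpha>)" lborel "\<lambda>l. 1 / (of_real l - \<alpha>)"]
      by simp
  qed
  moreover have "((\<lambda>l. - (1 / (of_real l - \<alpha>))) \<longlongrightarrow> 0) F" if "F = at_bot \<or> F = at_top" for F
  proof -
    have "filterlim (\<lambda>l. of_real l :: complex) at_infinity F"
    proof -
      have "filterlim (\<lambda>l. \<bar>l\<bar>) at_top F"
        using filterlim_at_infinity_imp_norm_at_top[of "\<lambda>l::real. l" F] that
          at_top_le_at_infinity at_bot_le_at_infinity
        by (auto simp: filterlim_def)
      then show ?thesis
        using filterlim_norm_at_top_imp_at_infinity[of "\<lambda>l. of_real l :: complex" F] by simp
    qed
    then have "filterlim (\<lambda>l. of_real l - \<alpha>) at_infinity F"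
      using tendsto_add_filterlim_at_infinity'[of of_real F "\<lambda>_. - \<alpha>"] by auto
    then show ?thesis
      using tendsto_minus[OF tendsto_divide_0[OF tendsto_const]] by force
  qed
  ultimately show ?thesis
    using integral_FTC_real_line[of "\<lambda>l. - (1 / (of_real l - \<alpha>))"] by fastforce
qed

text \<open>The poles in \<open>l\<close> lie at \<open>z' - \<i> b\<close> and at
  \<open>z + \<i> a\<close> or \<open>z - \<i> a\<close>. In opposite half planes they reproduce a
  Cauchy kernel whose height is the sum of the two; in the same half plane the integral is 0. The
  semigroup and inner product identities below rest on this.\<close>

lemma integral_cauchy_kernel_mult:
  assumes "a > 0" "b > 0"
  shows "(LINT l|lborel. cauchy_kernel b (z' - l) * cauchy_kernel (- a) (z - l))
      = - 2 * \<i> * pi * cauchy_kernel (a + b) (z' - z)"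
    and "(LINT l|lborel. cauchy_kernel b (z' - l) * cauchy_kernel a (z - l)) = 0"
proof -
  have *: "cauchy_kernel b (z' - l) * cauchy_kernel c (z - l)
    = 1 / ((of_real l - Complex z' (- b)) * (of_real l - Complex z (- c)))" for c l
    unfolding cauchy_kernel_def Complex_eq by (simp add: algebra_simps)
  show "(LINT l|lborel. cauchy_kernel b (z' - l) * cauchy_kernel (- a) (z - l))
      = - 2 * \<i> * pi * cauchy_kernel (a + b) (z' - z)"
  proof -
    have "Complex z (- (- a)) - Complex z' (- b) = - (of_real (z' - z) - \<i> * of_real (a + b))"
      by (simp add: complex_eq_iff)
    moreover have "Complex z' (- b) \<noteq> Complex z (- (- a))"
      using assms by simp
    ultimately show ?thesis
      unfolding * cauchy_kernel_def[of "a + b"] using assms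
        integral_cauchy_product[of "Complex z' (- b)" "Complex z (- (- a))"]
      by (simp del: of_real_diff of_real_add minus_diff_eq add: minus_divide_right[symmetric])
  qed
  show "(LINT l|lborel. cauchy_kernel b (z' - l) * cauchy_kernel a (z - l)) = 0"
    unfolding * using assms
      integral_cauchy_product[of "Complex z' (- b)" "Complex z (- a)"]
      integral_cauchy_square[of "Complex z' (- b)"]
    by (cases "Complex z' (- b) = Complex z (- a)") auto
qed

lemma Cauchy_Schwarz_integral:
  fixes f g :: "'a \<Rightarrow> complex"
  assumes [measurable]: "f \<in> borel_measurable M" "g \<in> borel_measurable M"
    and f: "integrable M (\<lambda>x. (cmod (f x))\<^sup>2)" and g: "integrable M (\<lambda>x. (cmod (g x))\<^sup>2)"
  shows "(cmod (LINT x|M. f x * g x))\<^sup>2 \<le> (LINT x|M. (cmod (f x))\<^sup>2) * (LINT x|M. (cmod (g x))\<^sup>2)"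
proof -
  have fg: "integrable M (\<lambda>x. f x * g x)"
    by (rule integrable_mult_of_square_integrable) (use assms in auto)
  have nn: "(\<integral>\<^sup>+x. ennreal ((cmod (h x))\<^sup>2) \<partial>M) = ennreal (LINT x|M. (cmod (h x))\<^sup>2)"
    if "integrable M (\<lambda>x. (cmod (h x))\<^sup>2)" for h
    using that by (intro nn_integral_eq_integral) auto
  have "ennreal ((cmod (LINT x|M. f x * g x))\<^sup>2) = (ennreal (cmod (LINT x|M. f x * g x)))\<^sup>2"
    by (simp add: ennreal_power)
  also have "\<dots> \<le> (\<integral>\<^sup>+x. ennreal (norm (f x * g x)) \<partial>M)\<^sup>2"
    using integral_norm_bound_ennreal[OF fg] by (intro power_mono) auto
  also have "\<dots> = (\<integral>\<^sup>+x. ennreal (cmod (f x)) * ennreal (cmod (g x)) \<partial>M)\<^sup>2"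
    by (simp add: norm_mult ennreal_mult)
  also have "\<dots> \<le> (\<integral>\<^sup>+x. (ennreal (cmod (f x)))\<^sup>2 \<partial>M) * (\<integral>\<^sup>+x. (ennreal (cmod (g x)))\<^sup>2 \<partial>M)"
    by (rule Cauchy_Schwarz_nn_integral) auto
  also have "\<dots> = ennreal ((LINT x|M. (cmod (f x))\<^sup>2) * (LINT x|M. (cmod (g x))\<^sup>2))"
    using nn[OF f] nn[OF g] by (simp add: ennreal_power ennreal_mult)
  finally show ?thesis
    by (subst (asm) ennreal_le_iff) auto
qed

text \<open>Every interchange of Bochner integrals below goes through this criterion: an integrable
  density times a kernel whose \<open>L\<^sup>1\<close> norm in the second variable is uniformly
  bounded.\<close>

lemma integrable_mult_kernel:
  fixes h :: "real \<Rightarrow> complex" and K :: "real \<Rightarrow> real \<Rightarrow> complex"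
  assumes h: "integrable lborel h"
    and K [measurable]: "(\<lambda>(z, l). K z l) \<in> borel_measurable (lborel \<Otimes>\<^sub>M lborel)"
    and int: "\<And>z. integrable lborel (K z)"
    and bound: "\<And>z. (LINT l|lborel. cmod (K z l)) \<le> C"
  shows "integrable (lborel \<Otimes>\<^sub>M lborel) (\<lambda>(z, l). h z * K z l)"
proof (rule lborel_pair.Fubini_integrable)
  have [measurable]: "h \<in> borel_measurable borel"
    using borel_measurable_integrable[OF h] by simp
  show "(\<lambda>(z, l). h z * K z l) \<in> borel_measurable (lborel \<Otimes>\<^sub>M lborel)"
    by measurable
  have Kz: "0 \<le> (LINT l|lborel. cmod (K z l))" for z
    by simp
  have "integrable lborel (\<lambda>z. cmod (h z) * (LINT l|lborel. cmod (K z l)))"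
  proof (rule Bochner_Integration.integrable_bound)
    show "integrable lborel (\<lambda>z. C * cmod (h z))"
      using h by auto
    show "AE z in lborel. norm (cmod (h z) * (LINT l|lborel. cmod (K z l))) \<le> norm (C * cmod (h z))"
    proof (intro AE_I2)
      fix z
      have "norm (cmod (h z) * (LINT l|lborel. cmod (K z l))) = cmod (h z) * (LINT l|lborel. cmod (K z l))"
        using Kz by simp
      also have "\<dots> \<le> cmod (h z) * C"
        by (intro mult_left_mono bound) simp
      finally show "norm (cmod (h z) * (LINT l|lborel. cmod (K z l))) \<le> norm (C * cmod (h z))"
        by (simp add: mult.commute)
    qed
  qed measurable
  then show "integrable lborel (\<lambda>z. LINT l|lborel. norm (case (z, l) of (z, l) \<Rightarrow> h z * K z l))"
    by (simp add: norm_mult)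
  show "AE z in lborel. integrable lborel (\<lambda>l. case (z, l) of (z, l) \<Rightarrow> h z * K z l)"
    using int by simp
qed

section \<open>The Cauchy transform\<close>

text \<open>The Cauchy integral of \<open>h\<close> at the point \<open>l + \<i> a\<close>; the
  boundary operator takes its limit as \<open>a\<close> tends to 0 from one side.\<close>

definition cauchy_transform :: "(real \<Rightarrow> complex) \<Rightarrow> real \<Rightarrow> real \<Rightarrow> complex" where
  "cauchy_transform h a l = (LINT z|lborel. h z * cauchy_kernel a (z - l))"

lemma integrable_mult_cauchy_kernel:
  assumes "integrable lborel h" "a \<noteq> 0"
  shows "integrable lborel (\<lambda>z. h z * cauchy_kernel a (z - l))"
proof (rule Bochner_Integration.integrable_bound)
  show "integrable lborel (\<lambda>z. 1 / \<bar>a\<bar> * cmod (h z))"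
    using assms by auto
  have [measurable]: "h \<in> borel_measurable borel"
    using borel_measurable_integrable[OF assms(1)] by simp
  show "(\<lambda>z. h z * cauchy_kernel a (z - l)) \<in> borel_measurable lborel"
    by measurable
  have "cmod (h z) * cmod (cauchy_kernel a (z - l)) \<le> cmod (h z) * (1 / \<bar>a\<bar>)" for z
    by (intro mult_left_mono norm_cauchy_kernel_le assms) simp
  then show "AE z in lborel. norm (h z * cauchy_kernel a (z - l)) \<le> norm (1 / \<bar>a\<bar> * cmod (h z))"
    by (simp add: norm_mult mult.commute)
qed

lemma borel_measurable_cauchy_transform [measurable]:
  assumes [measurable]: "h \<in> borel_measurable borel"
  shows "cauchy_transform h a \<in> borel_measurable borel"
  unfolding cauchy_transform_def[abs_def] by measurable

text \<open>Both estimates come from \<open>1 / u - 1 / v = (v - u) / (u v)\<close> and the bound of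
  a kernel by the inverse of its height. They are useless as the height tends to 0 and serve only
  for continuity away from the real line.\<close>

lemma cauchy_transform_diff_le:
  assumes h: "integrable lborel h" and "a \<noteq> 0"
  shows "cmod (cauchy_transform h a l - cauchy_transform h a l') \<le> \<bar>l - l'\<bar> / a\<^sup>2 * (LINT z|lborel. cmod (h z))"
    and "b \<noteq> 0 \<Longrightarrow> cmod (cauchy_transform h a l - cauchy_transform h b l) \<le> \<bar>a - b\<bar> / \<bar>a * b\<bar> * (LINT z|lborel. cmod (h z))"
proof -
  have gen: "cmod (cauchy_transform h a l - cauchy_transform h b l') \<le> c * (LINT z|lborel. cmod (h z))"
    if b: "b \<noteq> 0" and c: "\<And>z. cmod (cauchy_kernel a (z - l) - cauchy_kernel b (z - l')) \<le> c" for b l' c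
  proof -
    note int = integrable_mult_cauchy_kernel[OF h \<open>a \<noteq> 0\<close>, of l] integrable_mult_cauchy_kernel[OF h b, of l']
    have "cauchy_transform h a l - cauchy_transform h b l'
      = (LINT z|lborel. h z * (cauchy_kernel a (z - l) - cauchy_kernel b (z - l')))"
      unfolding cauchy_transform_def using int
      by (simp add: right_diff_distrib)
    also have "cmod \<dots> \<le> (LINT z|lborel. c * cmod (h z))"
    proof (rule Bochner_Integration.integral_norm_bound_integral)
      show "integrable lborel (\<lambda>z. h z * (cauchy_kernel a (z - l) - cauchy_kernel b (z - l')))"
        using int by (simp add: right_diff_distrib)
      show "integrable lborel (\<lambda>z. c * cmod (h z))"
        using h by auto
      have "cmod (h z) * cmod (cauchy_kernel a (z - l) - cauchy_kernel b (z - l')) \<le> cmod (h z) * c" for z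
        by (intro mult_left_mono c) simp
      then show "cmod (h z * (cauchy_kernel a (z - l) - cauchy_kernel b (z - l'))) \<le> c * cmod (h z)" for z
        by (simp add: norm_mult mult.commute)
    qed
    finally show ?thesis by simp
  qed
  have *: "cmod (cauchy_kernel a x - cauchy_kernel b y)
    \<le> cmod ((of_real y - \<i> * of_real b) - (of_real x - \<i> * of_real a)) / \<bar>a * b\<bar>"
    if "b \<noteq> 0" for b x y
  proof -
    have "cauchy_kernel a x - cauchy_kernel b y =
      ((of_real y - \<i> * of_real b) - (of_real x - \<i> * of_real a)) * (cauchy_kernel a x * cauchy_kernel b y)"
      using cauchy_kernel_denom_nonzero[OF \<open>a \<noteq> 0\<close>, of x] cauchy_kernel_denom_nonzero[OF that, of y]
      unfolding cauchy_kernel_def by (simp add: diff_frac_eq)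
    also have "cmod \<dots> \<le> cmod ((of_real y - \<i> * of_real b) - (of_real x - \<i> * of_real a)) * (1 / \<bar>a\<bar> * (1 / \<bar>b\<bar>))"
      unfolding norm_mult
      by (intro mult_left_mono mult_mono norm_cauchy_kernel_le \<open>a \<noteq> 0\<close> that) auto
    finally show ?thesis by (simp add: abs_mult)
  qed
  show "cmod (cauchy_transform h a l - cauchy_transform h a l') \<le> \<bar>l - l'\<bar> / a\<^sup>2 * (LINT z|lborel. cmod (h z))"
  proof (rule gen[OF \<open>a \<noteq> 0\<close>])
    have "cmod (of_real (z - l') - \<i> * of_real a - (of_real (z - l) - \<i> * of_real a)) = \<bar>l - l'\<bar>" for z
    proof -
      have "of_real (z - l') - \<i> * of_real a - (of_real (z - l) - \<i> * of_real a) = complex_of_real (l - l')" by simp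
      then show ?thesis by (simp only: norm_of_real)
    qed
    then show "cmod (cauchy_kernel a (z - l) - cauchy_kernel a (z - l')) \<le> \<bar>l - l'\<bar> / a\<^sup>2" for z
      using *[OF \<open>a \<noteq> 0\<close>, of "z - l" "z - l'"] by (simp add: power2_eq_square abs_mult)
  qed
  show "cmod (cauchy_transform h a l - cauchy_transform h b l) \<le> \<bar>a - b\<bar> / \<bar>a * b\<bar> * (LINT z|lborel. cmod (h z))"
    if b: "b \<noteq> 0"
  proof (rule gen[OF b])
    have "cmod (of_real x - \<i> * of_real b - (of_real x - \<i> * of_real a)) = \<bar>a - b\<bar>" for x
    proof -
      have "of_real x - \<i> * of_real b - (of_real x - \<i> * of_real a) = \<i> * complex_of_real (a - b)"
        by (simp add: algebra_simps)
      then show ?thesis by (simp only: norm_mult norm_of_real) simp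
    qed
    then show "cmod (cauchy_kernel a (z - l) - cauchy_kernel b (z - l)) \<le> \<bar>a - b\<bar> / \<bar>a * b\<bar>" for z
      using *[OF b, of "z - l" "z - l"] by simp
  qed
qed

lemma isCont_cauchy_transform:
  assumes "integrable lborel h" "a \<noteq> 0"
  shows "isCont (cauchy_transform h a) l" "isCont (\<lambda>a. cauchy_transform h a l) a"
proof -
  define N where "N = (LINT z|lborel. cmod (h z))"
  have "((\<lambda>l'. \<bar>l' - l\<bar> / a\<^sup>2 * N) \<longlongrightarrow> \<bar>l - l\<bar> / a\<^sup>2 * N) (at l)"
    using assms by (intro tendsto_intros) auto
  moreover have "\<forall>\<^sub>F l' in at l. cmod (cauchy_transform h a l' - cauchy_transform h a l) \<le> \<bar>l' - l\<bar> / a\<^sup>2 * N"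
    using cauchy_transform_diff_le(1)[OF assms] by (simp add: N_def)
  ultimately have "((\<lambda>l'. cauchy_transform h a l' - cauchy_transform h a l) \<longlongrightarrow> 0) (at l)"
    by (auto intro: Lim_null_comparison)
  then show "isCont (cauchy_transform h a) l"
    by (simp add: isCont_def LIM_zero_iff)
  have "((\<lambda>b. \<bar>b - a\<bar> / \<bar>b * a\<bar> * N) \<longlongrightarrow> \<bar>a - a\<bar> / \<bar>a * a\<bar> * N) (at a)"
    using assms by (intro tendsto_intros) auto
  moreover have "\<forall>\<^sub>F b in at a. cmod (cauchy_transform h b l - cauchy_transform h a l) \<le> \<bar>b - a\<bar> / \<bar>b * a\<bar> * N"
  proof -
    have "\<forall>\<^sub>F b in at a. b \<noteq> 0"
      using assms(2) eventually_neq_at_within by blast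
    then show ?thesis
      by eventually_elim (use cauchy_transform_diff_le(2)[OF assms(1) _ assms(2)] in \<open>simp add: N_def\<close>)
  qed
  ultimately have "((\<lambda>b. cauchy_transform h b l - cauchy_transform h a l) \<longlongrightarrow> 0) (at a)"
    by (auto intro: Lim_null_comparison)
  then show "isCont (\<lambda>a. cauchy_transform h a l) a"
    by (simp add: isCont_def LIM_zero_iff)
qed

lemma mult_le_sum_squares:
  fixes x y :: real
  assumes "0 \<le> x" "0 \<le> y"
  shows "x * y \<le> x\<^sup>2 + y\<^sup>2"
  using sum_squares_bound[of x y] mult_nonneg_nonneg[OF assms] by linarith

text \<open>Supplies the uniform kernel bound that Fubini requires when a transform is paired with a
  square integrable function.\<close>

lemma integrable_norm_cauchy_kernel_mult:
  assumes "b \<noteq> 0" and [measurable]: "\<psi> \<in> borel_measurable borel"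
    and \<psi>: "integrable lborel (\<lambda>l. (cmod (\<psi> l))\<^sup>2)"
  shows "integrable lborel (\<lambda>l. cauchy_kernel b (z - l) * \<psi> l)"
    "(LINT l|lborel. cmod (cauchy_kernel b (z - l) * \<psi> l)) \<le> pi / \<bar>b\<bar> + (LINT l|lborel. (cmod (\<psi> l))\<^sup>2)"
proof -
  show int: "integrable lborel (\<lambda>l. cauchy_kernel b (z - l) * \<psi> l)"
    using assms by (intro integrable_mult_of_square_integrable integrable_norm_cauchy_kernel_sq) auto
  have "(LINT l|lborel. cmod (cauchy_kernel b (z - l) * \<psi> l))
    \<le> (LINT l|lborel. (cmod (cauchy_kernel b (z - l)))\<^sup>2 + (cmod (\<psi> l))\<^sup>2)"
  proof (rule integral_mono)
    show "integrable lborel (\<lambda>l. (cmod (cauchy_kernel b (z - l)))\<^sup>2 + (cmod (\<psi> l))\<^sup>2)"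
      using assms by (auto intro: integrable_norm_cauchy_kernel_sq)
    fix l
    show "cmod (cauchy_kernel b (z - l) * \<psi> l) \<le> (cmod (cauchy_kernel b (z - l)))\<^sup>2 + (cmod (\<psi> l))\<^sup>2"
      unfolding norm_mult by (rule mult_le_sum_squares) auto
  qed (use int in auto)
  also have "\<dots> = pi / \<bar>b\<bar> + (LINT l|lborel. (cmod (\<psi> l))\<^sup>2)"
    using assms by (simp add: integrable_norm_cauchy_kernel_sq integral_norm_cauchy_kernel_sq)
  finally show "(LINT l|lborel. cmod (cauchy_kernel b (z - l) * \<psi> l)) \<le> pi / \<bar>b\<bar> + (LINT l|lborel. (cmod (\<psi> l))\<^sup>2)" .
qed

text \<open>Fubini moves the transform from \<open>h\<close> onto \<open>\<psi>\<close>. If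
  \<open>\<psi>\<close> is itself a Cauchy kernel, the inner integral is explicit.\<close>

lemma integral_cauchy_transform_mult:
  assumes h: "integrable lborel h" and b: "b \<noteq> 0" and [measurable]: "\<psi> \<in> borel_measurable borel"
    and \<psi>: "integrable lborel (\<lambda>l. (cmod (\<psi> l))\<^sup>2)"
  shows "integrable lborel (\<lambda>l. cauchy_transform h b l * \<psi> l)"
    "(LINT l|lborel. cauchy_transform h b l * \<psi> l)
      = (LINT z|lborel. h z * (LINT l|lborel. cauchy_kernel b (z - l) * \<psi> l))"
proof -
  have [measurable]: "h \<in> borel_measurable borel"
    using borel_measurable_integrable[OF h] by simp
  have "integrable (lborel \<Otimes>\<^sub>M lborel) (\<lambda>(z, l). h z * (cauchy_kernel b (z - l) * \<psi> l))"
    using assms by (intro integrable_mult_kernel[where C = "pi / \<bar>b\<bar> + (LINT l|lborel. (cmod (\<psi> l))\<^sup>2)"]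
        integrable_norm_cauchy_kernel_mult) auto
  note F = lborel_pair.integrable_snd[OF this] lborel_pair.Fubini_integral[OF this]
  have "cauchy_transform h b l * \<psi> l = (LINT z|lborel. h z * (cauchy_kernel b (z - l) * \<psi> l))" for l
    unfolding cauchy_transform_def by (simp add: mult.assoc[symmetric])
  with F show "integrable lborel (\<lambda>l. cauchy_transform h b l * \<psi> l)"
    "(LINT l|lborel. cauchy_transform h b l * \<psi> l)
      = (LINT z|lborel. h z * (LINT l|lborel. cauchy_kernel b (z - l) * \<psi> l))"
    by simp_all
qed

lemma borel_measurable_cnj [measurable]:
  "f \<in> borel_measurable M \<Longrightarrow> (\<lambda>x. cnj (f x)) \<in> borel_measurable M"
  by (rule borel_measurable_continuous_on[of cnj]) (intro continuous_intros)

section \<open>The Poisson kernel and the semigroup of heights\<close>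

definition poisson_kernel :: "real \<Rightarrow> real \<Rightarrow> real" where
  "poisson_kernel a x = a / pi * (1 / (x\<^sup>2 + a\<^sup>2))"

lemma poisson_kernel_nonneg: "a > 0 \<Longrightarrow> 0 \<le> poisson_kernel a x"
  by (simp add: poisson_kernel_def)

lemma borel_measurable_poisson_kernel [measurable]: "poisson_kernel a \<in> borel_measurable borel"
  unfolding poisson_kernel_def[abs_def] by measurable

lemma
  assumes "a > 0"
  shows integrable_poisson_kernel: "integrable lborel (\<lambda>l. poisson_kernel a (z - l))"
    and integral_poisson_kernel: "(LINT l|lborel. poisson_kernel a (z - l)) = 1"
proof -
  have *: "integrable lborel (\<lambda>l. 1 / ((z - l)\<^sup>2 + a\<^sup>2))" "(LINT l|lborel. 1 / ((z - l)\<^sup>2 + a\<^sup>2)) = pi / a"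
    using integrable_norm_cauchy_kernel_sq[of a z] integral_norm_cauchy_kernel_sq[of a z] assms
    by (simp_all add: norm_cauchy_kernel_sq)
  show "integrable lborel (\<lambda>l. poisson_kernel a (z - l))"
    unfolding poisson_kernel_def by (intro integrable_mult_right *)
  show "(LINT l|lborel. poisson_kernel a (z - l)) = 1"
    unfolding poisson_kernel_def integral_mult_right_zero * using assms by simp
qed

lemma poisson_kernel_eq_cauchy_kernel:
  assumes "a > 0"
  shows "of_real (poisson_kernel a x) = (cauchy_kernel a x - cauchy_kernel (- a) x) / (2 * \<i> * pi)"
proof -
  have "(of_real x - \<i> * of_real a) * (of_real x - \<i> * of_real (- a)) = complex_of_real (x\<^sup>2 + a\<^sup>2)"
    by (simp add: complex_eq_iff power2_eq_square)
  then have "cauchy_kernel a x - cauchy_kernel (- a) x = 2 * \<i> * of_real (a * (1 / (x\<^sup>2 + a\<^sup>2)))"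
    using assms cauchy_kernel_denom_nonzero[of a x] cauchy_kernel_denom_nonzero[of "- a" x]
    unfolding cauchy_kernel_def by (subst diff_frac_eq) auto
  then show ?thesis
    by (simp add: poisson_kernel_def)
qed

text \<open>The Poisson kernel is a difference of Cauchy kernels of heights \<open>a\<close> and
  \<open>- a\<close>. One of them has its pole in the same half plane as the kernel of the transform
  and contributes 0; the other adds the heights. Hence the transform at a greater height is a
  Poisson average of the one at a smaller height.\<close>

lemma cauchy_transform_poisson:
  assumes h: "integrable lborel h" and "a > 0" "b > 0"
  shows "integrable lborel (\<lambda>l. cauchy_transform h b l * of_real (poisson_kernel a (z - l)))"
    "(LINT l|lborel. cauchy_transform h b l * of_real (poisson_kernel a (z - l))) = cauchy_transform h (a + b) z"
proof -
  have sq: "integrable lborel (\<lambda>l. (cmod (cauchy_kernel c (z - l)))\<^sup>2)" if "c \<noteq> 0" for c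
    by (rule integrable_norm_cauchy_kernel_sq[OF that])
  note M = integral_cauchy_transform_mult[OF h, where b = b and \<psi> = "\<lambda>l. cauchy_kernel c (z - l)" for c]
  note 1 = M[of a] note 2 = M[of "- a"]
  have split: "cauchy_transform h b l * of_real (poisson_kernel a (z - l)) =
      (cauchy_transform h b l * cauchy_kernel a (z - l) - cauchy_transform h b l * cauchy_kernel (- a) (z - l)) / (2 * \<i> * pi)" for l
    unfolding poisson_kernel_eq_cauchy_kernel[OF \<open>a > 0\<close>] by (simp add: algebra_simps)
  show "integrable lborel (\<lambda>l. cauchy_transform h b l * of_real (poisson_kernel a (z - l)))"
    unfolding split using 1(1) 2(1) sq assms by simp
  have "(LINT l|lborel. cauchy_transform h b l * of_real (poisson_kernel a (z - l)))
    = (0 - (LINT z'|lborel. h z' * (- 2 * \<i> * pi * cauchy_kernel (a + b) (z' - z)))) / (2 * \<i> * pi)"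
    unfolding split using 1 2 sq assms integral_cauchy_kernel_mult[OF \<open>a > 0\<close> \<open>b > 0\<close>]
    by simp
  also have "\<dots> = cauchy_transform h (a + b) z"
    by (simp add: cauchy_transform_def mult.left_commute[of "h _"])
  finally show "(LINT l|lborel. cauchy_transform h b l * of_real (poisson_kernel a (z - l))) = cauchy_transform h (a + b) z" .
qed

text \<open>Splitting \<open>cmod (h z)\<close> into two square roots and applying Cauchy-Schwarz
  bounds the square by the norm of \<open>h\<close> in \<open>L\<^sup>1\<close> times the integral
  of \<open>cmod (h z)\<close> against the squared kernel, which Fubini integrates. This uses only
  integrability of \<open>h\<close>, at the price of a bound that blows up as \<open>a\<close> tends
  to 0; the uniform bound needs \<open>h\<close> in \<open>L\<^sup>2\<close> and comes
  later.\<close>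

lemma integrable_cauchy_transform_sq:
  assumes h: "integrable lborel h" and a: "a \<noteq> 0"
  shows "integrable lborel (\<lambda>l. (cmod (cauchy_transform h a l))\<^sup>2)"
proof -
  have [measurable]: "h \<in> borel_measurable borel"
    using borel_measurable_integrable[OF h] by simp
  have "integrable (lborel \<Otimes>\<^sub>M lborel)
      (\<lambda>(z, l). of_real (cmod (h z)) * complex_of_real ((cmod (cauchy_kernel a (z - l)))\<^sup>2))"
  proof (rule integrable_mult_kernel[where C = "pi / \<bar>a\<bar>"])
    show "integrable lborel (\<lambda>z. complex_of_real (cmod (h z)))"
      using h by auto
    show "integrable lborel (\<lambda>l. complex_of_real ((cmod (cauchy_kernel a (z - l)))\<^sup>2))" for z
      using integrable_norm_cauchy_kernel_sq[OF a, of z] by (simp only: integrable_of_real)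
    show "(LINT l|lborel. cmod (complex_of_real ((cmod (cauchy_kernel a (z - l)))\<^sup>2))) \<le> pi / \<bar>a\<bar>" for z
      using integral_norm_cauchy_kernel_sq[OF a, of z] by (simp add: norm_power)
  qed measurable
  from lborel_pair.integrable_snd[OF this]
  have "integrable lborel (\<lambda>l. LINT z|lborel. complex_of_real (cmod (h z) * (cmod (cauchy_kernel a (z - l)))\<^sup>2))"
    by simp
  then have "integrable lborel (\<lambda>l. LINT z|lborel. cmod (h z) * (cmod (cauchy_kernel a (z - l)))\<^sup>2)"
    unfolding integral_complex_of_real complex_of_real_integrable_eq .
  then have int: "integrable lborel (\<lambda>l. (LINT z|lborel. cmod (h z)) * (LINT z|lborel. cmod (h z) * (cmod (cauchy_kernel a (z - l)))\<^sup>2))"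
    by simp
  show ?thesis
  proof (rule Bochner_Integration.integrable_bound[OF int])
    show "AE l in lborel. norm ((cmod (cauchy_transform h a l))\<^sup>2)
      \<le> norm ((LINT z|lborel. cmod (h z)) * (LINT z|lborel. cmod (h z) * (cmod (cauchy_kernel a (z - l)))\<^sup>2))"
    proof (intro AE_I2)
      fix l
      let ?s = "\<lambda>z. complex_of_real (sqrt (cmod (h z)))"
      have int2: "integrable lborel (\<lambda>z. cmod (h z) * (cmod (cauchy_kernel a (z - l)))\<^sup>2)"
      proof (rule Bochner_Integration.integrable_bound)
        show "integrable lborel (\<lambda>z. (1 / \<bar>a\<bar>)\<^sup>2 * cmod (h z))" using h by auto
        have "cmod (h z) * (cmod (cauchy_kernel a (z - l)))\<^sup>2 \<le> cmod (h z) * (1 / \<bar>a\<bar>)\<^sup>2" for z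
          by (intro mult_left_mono power_mono norm_cauchy_kernel_le a) auto
        then show "AE z in lborel. norm (cmod (h z) * (cmod (cauchy_kernel a (z - l)))\<^sup>2) \<le> norm ((1 / \<bar>a\<bar>)\<^sup>2 * cmod (h z))"
          by (simp add: mult.commute)
      qed measurable
      have "cmod (cauchy_transform h a l) \<le> (LINT z|lborel. cmod (h z * cauchy_kernel a (z - l)))"
        unfolding cauchy_transform_def by (rule integral_norm_bound)
      also have "\<dots> = Re (LINT z|lborel. ?s z * (?s z * of_real (cmod (cauchy_kernel a (z - l)))))"
      proof -
        have "?s z * (?s z * of_real (cmod (cauchy_kernel a (z - l)))) = of_real (cmod (h z * cauchy_kernel a (z - l)))" for z
        proof -
          have "?s z * ?s z = of_real (cmod (h z))"
            by (simp flip: of_real_mult)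
          then show ?thesis by (simp add: norm_mult mult.assoc[symmetric])
        qed
        then show ?thesis by (simp only: integral_complex_of_real Re_complex_of_real)
      qed
      also have "\<dots> \<le> cmod (LINT z|lborel. ?s z * (?s z * of_real (cmod (cauchy_kernel a (z - l)))))"
        by (rule complex_Re_le_cmod)
      finally have "(cmod (cauchy_transform h a l))\<^sup>2 \<le> (cmod (LINT z|lborel. ?s z * (?s z * of_real (cmod (cauchy_kernel a (z - l))))))\<^sup>2"
        by (rule power_mono) simp
      also have "\<dots> \<le> (LINT z|lborel. (cmod (?s z))\<^sup>2) * (LINT z|lborel. (cmod (?s z * of_real (cmod (cauchy_kernel a (z - l)))))\<^sup>2)"
        using h int2 by (intro Cauchy_Schwarz_integral) (auto simp: norm_mult power_mult_distrib)
      finally show "norm ((cmod (cauchy_transform h a l))\<^sup>2)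
        \<le> norm ((LINT z|lborel. cmod (h z)) * (LINT z|lborel. cmod (h z) * (cmod (cauchy_kernel a (z - l)))\<^sup>2))"
        by (simp add: norm_mult power_mult_distrib)
    qed
  qed measurable
qed

text \<open>Jensen's inequality for the probability density \<open>poisson_kernel a\<close>,
  obtained from Cauchy-Schwarz by splitting the kernel into two square roots. Integrability holds
  because the kernel is bounded for fixed \<open>a\<close>.\<close>

lemma poisson_jensen:
  fixes g :: "real \<Rightarrow> complex"
  assumes "a > 0" and [measurable]: "g \<in> borel_measurable borel"
    and g: "integrable lborel (\<lambda>l. (cmod (g l))\<^sup>2)"
  shows "integrable lborel (\<lambda>l. (cmod (g l))\<^sup>2 * poisson_kernel a (z - l))"
    "(cmod (LINT l|lborel. g l * of_real (poisson_kernel a (z - l))))\<^sup>2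
      \<le> (LINT l|lborel. (cmod (g l))\<^sup>2 * poisson_kernel a (z - l))"
proof -
  have P: "0 \<le> poisson_kernel a x" for x
    using assms by (simp add: poisson_kernel_nonneg)
  have P2: "poisson_kernel a x \<le> 1 / (a * pi)" for x
  proof -
    have "a / pi * (1 / (x\<^sup>2 + a\<^sup>2)) \<le> a / pi * (1 / a\<^sup>2)"
      using assms by (intro mult_left_mono frac_le) auto
    then show ?thesis
      using assms by (simp add: poisson_kernel_def power2_eq_square mult.commute)
  qed
  show int: "integrable lborel (\<lambda>l. (cmod (g l))\<^sup>2 * poisson_kernel a (z - l))"
  proof (rule Bochner_Integration.integrable_bound)
    show "integrable lborel (\<lambda>l. (cmod (g l))\<^sup>2 * (1 / (a * pi)))"
      using g by auto
    show "AE l in lborel. norm ((cmod (g l))\<^sup>2 * poisson_kernel a (z - l)) \<le> norm ((cmod (g l))\<^sup>2 * (1 / (a * pi)))"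
    proof (intro AE_I2)
      fix l
      have "(cmod (g l))\<^sup>2 * poisson_kernel a (z - l) \<le> (cmod (g l))\<^sup>2 * (1 / (a * pi))"
        by (intro mult_left_mono P2) auto
      then show "norm ((cmod (g l))\<^sup>2 * poisson_kernel a (z - l)) \<le> norm ((cmod (g l))\<^sup>2 * (1 / (a * pi)))"
        using P assms by simp
    qed
  qed measurable
  let ?s = "\<lambda>l. complex_of_real (sqrt (poisson_kernel a (z - l)))"
  have s: "?s l * ?s l = of_real (poisson_kernel a (z - l))" for l
    using P by (simp flip: of_real_mult)
  have "(cmod (LINT l|lborel. (g l * ?s l) * ?s l))\<^sup>2
    \<le> (LINT l|lborel. (cmod (g l * ?s l))\<^sup>2) * (LINT l|lborel. (cmod (?s l))\<^sup>2)"
    using int integrable_poisson_kernel[OF \<open>a > 0\<close>, of z] P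
    by (intro Cauchy_Schwarz_integral) (auto simp: norm_mult power_mult_distrib)
  then show "(cmod (LINT l|lborel. g l * of_real (poisson_kernel a (z - l))))\<^sup>2
      \<le> (LINT l|lborel. (cmod (g l))\<^sup>2 * poisson_kernel a (z - l))"
    using integral_poisson_kernel[OF \<open>a > 0\<close>, of z] P
    by (simp add: mult.assoc s norm_mult power_mult_distrib)
qed

lemma poisson_integral_contraction:
  fixes g :: "real \<Rightarrow> complex"
  assumes a: "a > 0" and [measurable]: "g \<in> borel_measurable borel"
    and g: "integrable lborel (\<lambda>l. (cmod (g l))\<^sup>2)"
  shows "integrable lborel (\<lambda>z. LINT l|lborel. (cmod (g l))\<^sup>2 * poisson_kernel a (z - l))"
    "(LINT z|lborel. LINT l|lborel. (cmod (g l))\<^sup>2 * poisson_kernel a (z - l)) = (LINT l|lborel. (cmod (g l))\<^sup>2)"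
proof -
  have sym: "poisson_kernel a (z - l) = poisson_kernel a (l - z)" for z l
    by (simp add: poisson_kernel_def power2_commute)
  have nn: "0 \<le> poisson_kernel a x" for x
    using a by (simp add: poisson_kernel_nonneg)
  have "integrable (lborel \<Otimes>\<^sub>M lborel) (\<lambda>(l, z). of_real ((cmod (g l))\<^sup>2) * complex_of_real (poisson_kernel a (z - l)))"
  proof (rule integrable_mult_kernel[where C = 1])
    show "integrable lborel (\<lambda>l. complex_of_real ((cmod (g l))\<^sup>2))"
      using g by (simp only: integrable_of_real)
    show "integrable lborel (\<lambda>l. complex_of_real (poisson_kernel a (l - z)))" for z
      using integrable_poisson_kernel[OF a, of z] by (simp add: sym)
    show "(LINT l|lborel. cmod (complex_of_real (poisson_kernel a (l - z)))) \<le> 1" for z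
      using integral_poisson_kernel[OF a, of z] nn by (simp add: sym)
  qed measurable
  then have int: "integrable (lborel \<Otimes>\<^sub>M lborel) (\<lambda>(l, z). (cmod (g l))\<^sup>2 * poisson_kernel a (z - l))"
    unfolding of_real_mult[symmetric] complex_of_real_integrable_eq[symmetric]
    by (simp add: split_def)
  from lborel_pair.integrable_snd[OF int]
  show "integrable lborel (\<lambda>z. LINT l|lborel. (cmod (g l))\<^sup>2 * poisson_kernel a (z - l))" .
  from lborel_pair.Fubini_integral[OF int]
  show "(LINT z|lborel. LINT l|lborel. (cmod (g l))\<^sup>2 * poisson_kernel a (z - l)) = (LINT l|lborel. (cmod (g l))\<^sup>2)"
    using integral_poisson_kernel[OF a] by (simp add: sym)
qed

text \<open>Positivity of this inner product, its dependence on \<open>a + b\<close> only, and the contraction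
  property of the Poisson kernel replace Plancherel's theorem.\<close>

lemma cauchy_transform_inner:
  assumes h: "integrable lborel h" and "a > 0" "b > 0"
  shows "(LINT l|lborel. cauchy_transform h a l * cnj (cauchy_transform h b l))
    = 2 * \<i> * pi * (LINT z|lborel. h z * cnj (cauchy_transform h (a + b) z))"
proof -
  have [measurable]: "h \<in> borel_measurable borel"
    using borel_measurable_integrable[OF h] by simp
  have inner: "(LINT l|lborel. cauchy_kernel a (z - l) * cnj (cauchy_transform h b l))
    = 2 * \<i> * pi * cnj (cauchy_transform h (a + b) z)" for z
  proof -
    have "(LINT l|lborel. cauchy_transform h b l * cauchy_kernel (- a) (z - l))
      = (LINT z'|lborel. h z' * (- 2 * \<i> * pi * cauchy_kernel (a + b) (z' - z)))"
      using assms integral_cauchy_kernel_mult(1)[OF \<open>a > 0\<close> \<open>b > 0\<close>]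
        integrable_norm_cauchy_kernel_sq[of "- a" z]
      by (subst integral_cauchy_transform_mult) auto
    also have "\<dots> = - 2 * \<i> * pi * cauchy_transform h (a + b) z"
      by (simp add: cauchy_transform_def mult.left_commute[of "h _"])
    finally have "cnj (LINT l|lborel. cauchy_transform h b l * cauchy_kernel (- a) (z - l))
      = 2 * \<i> * pi * cnj (cauchy_transform h (a + b) z)"
      by simp
    moreover have "(LINT l|lborel. cauchy_kernel a (z - l) * cnj (cauchy_transform h b l))
      = (LINT l|lborel. cnj (cauchy_transform h b l * cauchy_kernel (- a) (z - l)))"
      by (intro Bochner_Integration.integral_cong refl) (simp add: cnj_cauchy_kernel mult.commute)
    ultimately show ?thesis
      by (simp only: Bochner_Integration.integral_cnj)
  qed
  have "(\<lambda>l. cnj (cauchy_transform h b l)) \<in> borel_measurable borel"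
    by measurable
  then show ?thesis
    using assms integrable_cauchy_transform_sq[OF h, of b]
    by (subst integral_cauchy_transform_mult) (auto simp: inner mult.left_commute[of "h _"])
qed

section \<open>Boundary values almost everywhere\<close>

text \<open>Vitali's covering lemma selects countably many disjoint balls whose fivefold
  enlargements cover \<open>S\<close>; on each of them the mass of \<open>u\<close> is at least
  \<open>\<alpha>\<close> times the length. Speaking of a measurable set \<open>S\<close> on which
  some average is large avoids introducing a maximal function.\<close>

lemma hardy_littlewood_weak_type:
  fixes u :: "real \<Rightarrow> ennreal"
  assumes [measurable]: "u \<in> borel_measurable borel" "S \<in> sets borel"
    and fin: "(\<integral>\<^sup>+y. u y \<partial>lborel) < \<infinity>" and \<alpha>: "\<alpha> > 0"
    and S: "\<And>x. x \<in> S \<Longrightarrow> \<exists>r>0. ennreal (2 * r * \<alpha>) \<le> (\<integral>\<^sup>+y. u y * indicator (cball x r) y \<partial>lborel)"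
  shows "ennreal \<alpha> * emeasure lborel S \<le> 5 * (\<integral>\<^sup>+y. u y \<partial>lborel)"
proof -
  obtain r where r: "\<And>x. x \<in> S \<Longrightarrow> r x > 0"
    "\<And>x. x \<in> S \<Longrightarrow> ennreal (2 * r x * \<alpha>) \<le> (\<integral>\<^sup>+y. u y * indicator (cball x (r x)) y \<partial>lborel)"
    using S by metis
  obtain N where N: "(\<integral>\<^sup>+y. u y \<partial>lborel) = ennreal N" "N \<ge> 0"
    using fin by (cases "\<integral>\<^sup>+y. u y \<partial>lborel") auto
  \<comment> \<open>The covering lemma requires bounded radii: a ball with average at least
    \<open>\<alpha>\<close> has length at most the total mass divided by
    \<open>\<alpha>\<close>.\<close>
  have rb: "0 < r x \<and> r x \<le> N / (2 * \<alpha>)" if x: "x \<in> S" for x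
  proof -
    have "ennreal (2 * r x * \<alpha>) \<le> (\<integral>\<^sup>+y. u y * indicator (cball x (r x)) y \<partial>lborel)"
      using r(2)[OF x] .
    also have "\<dots> \<le> (\<integral>\<^sup>+y. u y \<partial>lborel)"
      by (intro nn_integral_mono) (auto split: split_indicator)
    finally have "2 * r x * \<alpha> \<le> N"
      using N by (simp add: ennreal_le_iff)
    then show ?thesis
      using r(1)[OF x] \<alpha> by (simp add: field_simps)
  qed
  have "S \<subseteq> (\<Union>i\<in>S. cball i (r i))"
    using r(1) by force
  then obtain C where C: "countable C" "C \<subseteq> S"
     "pairwise (\<lambda>i j. disjnt (cball i (r i)) (cball j (r j))) C"
     "S \<subseteq> (\<Union>i\<in>C. cball i (5 * r i))"
    by (rule Vitali_covering_lemma_cballs[where a = "\<lambda>x. x" and r = r and B = "N / (2 * \<alpha>)"]) (use rb in auto)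
  have len: "emeasure lborel (cball i d) = ennreal (2 * d)" if "d \<ge> 0" for i d :: real
    using that by (simp add: cball_eq_atLeastAtMost)
  have "emeasure lborel S = (\<integral>\<^sup>+x. indicator S x \<partial>lborel)"
    by simp
  \<comment> \<open>The sum over the centres is written as an integral over the counting measure on
    \<open>C\<close>, so that it can be exchanged with the Lebesgue integral.\<close>
  also have "\<dots> \<le> (\<integral>\<^sup>+x. \<integral>\<^sup>+i. indicator (cball i (5 * r i)) x \<partial>count_space C \<partial>lborel)"
  proof (rule nn_integral_mono)
    fix x
    show "indicator S x \<le> (\<integral>\<^sup>+i. indicator (cball i (5 * r i)) x \<partial>count_space C)"
    proof (cases "x \<in> S")
      case True
      then obtain i where i: "i \<in> C" "x \<in> cball i (5 * r i)"
        using C(4) by blast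
      then show ?thesis
        using nn_integral_ge_point[OF i(1), of "\<lambda>i. indicator (cball i (5 * r i)) x"] True by simp
    qed simp
  qed
  also have "\<dots> = (\<integral>\<^sup>+i. \<integral>\<^sup>+x. indicator (cball i (5 * r i)) x \<partial>lborel \<partial>count_space C)"
    by (rule nn_integral_count_space_nn_integral) (use C in \<open>auto intro!: borel_measurable_indicator\<close>)
  also have "\<dots> = (\<integral>\<^sup>+i. 5 * ennreal (2 * r i) \<partial>count_space C)"
  proof (intro nn_integral_cong)
    fix i assume "i \<in> space (count_space C)"
    then have "r i > 0" using C(2) r(1) by auto
    then show "(\<integral>\<^sup>+x. indicator (cball i (5 * r i)) x \<partial>lborel) = 5 * ennreal (2 * r i)"
      using ennreal_mult[of 5 "2 * r i"] by (simp add: len)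
  qed
  finally have "ennreal \<alpha> * emeasure lborel S \<le> ennreal \<alpha> * (\<integral>\<^sup>+i. 5 * ennreal (2 * r i) \<partial>count_space C)"
    by (rule mult_left_mono) simp
  also have "\<dots> = 5 * (\<integral>\<^sup>+i. ennreal (2 * r i * \<alpha>) \<partial>count_space C)"
  proof -
    have "ennreal \<alpha> * (5 * ennreal (2 * r i)) = 5 * ennreal (2 * r i * \<alpha>)" if "i \<in> C" for i
      using \<alpha> r(1)[of i] C(2) that ennreal_mult[of "2 * r i" \<alpha>] by (auto simp: mult_ac)
    then show ?thesis
      by (simp add: nn_integral_cmult[symmetric] cong: nn_integral_cong_simp)
  qed
  also have "\<dots> \<le> 5 * (\<integral>\<^sup>+i. emeasure (density lborel u) (cball i (r i)) \<partial>count_space C)"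
    using C(2) r(2) by (intro mult_left_mono nn_integral_mono) (auto simp: emeasure_density)
  also have "\<dots> = 5 * emeasure (density lborel u) (\<Union>i\<in>C. cball i (r i))"
    using C(1,3) by (subst emeasure_UN_countable)
      (auto simp: disjoint_family_on_def pairwise_def disjnt_def)
  also have "\<dots> \<le> 5 * emeasure (density lborel u) UNIV"
    using C(1) by (intro mult_left_mono emeasure_mono) auto
  also have "\<dots> = 5 * (\<integral>\<^sup>+y. u y \<partial>lborel)"
    by (simp add: emeasure_density)
  finally show ?thesis .
qed

text \<open>The Poisson kernel is a superposition of normalised indicators of centred intervals.\<close>

lemma poisson_layer_cake:
  fixes v :: "real \<Rightarrow> ennreal"
  assumes a: "a > 0" and [measurable]: "v \<in> borel_measurable borel"
  shows "(\<integral>\<^sup>+y. v y * ennreal (poisson_kernel a (x - y)) \<partial>lborel)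
    = (\<integral>\<^sup>+r. ennreal (2 * a / pi * r / (r\<^sup>2 + a\<^sup>2)\<^sup>2) * indicator {0<..} r
         * (\<integral>\<^sup>+y. v y * indicator (cball x r) y \<partial>lborel) \<partial>lborel)"
proof -
  let ?\<rho> = "\<lambda>r. 2 * a / pi * r / (r\<^sup>2 + a\<^sup>2)\<^sup>2"
  have pos: "r\<^sup>2 + a\<^sup>2 > 0" for r :: real
    using a by (simp add: add_nonneg_pos)
  \<comment> \<open>\<open>?\<rho>\<close> is minus the derivative of the Poisson kernel, which
    vanishes at infinity; so the value at \<open>t\<close> is the integral of \<open>?\<rho>\<close>
    over all radii beyond \<open>\<bar>t\<bar>\<close>.\<close>
  have P: "ennreal (poisson_kernel a t) = (\<integral>\<^sup>+r. ennreal (?\<rho> r) * indicator {\<bar>t\<bar>..} r \<partial>lborel)" for t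
  proof -
    have "(\<integral>\<^sup>+r. ennreal (?\<rho> r) * indicator {\<bar>t\<bar>..} r \<partial>lborel) = ennreal (0 - (- poisson_kernel a \<bar>t\<bar>))"
    proof (rule nn_integral_FTC_atLeast[where F = "\<lambda>t. - poisson_kernel a t"])
      show "?\<rho> \<in> borel_measurable borel"
        by measurable
      show "((\<lambda>t. - poisson_kernel a t) has_real_derivative ?\<rho> r) (at r)" for r
      proof -
        have "((\<lambda>t. 1 / (t\<^sup>2 + a\<^sup>2)) has_real_derivative - (2 * r) / (r\<^sup>2 + a\<^sup>2)\<^sup>2) (at r)"
          using pos[of r] by (auto intro!: derivative_eq_intros simp: power2_eq_square[of "r\<^sup>2 + a\<^sup>2"])
        then have "((\<lambda>t. - (a / pi * (1 / (t\<^sup>2 + a\<^sup>2)))) has_real_derivative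
            - (a / pi * (- (2 * r) / (r\<^sup>2 + a\<^sup>2)\<^sup>2))) (at r)"
          by (intro DERIV_minus DERIV_cmult)
        moreover have "- (a / pi * (- (2 * r) / (r\<^sup>2 + a\<^sup>2)\<^sup>2)) = ?\<rho> r"
          by simp
        ultimately show ?thesis
          unfolding poisson_kernel_def by (simp only:)
      qed
      show "0 \<le> ?\<rho> r" if "\<bar>t\<bar> \<le> r" for r
        using that a by (intro divide_nonneg_nonneg mult_nonneg_nonneg) auto
      show "((\<lambda>t. - poisson_kernel a t) \<longlongrightarrow> 0) at_top"
        unfolding poisson_kernel_def using a by real_asymp
    qed
    then show ?thesis
      by (simp add: poisson_kernel_def)
  qed
  have "(\<integral>\<^sup>+y. v y * ennreal (poisson_kernel a (x - y)) \<partial>lborel)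
    = (\<integral>\<^sup>+y. (\<integral>\<^sup>+r. v y * (ennreal (?\<rho> r) * indicator {\<bar>x - y\<bar>..} r) \<partial>lborel) \<partial>lborel)"
    unfolding P by (simp add: nn_integral_cmult)
  also have "\<dots> = (\<integral>\<^sup>+y. (\<integral>\<^sup>+r. ennreal (?\<rho> r) * indicator {0<..} r * (v y * indicator (cball x r) y) \<partial>lborel) \<partial>lborel)"
  proof (rule nn_integral_cong)
    fix y
    have "AE r in lborel. v y * (ennreal (?\<rho> r) * indicator {\<bar>x - y\<bar>..} r)
        = ennreal (?\<rho> r) * indicator {0<..} r * (v y * indicator (cball x r) y)"
      using AE_lborel_singleton[of 0]
      by eventually_elim (auto split: split_indicator simp: dist_real_def mult_ac)
    then show "(\<integral>\<^sup>+r. v y * (ennreal (?\<rho> r) * indicator {\<bar>x - y\<bar>..} r) \<partial>lborel)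
        = (\<integral>\<^sup>+r. ennreal (?\<rho> r) * indicator {0<..} r * (v y * indicator (cball x r) y) \<partial>lborel)"
      by (rule nn_integral_cong_AE)
  qed
  also have "\<dots> = (\<integral>\<^sup>+r. (\<integral>\<^sup>+y. ennreal (?\<rho> r) * indicator {0<..} r * (v y * indicator (cball x r) y) \<partial>lborel) \<partial>lborel)"
  proof (rule lborel_pair.Fubini')
    have "(\<lambda>(r, y). indicator (cball x r) y :: ennreal) = (\<lambda>(r, y). if \<bar>x - y\<bar> \<le> r then 1 else 0)"
      by (auto simp: dist_real_def fun_eq_iff)
    moreover have "(\<lambda>(r, y). if \<bar>x - y\<bar> \<le> r then 1 else 0 :: ennreal) \<in> borel_measurable (lborel \<Otimes>\<^sub>M lborel)"
      by measurable
    ultimately have [measurable]: "(\<lambda>(r, y). indicator (cball x r) y :: ennreal) \<in> borel_measurable (borel \<Otimes>\<^sub>M borel)"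
      by (simp cong: measurable_cong_sets)
    show "(\<lambda>(r, y). ennreal (?\<rho> r) * indicator {0<..} r * (v y * indicator (cball x r) y))
      \<in> borel_measurable (lborel \<Otimes>\<^sub>M lborel)"
      by measurable
  qed
  also have "\<dots> = (\<integral>\<^sup>+r. ennreal (?\<rho> r) * indicator {0<..} r
         * (\<integral>\<^sup>+y. v y * indicator (cball x r) y \<partial>lborel) \<partial>lborel)"
  proof (intro nn_integral_cong nn_integral_cmult)
    have "Measurable.pred borel (\<lambda>y. y \<in> cball x r)" for r
      by (simp add: pred_def)
    then show "(\<lambda>y. v y * indicator (cball x r) y) \<in> borel_measurable lborel" for r
      by measurable
  qed
  finally show ?thesis .
qed

text \<open>In the layer decomposition only averages over centred intervals enter, so
  \<open>u\<close> may be compared with the constant \<open>\<alpha>\<close>, whose Poisson integral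
  is \<open>\<alpha>\<close>. The contrapositive turns a large Poisson integral into a large
  average, as the weak type inequality demands.\<close>

lemma poisson_le_if_averages_le:
  fixes u :: "real \<Rightarrow> ennreal"
  assumes a: "a > 0" and \<alpha>: "\<alpha> \<ge> 0" and [measurable]: "u \<in> borel_measurable borel"
    and u: "\<And>r. r > 0 \<Longrightarrow> (\<integral>\<^sup>+y. u y * indicator (cball x r) y \<partial>lborel) \<le> ennreal (2 * r * \<alpha>)"
  shows "(\<integral>\<^sup>+y. u y * ennreal (poisson_kernel a (x - y)) \<partial>lborel) \<le> ennreal \<alpha>"
proof -
  have "(\<integral>\<^sup>+y. u y * ennreal (poisson_kernel a (x - y)) \<partial>lborel)
    \<le> (\<integral>\<^sup>+y. ennreal \<alpha> * ennreal (poisson_kernel a (x - y)) \<partial>lborel)"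
    unfolding poisson_layer_cake[OF a, of u, simplified] poisson_layer_cake[OF a, of "\<lambda>_. ennreal \<alpha>", simplified]
  proof (intro nn_integral_mono)
    fix r :: real
    show "ennreal (2 * a * r / (pi * (r\<^sup>2 + a\<^sup>2)\<^sup>2)) * indicator {0<..} r * (\<integral>\<^sup>+y. u y * indicator (cball x r) y \<partial>lborel)
      \<le> ennreal (2 * a * r / (pi * (r\<^sup>2 + a\<^sup>2)\<^sup>2)) * indicator {0<..} r * (\<integral>\<^sup>+y. ennreal \<alpha> * indicator (cball x r) y \<partial>lborel)"
    proof (cases "r > 0")
      case True
      have "(\<integral>\<^sup>+y. ennreal \<alpha> * indicator (cball x r) y \<partial>lborel) = ennreal (2 * r * \<alpha>)"
        using True \<alpha> by (subst nn_integral_cmult_indicator)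
          (auto simp: cball_eq_atLeastAtMost ennreal_mult[symmetric] mult.commute)
      then show ?thesis
        using u[OF True] by (intro mult_left_mono) auto
    qed simp
  qed
  also have "\<dots> = ennreal \<alpha> * (\<integral>\<^sup>+y. ennreal (poisson_kernel a (x - y)) \<partial>lborel)"
    by (rule nn_integral_cmult) measurable
  also have "(\<integral>\<^sup>+y. ennreal (poisson_kernel a (x - y)) \<partial>lborel) = 1"
    using integrable_poisson_kernel[OF a, of x] integral_poisson_kernel[OF a, of x] poisson_kernel_nonneg[OF a]
    by (subst nn_integral_eq_integral) auto
  finally show ?thesis by simp
qed

text \<open>A transform at a greater height is a Poisson average of one at a smaller height, and by
  Jensen's inequality such averages do not increase the norm.\<close>

lemma cauchy_transform_norm_antimono:
  assumes h: "integrable lborel h" and "a > 0" "b > 0"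
  shows "(LINT l|lborel. (cmod (cauchy_transform h (a + b) l))\<^sup>2) \<le> (LINT l|lborel. (cmod (cauchy_transform h b l))\<^sup>2)"
proof -
  have [measurable]: "h \<in> borel_measurable borel"
    using borel_measurable_integrable[OF h] by simp
  have sq: "integrable lborel (\<lambda>l. (cmod (cauchy_transform h b l))\<^sup>2)"
    using integrable_cauchy_transform_sq[OF h, of b] assms by simp
  note C = poisson_integral_contraction[OF \<open>a > 0\<close> _ sq, simplified]
  have "(LINT l|lborel. (cmod (cauchy_transform h (a + b) l))\<^sup>2)
    \<le> (LINT z|lborel. LINT l|lborel. (cmod (cauchy_transform h b l))\<^sup>2 * poisson_kernel a (z - l))"
    using poisson_jensen(2)[OF \<open>a > 0\<close> _ sq] cauchy_transform_poisson(2)[OF assms]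
      integrable_cauchy_transform_sq[OF h, of "a + b"] assms C(1)
    by (intro integral_mono) auto
  also have "\<dots> = (LINT l|lborel. (cmod (cauchy_transform h b l))\<^sup>2)"
    using C(2) by simp
  finally show ?thesis .
qed

text \<open>The inner product rule with equal heights expresses \<open>M a\<close> through
  \<open>h\<close> and the transform at height \<open>2 a\<close>. Cauchy-Schwarz and monotonicity
  of the norm give \<open>(M a)\<^sup>2 \<le> (2 pi)\<^sup>2 H M a\<close>, and one factor
  \<open>M a\<close> cancels.\<close>

lemma cauchy_transform_L2_bound:
  assumes h: "integrable lborel h" and h2: "integrable lborel (\<lambda>z. (cmod (h z))\<^sup>2)" and a: "a > 0"
  shows "(LINT l|lborel. (cmod (cauchy_transform h a l))\<^sup>2) \<le> (2 * pi)\<^sup>2 * (LINT z|lborel. (cmod (h z))\<^sup>2)"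
proof -
  have [measurable]: "h \<in> borel_measurable borel"
    using borel_measurable_integrable[OF h] by simp
  define M where "M = (\<lambda>a. LINT l|lborel. (cmod (cauchy_transform h a l))\<^sup>2)"
  define H where "H = (LINT z|lborel. (cmod (h z))\<^sup>2)"
  have M0: "M a \<ge> 0" for a
    by (simp add: M_def)
  have "complex_of_real (M a) = (LINT l|lborel. cauchy_transform h a l * cnj (cauchy_transform h a l))"
    by (simp only: M_def complex_norm_square[symmetric] integral_complex_of_real)
  also have "\<dots> = 2 * \<i> * pi * (LINT z|lborel. h z * cnj (cauchy_transform h (a + a) z))"
    by (rule cauchy_transform_inner[OF h a a])
  finally have "cmod (complex_of_real (M a)) = 2 * pi * cmod (LINT z|lborel. h z * cnj (cauchy_transform h (a + a) z))"
    by (simp only: norm_mult) simp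
  then have "(M a)\<^sup>2 = (2 * pi)\<^sup>2 * (cmod (LINT z|lborel. h z * cnj (cauchy_transform h (a + a) z)))\<^sup>2"
    using M0[of a] by (simp only: norm_of_real abs_of_nonneg power_mult_distrib)
  also have "\<dots> \<le> (2 * pi)\<^sup>2 * (H * (LINT z|lborel. (cmod (cnj (cauchy_transform h (a + a) z)))\<^sup>2))"
    unfolding H_def using h2 integrable_cauchy_transform_sq[OF h, of "a + a"] a
    by (intro mult_left_mono Cauchy_Schwarz_integral) (auto intro: borel_measurable_cnj)
  also have "\<dots> \<le> (2 * pi)\<^sup>2 * (H * M a)"
    unfolding complex_mod_cnj M_def using cauchy_transform_norm_antimono[OF h a a]
    by (intro mult_left_mono) (auto simp: H_def)
  finally have *: "M a * M a \<le> (2 * pi)\<^sup>2 * H * M a"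
    by (simp add: power2_eq_square mult.assoc)
  show ?thesis
  proof (cases "M a = 0")
    case True
    then show ?thesis by (simp add: M_def)
  next
    case False
    then have "M a > 0" using M0[of a] by simp
    then show ?thesis
      using * mult_le_cancel_right_pos[of "M a" "M a" "(2 * pi)\<^sup>2 * H"] unfolding M_def H_def by blast
  qed
qed

text \<open>The inner product of the transforms at heights \<open>a\<close> and \<open>b\<close>
  depends on \<open>a + b\<close> only, so it equals the squared norm at the mean height.\<close>

lemma cauchy_transform_norm_diff:
  assumes h: "integrable lborel h" and "a > 0" "b > 0"
  shows "integrable lborel (\<lambda>l. (cmod (cauchy_transform h a l - cauchy_transform h b l))\<^sup>2)"
    "(LINT l|lborel. (cmod (cauchy_transform h a l - cauchy_transform h b l))\<^sup>2)
      = (LINT l|lborel. (cmod (cauchy_transform h a l))\<^sup>2) + (LINT l|lborel. (cmod (cauchy_transform h b l))\<^sup>2)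
        - 2 * (LINT l|lborel. (cmod (cauchy_transform h ((a + b) / 2) l))\<^sup>2)"
proof -
  let ?F = "cauchy_transform h"
  have [measurable]: "h \<in> borel_measurable borel"
    using borel_measurable_integrable[OF h] by simp
  have sq: "integrable lborel (\<lambda>l. (cmod (?F c l))\<^sup>2)" if "c > 0" for c
    using integrable_cauchy_transform_sq[OF h, of c] that by simp
  have cm: "(\<lambda>l. cnj (?F b l)) \<in> borel_measurable borel"
    by measurable
  have cr: "integrable lborel (\<lambda>l. ?F a l * cnj (?F b l))"
    using sq assms cm by (intro integrable_mult_of_square_integrable) auto
  have exp: "(cmod (x - y))\<^sup>2 = (cmod x)\<^sup>2 + (cmod y)\<^sup>2 - 2 * Re (x * cnj y)" for x y
    unfolding cmod_power2 by (simp add: power2_eq_square algebra_simps)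
  show "integrable lborel (\<lambda>l. (cmod (?F a l - ?F b l))\<^sup>2)"
    unfolding exp using sq assms integrable_Re[OF cr]
    by (intro Bochner_Integration.integrable_diff Bochner_Integration.integrable_add integrable_mult_right) auto
  have c: "(a + b) / 2 > 0" "(a + b) / 2 + (a + b) / 2 = a + b"
    using assms by auto
  have "(LINT l|lborel. ?F a l * cnj (?F b l)) = (LINT l|lborel. ?F ((a + b) / 2) l * cnj (?F ((a + b) / 2) l))"
    unfolding cauchy_transform_inner[OF assms] cauchy_transform_inner[OF h c(1) c(1)] c(2) ..
  also have "\<dots> = of_real (LINT l|lborel. (cmod (?F ((a + b) / 2) l))\<^sup>2)"
    by (simp only: complex_norm_square[symmetric] integral_complex_of_real)
  finally have "(LINT l|lborel. Re (?F a l * cnj (?F b l))) = (LINT l|lborel. (cmod (?F ((a + b) / 2) l))\<^sup>2)"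
    using integral_Re[OF cr] by simp
  moreover have "(LINT l|lborel. (cmod (?F a l))\<^sup>2 + (cmod (?F b l))\<^sup>2 - 2 * R l)
    = (LINT l|lborel. (cmod (?F a l))\<^sup>2) + (LINT l|lborel. (cmod (?F b l))\<^sup>2) - 2 * (LINT l|lborel. R l)"
    if "integrable lborel R" for R
    using sq assms that by simp
  note this[OF integrable_Re[OF cr]]
  ultimately show "(LINT l|lborel. (cmod (?F a l - ?F b l))\<^sup>2)
      = (LINT l|lborel. (cmod (?F a l))\<^sup>2) + (LINT l|lborel. (cmod (?F b l))\<^sup>2)
        - 2 * (LINT l|lborel. (cmod (?F ((a + b) / 2) l))\<^sup>2)"
    unfolding exp by simp
qed

text \<open>The squared norms increase as the height decreases and are bounded. The distance formula
  then bounds the squared distance by the gap between their supremum and the value at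
  \<open>a\<close>, since both heights and their mean are at most \<open>a\<close>.\<close>

lemma cauchy_transform_L2_cauchy:
  assumes h: "integrable lborel h" and h2: "integrable lborel (\<lambda>z. (cmod (h z))\<^sup>2)" and \<tau>: "\<tau> > 0"
  obtains a where "a > 0"
    "\<And>d e. \<lbrakk>d > 0; e > 0; d + e \<le> a\<rbrakk> \<Longrightarrow>
      (LINT l|lborel. (cmod (cauchy_transform h d l - cauchy_transform h (d + e) l))\<^sup>2) < \<tau>"
proof -
  define M where "M = (\<lambda>a. LINT l|lborel. (cmod (cauchy_transform h a l))\<^sup>2)"
  have anti: "M c \<le> M b" if "0 < b" "b \<le> c" for b c
    using cauchy_transform_norm_antimono[OF h, of "c - b" b] that by (cases "b = c") (auto simp: M_def)
  have bdd: "bdd_above (M ` {0<..})"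
    using cauchy_transform_L2_bound[OF h h2] by (auto simp: bdd_above_def M_def)
  define L where "L = (SUP a\<in>{0<..}. M a)"
  have le: "M a \<le> L" if "a > 0" for a
    unfolding L_def using that by (intro cSUP_upper bdd) auto
  obtain a where a: "a > 0" "L - \<tau> < M a"
    using less_cSUP_iff[of "{0<..}" M "L - \<tau>"] bdd \<tau> by (auto simp: L_def[symmetric])
  show ?thesis
  proof (rule that[OF a(1)])
    fix d e :: real assume de: "d > 0" "e > 0" "d + e \<le> a"
    have "(LINT l|lborel. (cmod (cauchy_transform h d l - cauchy_transform h (d + e) l))\<^sup>2)
      = M d + M (d + e) - 2 * M ((d + (d + e)) / 2)"
      using cauchy_transform_norm_diff(2)[OF h, of d "d + e"] de by (simp add: M_def)
    also have "\<dots> \<le> M d - M ((d + (d + e)) / 2)"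
      using anti[of "(d + (d + e)) / 2" "d + e"] de by simp
    also have "\<dots> \<le> L - M a"
      using le[of d] anti[of "(d + (d + e)) / 2" a] de by simp
    also have "\<dots> < \<tau>" using a(2) by simp
    finally show "(LINT l|lborel. (cmod (cauchy_transform h d l - cauchy_transform h (d + e) l))\<^sup>2) < \<tau>" .
  qed
qed

text \<open>Raising both heights by \<open>b\<close> amounts to taking the Poisson integral of the
  difference \<open>g\<close> at offset \<open>d\<close>. Where this exceeds \<open>c\<close> for
  some \<open>b\<close>, Jensen's inequality makes a Poisson integral of the square of
  \<open>g\<close> exceed \<open>c\<^sup>2\<close>, hence also some average. The positive offset
  \<open>d\<close> makes \<open>g\<close> a difference of genuine transforms rather than of boundary
  values that are not yet known to exist.\<close>

lemma cauchy_transform_weak_type: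
  assumes h: "integrable lborel h" and "d > 0" "e > 0" "c > 0"
  defines "S \<equiv> {x. \<exists>b>0. c < cmod (cauchy_transform h (b + d) x - cauchy_transform h (b + (d + e)) x)}"
  shows "open S"
    "ennreal (c\<^sup>2) * emeasure lborel S
      \<le> 5 * ennreal (LINT l|lborel. (cmod (cauchy_transform h d l - cauchy_transform h (d + e) l))\<^sup>2)"
proof -
  let ?F = "cauchy_transform h"
  define g where "g = (\<lambda>l. ?F d l - ?F (d + e) l)"
  have [measurable]: "h \<in> borel_measurable borel"
    using borel_measurable_integrable[OF h] by simp
  have gm [measurable]: "g \<in> borel_measurable borel"
    unfolding g_def by measurable
  have g2: "integrable lborel (\<lambda>l. (cmod (g l))\<^sup>2)"
    unfolding g_def using assms by (intro cauchy_transform_norm_diff(1)) auto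
  have "S = (\<Union>b\<in>{0<..}. {x. c < cmod (?F (b + d) x - ?F (b + (d + e)) x)})"
    by (auto simp: S_def)
  moreover have "open {x. c < cmod (?F (b + d) x - ?F (b + (d + e)) x)}" if "b > 0" for b
  proof (rule open_Collect_less)
    show "continuous_on UNIV (\<lambda>x. cmod (?F (b + d) x - ?F (b + (d + e)) x))"
      using that assms
      by (intro continuous_intros) (auto intro!: continuous_at_imp_continuous_on isCont_cauchy_transform h)
  qed simp
  ultimately show S: "open S"
    by auto
  have nn: "(\<integral>\<^sup>+l. ennreal ((cmod (g l))\<^sup>2) \<partial>lborel) = ennreal (LINT l|lborel. (cmod (g l))\<^sup>2)"
    by (intro nn_integral_eq_integral g2) auto
  have "ennreal (c\<^sup>2) * emeasure lborel S \<le> 5 * (\<integral>\<^sup>+l. ennreal ((cmod (g l))\<^sup>2) \<partial>lborel)"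
  proof (rule hardy_littlewood_weak_type)
    fix x assume "x \<in> S"
    then obtain b where b: "b > 0" "c < cmod (?F (b + d) x - ?F (b + (d + e)) x)"
      by (auto simp: S_def)
    have "?F (b + d) x - ?F (b + (d + e)) x = (LINT l|lborel. g l * of_real (poisson_kernel b (x - l)))"
      using cauchy_transform_poisson[OF h b(1), of d x] cauchy_transform_poisson[OF h b(1), of "d + e" x] assms
      by (simp add: g_def left_diff_distrib)
    then have "c\<^sup>2 < (cmod (LINT l|lborel. g l * of_real (poisson_kernel b (x - l))))\<^sup>2"
      using b(2) assms by (intro power_strict_mono) auto
    also have "\<dots> \<le> (LINT l|lborel. (cmod (g l))\<^sup>2 * poisson_kernel b (x - l))"
      by (rule poisson_jensen[OF b(1) gm g2])
    finally have "ennreal (c\<^sup>2) < ennreal (LINT l|lborel. (cmod (g l))\<^sup>2 * poisson_kernel b (x - l))"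
      by (intro ennreal_lessI) (auto intro: le_less_trans[of 0 "c\<^sup>2"])
    also have "\<dots> = (\<integral>\<^sup>+l. ennreal ((cmod (g l))\<^sup>2) * ennreal (poisson_kernel b (x - l)) \<partial>lborel)"
      using poisson_jensen(1)[OF b(1) gm g2, of x] poisson_kernel_nonneg[OF b(1)]
      by (subst nn_integral_eq_integral[symmetric]) (auto simp: ennreal_mult)
    finally have "\<not> (\<integral>\<^sup>+l. ennreal ((cmod (g l))\<^sup>2) * ennreal (poisson_kernel b (x - l)) \<partial>lborel) \<le> ennreal (c\<^sup>2)"
      by simp
    then have "\<not> (\<forall>r>0. (\<integral>\<^sup>+y. ennreal ((cmod (g y))\<^sup>2) * indicator (cball x r) y \<partial>lborel) \<le> ennreal (2 * r * c\<^sup>2))"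
      using poisson_le_if_averages_le[OF b(1), of "c\<^sup>2" "\<lambda>l. ennreal ((cmod (g l))\<^sup>2)" x] by auto
    then show "\<exists>r>0. ennreal (2 * r * c\<^sup>2) \<le> (\<integral>\<^sup>+y. ennreal ((cmod (g y))\<^sup>2) * indicator (cball x r) y \<partial>lborel)"
      by (meson linorder_le_cases)
  qed (use S nn assms in auto)
  then show "ennreal (c\<^sup>2) * emeasure lborel S
      \<le> 5 * ennreal (LINT l|lborel. (cmod (?F d l - ?F (d + e) l))\<^sup>2)"
    unfolding nn by (simp add: g_def)
qed

lemma convergent_at_right_if_cauchy:
  fixes f :: "real \<Rightarrow> 'a::complete_space"
  assumes "\<And>e. e > 0 \<Longrightarrow> \<exists>d>0. \<forall>x y. 0 < x \<and> x < d \<and> 0 < y \<and> y < d \<longrightarrow> dist (f x) (f y) < e"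
  shows "\<exists>L. (f \<longlongrightarrow> L) (at_right 0)"
proof -
  define X where "X = (\<lambda>n. f (1 / real (Suc n)))"
  have ev: "\<exists>M. \<forall>n\<ge>M. 1 / real (Suc n) < d" if d: "d > 0" for d :: real
  proof -
    obtain M where "1 / real (Suc M) < d"
      using nat_approx_posE[OF d] .
    then show ?thesis
      by (intro exI[of _ M] allI impI, elim le_less_trans[rotated], intro divide_left_mono) auto
  qed
  have "Cauchy X"
    unfolding Cauchy_def
  proof (intro allI impI)
    fix e :: real assume "e > 0"
    then obtain d where d: "d > 0" "\<And>x y. \<lbrakk>0 < x; x < d; 0 < y; y < d\<rbrakk> \<Longrightarrow> dist (f x) (f y) < e"
      using assms by meson
    obtain M where "\<forall>n\<ge>M. 1 / real (Suc n) < d"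
      using ev[OF d(1)] by blast
    then show "\<exists>M. \<forall>m\<ge>M. \<forall>n\<ge>M. dist (X m) (X n) < e"
      unfolding X_def by (intro exI[of _ M]) (auto intro!: d(2))
  qed
  then obtain L where L: "X \<longlonglongrightarrow> L"
    using Cauchy_convergent convergent_def by blast
  have "(f \<longlongrightarrow> L) (at_right 0)"
  proof (rule tendstoI)
    fix e :: real assume "e > 0"
    then obtain d where d: "d > 0" "\<And>x y. \<lbrakk>0 < x; x < d; 0 < y; y < d\<rbrakk> \<Longrightarrow> dist (f x) (f y) < e / 2"
      using assms[of "e / 2"] by auto
    obtain M where M: "\<forall>n\<ge>M. 1 / real (Suc n) < d"
      using ev[OF d(1)] by blast
    have "dist (f x) L \<le> e / 2" if "0 < x" "x < d" for x
    proof (rule LIMSEQ_le_const2)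
      show "(\<lambda>n. dist (f x) (X n)) \<longlonglongrightarrow> dist (f x) L"
        by (intro tendsto_intros L)
      show "\<exists>N. \<forall>n\<ge>N. dist (f x) (X n) \<le> e / 2"
        using M d(2) that unfolding X_def by (intro exI[of _ M]) (auto intro!: less_imp_le)
    qed
    then show "\<forall>\<^sub>F x in at_right 0. dist (f x) L < e"
      using d(1) \<open>e > 0\<close> unfolding eventually_at_right_field by (intro exI[of _ d]) fastforce
  qed
  then show ?thesis by blast
qed

text \<open>\<open>A c e\<close> collects the points where, at some height, raising it by
  \<open>e\<close> changes the transform by more than \<open>c\<close>. These sets have small
  measure for suitable \<open>e\<close>, so almost every point avoids one of them for each
  \<open>c\<close>. There the transform is within \<open>c\<close> of its continuous shift by
  \<open>e\<close> and is therefore Cauchy as the height tends to 0.\<close>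

lemma AE_cauchy_transform_convergent:
  assumes h: "integrable lborel h" and h2: "integrable lborel (\<lambda>z. (cmod (h z))\<^sup>2)"
  shows "AE l in lborel. \<exists>L. ((\<lambda>a. cauchy_transform h a l) \<longlongrightarrow> L) (at_right 0)"
proof -
  let ?F = "cauchy_transform h"
  define A where "A = (\<lambda>c e. {x. \<exists>b>0. c < cmod (?F b x - ?F (b + e) x)})"
  have small: "\<exists>e>0. A c e \<in> sets borel \<and> emeasure lborel (A c e) \<le> ennreal t" if c: "c > 0" and t: "t > 0" for c t
  proof -
    \<comment> \<open>Chosen so that the weak type inequality with its factor 5 leaves exactly the
      measure \<open>t\<close>.\<close>
    define \<tau> where "\<tau> = c\<^sup>2 * t / 5"
    have "\<tau> > 0" using c t by (simp add: \<tau>_def)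
    then obtain a where a: "a > 0" "\<And>d e. \<lbrakk>d > 0; e > 0; d + e \<le> a\<rbrakk> \<Longrightarrow>
      (LINT l|lborel. (cmod (?F d l - ?F (d + e) l))\<^sup>2) < \<tau>"
      using cauchy_transform_L2_cauchy[OF h h2] by metis
    \<comment> \<open>Half of \<open>a\<close> is reserved for the gap \<open>e\<close>; the offsets
      \<open>d n\<close> never exceed the other half and decrease to 0.\<close>
    define e where "e = a / 2"
    define d where "d = (\<lambda>n. e / real (Suc n))"
    have e: "e > 0" and d: "\<And>n. d n > 0" "\<And>n. d n + e \<le> a"
      using a(1) by (auto simp: e_def d_def field_simps)
    define S where "S = (\<lambda>n. {x. \<exists>b>0. c < cmod (?F (b + d n) x - ?F (b + (d n + e)) x)})"
    have op: "open (S n)" for n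
      unfolding S_def by (rule cauchy_transform_weak_type(1)[OF h d(1) e c])
    have m: "emeasure lborel (S n) \<le> ennreal t" for n
    proof -
      have "ennreal (c\<^sup>2) * emeasure lborel (S n)
        \<le> 5 * ennreal (LINT l|lborel. (cmod (?F (d n) l - ?F (d n + e) l))\<^sup>2)"
        unfolding S_def by (rule cauchy_transform_weak_type(2)[OF h d(1) e c])
      also have "\<dots> \<le> 5 * ennreal \<tau>"
        using a(2)[OF d(1) e d(2), of n] by (intro mult_left_mono ennreal_leI) auto
      also have "\<dots> = ennreal (c\<^sup>2) * ennreal t"
        using c t ennreal_mult[of 5 \<tau>] ennreal_mult[of "c\<^sup>2" t] by (simp add: \<tau>_def)
      finally show ?thesis
        using c by (subst (asm) ennreal_mult_le_mult_iff) auto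
    qed
    \<comment> \<open>The weak type inequality is available only at a positive offset. Keeping the
      gap \<open>e\<close> and letting the offset decrease to 0 exhausts \<open>A c e\<close>, so
      the measure bound survives by continuity from below.\<close>
    have "A c e = (\<Union>n. S n)"
    proof (intro set_eqI iffI)
      fix x assume "x \<in> A c e"
      then obtain b where b: "b > 0" "c < cmod (?F b x - ?F (b + e) x)"
        by (auto simp: A_def)
      obtain n where n: "1 / real (Suc n) < b / e"
        using nat_approx_posE[of "b / e"] b(1) e by auto
      then have "d n < b"
        using e by (simp add: d_def field_simps)
      then show "x \<in> (\<Union>n. S n)"
        using b(2) by (auto simp: S_def add.assoc[symmetric] intro!: exI[of _ n] exI[of _ "b - d n"])
    next
      fix x assume "x \<in> (\<Union>n. S n)"
      then obtain n b where "b > 0" "c < cmod (?F (b + d n) x - ?F (b + (d n + e)) x)"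
        by (auto simp: S_def)
      then show "x \<in> A c e"
        using d(1)[of n] by (auto simp: A_def add.assoc[symmetric] intro!: exI[of _ "b + d n"])
    qed
    moreover have "incseq S"
    proof (rule incseq_SucI, rule subsetI)
      fix n x assume "x \<in> S n"
      then obtain b where b: "b > 0" "c < cmod (?F (b + d n) x - ?F (b + (d n + e)) x)"
        by (auto simp: S_def)
      have "d (Suc n) \<le> d n"
        using e by (simp add: d_def frac_le)
      then show "x \<in> S (Suc n)"
        using b unfolding S_def by (auto simp: algebra_simps intro!: exI[of _ "b + d n - d (Suc n)"])
    qed
    ultimately have "emeasure lborel (A c e) = (SUP n. emeasure lborel (S n))"
      using op by (subst SUP_emeasure_incseq) (auto intro: borel_open)
    also have "\<dots> \<le> ennreal t"
      by (rule SUP_least) (rule m)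
    finally show ?thesis
      using e op \<open>A c e = (\<Union>n. S n)\<close> by (auto intro!: exI[of _ e] borel_open open_UN)
  qed
  have AE: "AE x in lborel. \<exists>e>0. x \<notin> A c e" if c: "c > 0" for c
  proof -
    have "\<forall>n. \<exists>e>0. A c e \<in> sets borel \<and> emeasure lborel (A c e) \<le> ennreal (1 / real (Suc n))"
      using small[OF c] by auto
    then obtain e where e: "\<And>n. e n > 0" "\<And>n. A c (e n) \<in> sets borel"
      "\<And>n. emeasure lborel (A c (e n)) \<le> ennreal (1 / real (Suc n))"
      by metis
    define Z where "Z = (\<Inter>n. A c (e n))"
    have Z: "Z \<in> sets lborel"
      unfolding Z_def using e(2) by auto
    have "emeasure lborel Z \<le> ennreal t" if t: "t > 0" for t
    proof -
      obtain n where n: "1 / real (Suc n) < t"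
        using nat_approx_posE[OF t] .
      have "emeasure lborel Z \<le> emeasure lborel (A c (e n))"
        using e(2) by (intro emeasure_mono) (auto simp: Z_def)
      also have "\<dots> \<le> ennreal t"
        using e(3)[of n] n by (meson ennreal_leI less_imp_le order_trans)
      finally show ?thesis .
    qed
    then have "emeasure lborel Z = 0"
      using ennreal_le_epsilon[of 0 "emeasure lborel Z"] by auto
    then have "AE x in lborel. x \<notin> Z"
      using Z by (intro AE_not_in) (auto simp: null_sets_def)
    then show ?thesis
      by eventually_elim (use e(1) in \<open>auto simp: Z_def\<close>)
  qed
  have "AE x in lborel. \<forall>k. \<exists>e>0. x \<notin> A (1 / real (Suc k)) e"
    unfolding AE_all_countable by (intro allI AE) auto
  then show ?thesis
  proof eventually_elim
    fix x assume x: "\<forall>k. \<exists>e>0. x \<notin> A (1 / real (Suc k)) e"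
    show "\<exists>L. ((\<lambda>a. ?F a x) \<longlongrightarrow> L) (at_right 0)"
    proof (rule convergent_at_right_if_cauchy)
      fix r :: real assume "r > 0"
      then obtain k where k: "1 / real (Suc k) < r / 3"
        using nat_approx_posE[of "r / 3"] by auto
      define c where "c = 1 / real (Suc k)"
      have c: "c > 0" "c < r / 3" using k by (auto simp: c_def)
      obtain e where e: "e > 0" "x \<notin> A c e"
        using x unfolding c_def by blast
      have 1: "cmod (?F b x - ?F (b + e) x) \<le> c" if "b > 0" for b
        using e(2) that by (force simp: A_def)
      \<comment> \<open>Shifting the height by \<open>e\<close> costs at most \<open>c\<close> at
        each of the two heights, and the shifted values differ by less than \<open>c\<close> by
        continuity at \<open>e > 0\<close>. The choice \<open>c < r / 3\<close> absorbs the three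
        errors.\<close>
      have "isCont (\<lambda>a. ?F a x) e"
        using e by (intro isCont_cauchy_transform h) auto
      then obtain d where d: "d > 0" "\<And>a. dist a e < d \<Longrightarrow> dist (?F a x) (?F e x) < c / 2"
        unfolding continuous_at_eps_delta using c(1) by (meson half_gt_zero)
      show "\<exists>d>0. \<forall>y z. 0 < y \<and> y < d \<and> 0 < z \<and> z < d \<longrightarrow> dist (?F y x) (?F z x) < r"
      proof (intro exI[of _ d] conjI allI impI d(1))
        fix y z assume yz: "0 < y \<and> y < d \<and> 0 < z \<and> z < d"
        have "dist (?F (y + e) x) (?F e x) < c / 2" "dist (?F (z + e) x) (?F e x) < c / 2"
          by (rule d(2), use yz in \<open>simp add: dist_real_def\<close>)+
        then have 2: "cmod (?F (y + e) x - ?F (z + e) x) < c"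
          using dist_triangle_half_l[of "?F (y + e) x" "?F e x" c "?F (z + e) x"] by (simp add: dist_norm)
        have "?F y x - ?F z x = (?F y x - ?F (y + e) x) + (?F (y + e) x - ?F (z + e) x) - (?F z x - ?F (z + e) x)"
          by simp
        also have "cmod \<dots> \<le> cmod (?F y x - ?F (y + e) x) + cmod (?F (y + e) x - ?F (z + e) x) + cmod (?F z x - ?F (z + e) x)"
          by (meson norm_triangle_ineq norm_triangle_ineq4 add_right_mono order_trans)
        also have "\<dots> < r"
          using 1[of y] 1[of z] 2 yz c by simp
        finally show "dist (?F y x) (?F z x) < r"
          by (simp add: dist_norm)
      qed
    qed
  qed
qed

text \<open>Conjugation exchanges the half planes. Limits from the left and bounds at negative
  heights are obtained from the other side in this way.\<close>

lemma cauchy_transform_cnj: "cauchy_transform h (- a) l = cnj (cauchy_transform (\<lambda>z. cnj (h z)) a l)"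
  unfolding cauchy_transform_def
  by (subst Bochner_Integration.integral_cnj[symmetric]) (simp add: cnj_cauchy_kernel del: Bochner_Integration.integral_cnj)

lemma AE_cauchy_transform_convergent_left:
  assumes h: "integrable lborel h" and h2: "integrable lborel (\<lambda>z. (cmod (h z))\<^sup>2)"
  shows "AE l in lborel. \<exists>L. ((\<lambda>a. cauchy_transform h a l) \<longlongrightarrow> L) (at_left 0)"
proof -
  have "AE l in lborel. \<exists>L. ((\<lambda>a. cauchy_transform (\<lambda>z. cnj (h z)) a l) \<longlongrightarrow> L) (at_right 0)"
    using assms by (intro AE_cauchy_transform_convergent) auto
  then show ?thesis
  proof eventually_elim
    case (elim l)
    then obtain L where "((\<lambda>a. cauchy_transform (\<lambda>z. cnj (h z)) a l) \<longlongrightarrow> L) (at_right 0)"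
      by blast
    then have "((\<lambda>a. cnj (cauchy_transform (\<lambda>z. cnj (h z)) a l)) \<longlongrightarrow> cnj L) (at_right 0)"
      by (rule tendsto_cnj)
    then have "((\<lambda>a. cauchy_transform h (- a) l) \<longlongrightarrow> cnj L) (at_right 0)"
      by (simp add: cauchy_transform_cnj)
    then have "((\<lambda>a. cauchy_transform h a l) \<longlongrightarrow> cnj L) (at_left 0)"
      by (simp add: filterlim_at_left_to_right)
    then show ?case by blast
  qed
qed

lemma cauchy_transform_L2_bound':
  assumes h: "integrable lborel h" and h2: "integrable lborel (\<lambda>z. (cmod (h z))\<^sup>2)" and a: "a \<noteq> 0"
  shows "(LINT l|lborel. (cmod (cauchy_transform h a l))\<^sup>2) \<le> (2 * pi)\<^sup>2 * (LINT z|lborel. (cmod (h z))\<^sup>2)"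
proof (cases "a > 0")
  case True
  then show ?thesis by (rule cauchy_transform_L2_bound[OF h h2])
next
  case False
  have "cauchy_transform h a l = cnj (cauchy_transform (\<lambda>z. cnj (h z)) (- a) l)" for l
    using cauchy_transform_cnj[of h "- a" l] by simp
  then show ?thesis
    using cauchy_transform_L2_bound[of "\<lambda>z. cnj (h z)" "- a"] assms False by simp
qed

text \<open>Fatou's lemma along a sequence of heights passes the bound, which does not depend on the
  height, on to the boundary function.\<close>

lemma cauchy_transform_fatou:
  assumes h: "integrable lborel h" and h2: "integrable lborel (\<lambda>z. (cmod (h z))\<^sup>2)"
    and a: "\<And>n. a n \<noteq> 0" and [measurable]: "G \<in> borel_measurable borel"
    and lim: "AE l in lborel. (\<lambda>n. cauchy_transform h (a n) l) \<longlonglongrightarrow> G l"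
  shows "integrable lborel (\<lambda>l. (cmod (G l))\<^sup>2)"
    "(LINT l|lborel. (cmod (G l))\<^sup>2) \<le> (2 * pi)\<^sup>2 * (LINT z|lborel. (cmod (h z))\<^sup>2)"
proof -
  have [measurable]: "h \<in> borel_measurable borel"
    using borel_measurable_integrable[OF h] by simp
  let ?B = "(2 * pi)\<^sup>2 * (LINT z|lborel. (cmod (h z))\<^sup>2)"
  have "(\<integral>\<^sup>+l. ennreal ((cmod (G l))\<^sup>2) \<partial>lborel) = (\<integral>\<^sup>+l. liminf (\<lambda>n. ennreal ((cmod (cauchy_transform h (a n) l))\<^sup>2)) \<partial>lborel)"
  proof (rule nn_integral_cong_AE)
    show "AE l in lborel. ennreal ((cmod (G l))\<^sup>2) = liminf (\<lambda>n. ennreal ((cmod (cauchy_transform h (a n) l))\<^sup>2))"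
      using lim
    proof eventually_elim
      case (elim l)
      then have "(\<lambda>n. ennreal ((cmod (cauchy_transform h (a n) l))\<^sup>2)) \<longlonglongrightarrow> ennreal ((cmod (G l))\<^sup>2)"
        by (intro tendsto_intros)
      from lim_imp_Liminf[OF _ this] show ?case
        by simp
    qed
  qed
  also have "\<dots> \<le> liminf (\<lambda>n. \<integral>\<^sup>+l. ennreal ((cmod (cauchy_transform h (a n) l))\<^sup>2) \<partial>lborel)"
    by (rule nn_integral_liminf) measurable
  also have "\<dots> \<le> ennreal ?B"
  proof (rule Liminf_le)
    show "\<forall>\<^sub>F n in sequentially. (\<integral>\<^sup>+l. ennreal ((cmod (cauchy_transform h (a n) l))\<^sup>2) \<partial>lborel) \<le> ennreal ?B"
    proof (intro always_eventually allI)
      fix n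
      have "(\<integral>\<^sup>+l. ennreal ((cmod (cauchy_transform h (a n) l))\<^sup>2) \<partial>lborel)
        = ennreal (LINT l|lborel. (cmod (cauchy_transform h (a n) l))\<^sup>2)"
        by (intro nn_integral_eq_integral integrable_cauchy_transform_sq h a) auto
      then show "(\<integral>\<^sup>+l. ennreal ((cmod (cauchy_transform h (a n) l))\<^sup>2) \<partial>lborel) \<le> ennreal ?B"
        using cauchy_transform_L2_bound'[OF h h2 a, of n] by (simp add: ennreal_leI)
    qed
  qed simp
  finally have *: "(\<integral>\<^sup>+l. ennreal ((cmod (G l))\<^sup>2) \<partial>lborel) \<le> ennreal ?B" .
  then show int: "integrable lborel (\<lambda>l. (cmod (G l))\<^sup>2)"
    by (intro integrableI_bounded) (auto intro: le_less_trans)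
  then show "(LINT l|lborel. (cmod (G l))\<^sup>2) \<le> ?B"
    using * by (subst (asm) nn_integral_eq_integral) auto
qed

section \<open>Test functions\<close>

text \<open>Smoothness of finite order, so that closure under products and affine substitutions can
  be proved by induction on the order; a test function is smooth of every order.\<close>

definition smooth_upto :: "nat \<Rightarrow> (real \<Rightarrow> real) \<Rightarrow> bool" where
  "smooth_upto n f \<longleftrightarrow> (\<forall>m\<le>n. \<forall>x. (deriv ^^ m) f differentiable (at x))"

lemma smooth_upto_0: "smooth_upto 0 f \<longleftrightarrow> (\<forall>x. f differentiable (at x))"
  by (simp add: smooth_upto_def)

lemma smooth_upto_Suc: "smooth_upto (Suc n) f \<longleftrightarrow> (\<forall>x. f differentiable (at x)) \<and> smooth_upto n (deriv f)"
proof
  assume *: "smooth_upto (Suc n) f"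
  have "(deriv ^^ m) (deriv f) differentiable (at x)" if "m \<le> n" for m x
    using *[unfolded smooth_upto_def, rule_format, of "Suc m" x] that by (simp only: funpow_Suc_right o_apply Suc_le_mono)
  then show "(\<forall>x. f differentiable (at x)) \<and> smooth_upto n (deriv f)"
    using *[unfolded smooth_upto_def, rule_format, of 0] by (simp add: smooth_upto_def)
next
  assume *: "(\<forall>x. f differentiable (at x)) \<and> smooth_upto n (deriv f)"
  have "(deriv ^^ m) f differentiable (at x)" if "m \<le> Suc n" for m x
  proof (cases m)
    case (Suc k)
    then show ?thesis
      using *[unfolded smooth_upto_def] that by (simp only: funpow_Suc_right o_apply Suc_le_mono)
  qed (use * in simp)
  then show "smooth_upto (Suc n) f"
    by (simp add: smooth_upto_def)
qed

lemma smooth_upto_SucD: "smooth_upto (Suc n) f \<Longrightarrow> smooth_upto n f"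
  by (simp add: smooth_upto_def)

lemma smooth_upto_differentiable: "smooth_upto n f \<Longrightarrow> f field_differentiable (at x)"
  by (cases n) (auto simp: smooth_upto_0 smooth_upto_Suc field_differentiable_def
      real_differentiable_def)

lemma differentiable_if_field_differentiable:
  "f field_differentiable (at x) \<Longrightarrow> f differentiable (at x)" for f :: "real \<Rightarrow> real"
  by (auto simp: field_differentiable_def real_differentiable_def)

lemma smooth_upto_const: "smooth_upto n (\<lambda>x. c)"
  by (induction n arbitrary: c) (simp_all add: smooth_upto_0 smooth_upto_Suc)

lemma smooth_upto_add:
  "\<lbrakk>smooth_upto n f; smooth_upto n g\<rbrakk> \<Longrightarrow> smooth_upto n (\<lambda>x. f x + g x)"
proof (induction n arbitrary: f g)
  case (Suc n)
  have "deriv (\<lambda>x. f x + g x) = (\<lambda>x. deriv f x + deriv g x)"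
    using Suc.prems by (intro ext deriv_add smooth_upto_differentiable)
  then show ?case
    using Suc by (auto simp: smooth_upto_Suc)
qed (auto simp: smooth_upto_0)

lemma smooth_upto_mult:
  "\<lbrakk>smooth_upto n f; smooth_upto n g\<rbrakk> \<Longrightarrow> smooth_upto n (\<lambda>x. f x * g x)"
proof (induction n arbitrary: f g)
  case (Suc n)
  have "deriv (\<lambda>x. f x * g x) = (\<lambda>x. f x * deriv g x + deriv f x * g x)"
    using Suc.prems by (intro ext deriv_mult smooth_upto_differentiable)
  moreover have "smooth_upto n (\<lambda>x. f x * deriv g x + deriv f x * g x)"
    using Suc.prems smooth_upto_SucD[OF Suc.prems(1)] smooth_upto_SucD[OF Suc.prems(2)]
    by (intro smooth_upto_add Suc.IH) (auto simp: smooth_upto_Suc)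
  ultimately show ?case
    using Suc.prems by (auto simp: smooth_upto_Suc)
qed (auto simp: smooth_upto_0)

lemma smooth_upto_ident: "smooth_upto n (\<lambda>x. x)"
  by (cases n) (simp_all add: smooth_upto_0 smooth_upto_Suc smooth_upto_const)

lemma smooth_upto_affine:
  "smooth_upto n f \<Longrightarrow> smooth_upto n (\<lambda>x. f (a * x + b))"
proof (induction n arbitrary: f)
  case 0
  have "(\<lambda>x. f (a * x + b)) field_differentiable (at x)" for x
  proof -
    have "(f has_field_derivative deriv f (a * x + b)) (at (a * x + b))"
      using smooth_upto_differentiable[OF 0] by (simp add: field_differentiable_derivI)
    then have "((\<lambda>x. f (a * x + b)) has_field_derivative deriv f (a * x + b) * a) (at x)"
      by (rule DERIV_chain2) (auto intro!: derivative_eq_intros)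
    then show ?thesis by (auto simp: field_differentiable_def)
  qed
  then show ?case by (simp add: smooth_upto_0 differentiable_if_field_differentiable)
next
  case (Suc n)
  have D: "((\<lambda>x. f (a * x + b)) has_field_derivative deriv f (a * x + b) * a) (at x)" for x
  proof -
    have "(f has_field_derivative deriv f (a * x + b)) (at (a * x + b))"
      using smooth_upto_differentiable[OF Suc.prems] by (simp add: field_differentiable_derivI)
    then show ?thesis
      by (rule DERIV_chain2) (auto intro!: derivative_eq_intros)
  qed
  then have "deriv (\<lambda>x. f (a * x + b)) = (\<lambda>x. deriv f (a * x + b) * a)"
    by (intro ext DERIV_imp_deriv)
  moreover have "smooth_upto n (\<lambda>x. deriv f (a * x + b) * a)"
    by (rule smooth_upto_mult[OF Suc.IH smooth_upto_const]) (use Suc.prems in \<open>simp add: smooth_upto_Suc\<close>)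
  ultimately show ?case
    using D unfolding smooth_upto_Suc real_differentiable_def by auto
qed

text \<open>The family is closed under differentiation up to linear combinations; its member
  \<open>k = 0\<close> is the classical smooth function \<open>exp (- 1 / t)\<close> that is flat at
  0.\<close>

definition flat_exp :: "nat \<Rightarrow> real \<Rightarrow> real" where
  "flat_exp k t = (if t > 0 then (1 / t) ^ k * exp (- (1 / t)) else 0)"

lemma DERIV_flat_exp:
  "(flat_exp k has_real_derivative flat_exp (k + 2) t - real k * flat_exp (k + 1) t) (at t)"
proof -
  consider "t > 0" | "t < 0" | "t = 0" by linarith
  then show ?thesis
  proof cases
    case 1
    define u where "u = 1 / t"
    have u: "((\<lambda>t. 1 / t) has_real_derivative - (u * u)) (at t)"
      using 1 by (auto intro!: derivative_eq_intros simp: u_def)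
    have "((\<lambda>t. (1 / t) ^ k) has_real_derivative real k * u ^ (k - 1) * - (u * u)) (at t)"
      using DERIV_power[OF u, of k] by (simp add: u_def mult_ac)
    moreover have "((\<lambda>t. exp (- (1 / t))) has_real_derivative exp (- u) * - (- (u * u))) (at t)"
      using DERIV_fun_exp[OF DERIV_minus[OF u]] by (simp add: u_def)
    ultimately have "((\<lambda>t. (1 / t) ^ k * exp (- (1 / t))) has_real_derivative
        real k * u ^ (k - 1) * - (u * u) * exp (- u) + exp (- u) * - (- (u * u)) * u ^ k) (at t)"
      unfolding u_def by (rule DERIV_mult)
    moreover have "real k * u ^ (k - 1) * - (u * u) * exp (- u) + exp (- u) * - (- (u * u)) * u ^ k
      = flat_exp (k + 2) t - real k * flat_exp (k + 1) t"
      using 1 by (cases k) (simp_all add: flat_exp_def u_def[symmetric] algebra_simps)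
    ultimately have "((\<lambda>t. (1 / t) ^ k * exp (- (1 / t))) has_real_derivative
        flat_exp (k + 2) t - real k * flat_exp (k + 1) t) (at t)"
      by simp
    then show ?thesis
      by (rule has_field_derivative_transform_within_open[where S = "{0<..}"]) (use 1 in \<open>auto simp: flat_exp_def\<close>)
  next
    case 2
    have "((\<lambda>t. 0) has_real_derivative 0) (at t)" by simp
    then have "(flat_exp k has_real_derivative 0) (at t)"
      by (rule has_field_derivative_transform_within_open[where S = "{..<0}"]) (use 2 in \<open>auto simp: flat_exp_def\<close>)
    then show ?thesis using 2 by (simp add: flat_exp_def)
  next
    case 3
    \<comment> \<open>The difference quotient at 0 from the right is
      \<open>u ^ (k + 1) * exp (- u)\<close> with \<open>u = 1 / h\<close>, and the exponential
      beats every power as \<open>u\<close> grows.\<close>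
    have "((\<lambda>h. (inverse h) ^ Suc k / exp (inverse h)) \<longlongrightarrow> (0::real)) (at_right 0)"
      by (rule filterlim_compose[OF tendsto_power_div_exp_0 filterlim_inverse_at_top_right])
    then have "((\<lambda>h. ((1 / h) ^ k * exp (- (1 / h))) / h) \<longlongrightarrow> (0::real)) (at_right 0)"
      by (simp add: exp_minus divide_inverse mult_ac)
    then have R: "((\<lambda>h. flat_exp k h / h) \<longlongrightarrow> 0) (at_right 0)"
      by (rule Lim_transform_eventually) (auto simp: flat_exp_def eventually_at_right_field intro: exI[of _ 1])
    have L: "((\<lambda>h. flat_exp k h / h) \<longlongrightarrow> 0) (at_left 0)"
      by (rule Lim_transform_eventually[OF tendsto_const])
        (auto simp: flat_exp_def eventually_at_left_field intro: exI[of _ "-1"])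
    have "((\<lambda>h. flat_exp k h / h) \<longlongrightarrow> 0) (at 0)"
      using L R by (simp add: filterlim_split_at)
    then have "(flat_exp k has_real_derivative 0) (at 0)"
      unfolding has_field_derivative_iff by (simp add: flat_exp_def)
    then show ?thesis using 3 by (simp add: flat_exp_def)
  qed
qed

lemma smooth_upto_flat_exp: "smooth_upto n (flat_exp k)"
proof (induction n arbitrary: k)
  case 0
  then show ?case
    using DERIV_flat_exp by (auto simp: smooth_upto_0 real_differentiable_def)
next
  case (Suc n)
  have "deriv (flat_exp k) = (\<lambda>t. flat_exp (k + 2) t + (- real k) * flat_exp (k + 1) t)"
    using DERIV_flat_exp by (intro ext DERIV_imp_deriv) simp
  moreover have "smooth_upto n (\<lambda>t. flat_exp (k + 2) t + (- real k) * flat_exp (k + 1) t)"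
    by (intro smooth_upto_add smooth_upto_mult smooth_upto_const Suc.IH)
  ultimately show ?case
    using DERIV_flat_exp by (auto simp: smooth_upto_Suc real_differentiable_def)
qed

lemma test_function_iff:
  "test_function \<phi> \<longleftrightarrow> (\<forall>n. smooth_upto n \<phi>) \<and> (\<exists>R. \<forall>x. \<bar>x\<bar> > R \<longrightarrow> \<phi> x = 0)"
  by (auto simp: test_function_def smooth_upto_def)

lemma test_function_translate:
  assumes "test_function \<phi>"
  shows "test_function (\<lambda>x. \<phi> (x - t))" "deriv (\<lambda>x. \<phi> (x - t)) = (\<lambda>x. deriv \<phi> (x - t))"
proof -
  obtain R where R: "\<And>x. \<bar>x\<bar> > R \<Longrightarrow> \<phi> x = 0"
    using assms by (auto simp: test_function_iff)
  have "smooth_upto n (\<lambda>x. \<phi> (1 * x + (- t)))" for n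
    by (rule smooth_upto_affine) (use assms in \<open>simp add: test_function_iff\<close>)
  moreover have "\<phi> (x - t) = 0" if "\<bar>x\<bar> > R + \<bar>t\<bar>" for x
    using that by (intro R) linarith
  ultimately show "test_function (\<lambda>x. \<phi> (x - t))"
    by (auto simp: test_function_iff intro!: exI[of _ "R + \<bar>t\<bar>"])
  show "deriv (\<lambda>x. \<phi> (x - t)) = (\<lambda>x. deriv \<phi> (x - t))"
  proof
    fix x
    have "(\<phi> has_field_derivative deriv \<phi> (x - t)) (at (x - t))"
      using assms smooth_upto_differentiable by (auto simp: test_function_iff field_differentiable_derivI)
    then have "((\<lambda>x. \<phi> (x - t)) has_field_derivative deriv \<phi> (x - t) * 1) (at x)"
      by (rule DERIV_chain2) (auto intro!: derivative_eq_intros)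
    then show "deriv (\<lambda>x. \<phi> (x - t)) x = deriv \<phi> (x - t)"
      by (auto intro: DERIV_imp_deriv)
  qed
qed

lemma test_function_mult:
  assumes "test_function \<phi>" "\<And>n. smooth_upto n g"
  shows "test_function (\<lambda>x. g x * \<phi> x)" "deriv (\<lambda>x. g x * \<phi> x) = (\<lambda>x. g x * deriv \<phi> x + deriv g x * \<phi> x)"
proof -
  have \<phi>: "smooth_upto n \<phi>" for n
    using assms(1) unfolding test_function_iff by blast
  obtain R where R: "\<And>x. \<bar>x\<bar> > R \<Longrightarrow> \<phi> x = 0"
    using assms(1) unfolding test_function_iff by blast
  show "test_function (\<lambda>x. g x * \<phi> x)"
    unfolding test_function_iff
  proof (intro conjI allI exI[of _ R] impI)
    show "smooth_upto n (\<lambda>x. g x * \<phi> x)" for n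
      by (rule smooth_upto_mult[OF assms(2) \<phi>])
  qed (simp add: R)
  show "deriv (\<lambda>x. g x * \<phi> x) = (\<lambda>x. g x * deriv \<phi> x + deriv g x * \<phi> x)"
    by (intro ext deriv_mult smooth_upto_differentiable[OF assms(2)[of 0]] smooth_upto_differentiable[OF \<phi>[of 0]])
qed

lemma test_function_bounded:
  assumes "test_function \<phi>"
  shows "continuous_on UNIV \<phi>" "continuous_on UNIV (deriv \<phi>)"
    "\<exists>B. \<forall>x. \<bar>\<phi> x\<bar> \<le> B" "\<exists>B. \<forall>x. \<bar>deriv \<phi> x\<bar> \<le> B"
proof -
  have s: "smooth_upto 1 \<phi>" using assms unfolding test_function_iff by blast
  have d: "(\<phi> has_field_derivative deriv \<phi> x) (at x)" for x
    using smooth_upto_differentiable[OF s] by (simp add: field_differentiable_derivI)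
  obtain R where R: "\<And>x. \<bar>x\<bar> > R \<Longrightarrow> \<phi> x = 0"
    using assms unfolding test_function_iff by blast
  have R': "deriv \<phi> x = 0" if "\<bar>x\<bar> > R" for x
  proof -
    have "((\<lambda>_. 0) has_field_derivative 0) (at x)" by simp
    then have "(\<phi> has_field_derivative 0) (at x)"
      by (rule has_field_derivative_transform_within_open[where S = "{x. R < \<bar>x\<bar>}"])
        (use that R in \<open>auto intro!: open_Collect_less continuous_intros\<close>)
    then show ?thesis by (rule DERIV_imp_deriv)
  qed
  show c1: "continuous_on UNIV \<phi>"
    using d by (intro continuous_at_imp_continuous_on) (auto intro: DERIV_isCont)
  have "smooth_upto 0 (deriv \<phi>)"
    using s by (simp add: smooth_upto_Suc)
  then show c2: "continuous_on UNIV (deriv \<phi>)"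
    by (intro continuous_at_imp_continuous_on) (simp add: smooth_upto_0 differentiable_imp_continuous_within)
  have gen: "\<exists>B. \<forall>x. \<bar>f x\<bar> \<le> B" if "continuous_on UNIV f" and "\<And>x. \<bar>x\<bar> > R \<Longrightarrow> f x = 0" for f :: "real \<Rightarrow> real"
  proof -
    have "compact (f ` {- \<bar>R\<bar>..\<bar>R\<bar>})"
      by (intro compact_continuous_image continuous_on_subset[OF that(1)]) auto
    then have "bounded (f ` {- \<bar>R\<bar>..\<bar>R\<bar>})"
      by (rule compact_imp_bounded)
    then obtain B where B: "\<And>x. x \<in> {- \<bar>R\<bar>..\<bar>R\<bar>} \<Longrightarrow> \<bar>f x\<bar> \<le> B"
      unfolding bounded_iff by force
    have "\<bar>f x\<bar> \<le> max B 0" for x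
    proof (cases "x \<in> {- \<bar>R\<bar>..\<bar>R\<bar>}")
      case False
      then show ?thesis using that(2)[of x] by auto
    qed (use B in \<open>auto simp: le_max_iff_disj\<close>)
    then show ?thesis by blast
  qed
  show "\<exists>B. \<forall>x. \<bar>\<phi> x\<bar> \<le> B" "\<exists>B. \<forall>x. \<bar>deriv \<phi> x\<bar> \<le> B"
    using gen[OF c1 R] gen[OF c2 R'] by auto
qed

text \<open>Each factor switches on at one end point, and the factor \<open>n\<close> sharpens the
  transition; the limit is the indicator of the open interval, and 0 if that interval is
  empty.\<close>

definition bump :: "real \<Rightarrow> real \<Rightarrow> nat \<Rightarrow> real \<Rightarrow> real" where
  "bump a b n x = flat_exp 0 (real n * (x - a)) * flat_exp 0 (real n * (b - x))"

lemma test_function_bump: "test_function (bump a b n)"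
proof -
  have "smooth_upto m (\<lambda>x. flat_exp 0 (real n * x + (- real n * a)) * flat_exp 0 ((- real n) * x + real n * b))" for m
    by (rule smooth_upto_mult[OF smooth_upto_affine smooth_upto_affine]) (rule smooth_upto_flat_exp)+
  moreover have "bump a b n = (\<lambda>x. flat_exp 0 (real n * x + (- real n * a)) * flat_exp 0 ((- real n) * x + real n * b))"
    by (auto simp: bump_def fun_eq_iff algebra_simps)
  moreover have "bump a b n x = 0" if "\<bar>x\<bar> > \<bar>a\<bar> + \<bar>b\<bar>" for x
    using that by (auto simp: bump_def flat_exp_def zero_less_mult_iff)
  ultimately show ?thesis
    by (auto simp: test_function_iff)
qed

lemma bump_bounded: "\<bar>bump a b n x\<bar> \<le> 1"
proof -
  have "\<bar>flat_exp 0 t\<bar> \<le> 1" for t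
    by (cases "t > 0") (simp_all add: flat_exp_def)
  then show ?thesis
    unfolding bump_def abs_mult by (intro mult_le_one abs_ge_zero)
qed

lemma bump_tendsto: "(\<lambda>n. bump a b n x) \<longlonglongrightarrow> indicator {a<..<b} x"
proof -
  have *: "(\<lambda>n. flat_exp 0 (real n * t)) \<longlonglongrightarrow> (if t > 0 then 1 else 0)" for t
  proof (cases "t > 0")
    case True
    have "(\<lambda>n. exp (- (inverse (real n) * inverse t))) \<longlonglongrightarrow> exp (- (0 * inverse t))"
      by (intro tendsto_intros lim_inverse_n)
    then have "(\<lambda>n. exp (- (1 / (real n * t)))) \<longlonglongrightarrow> 1"
      by (simp add: divide_inverse)
    moreover have "\<forall>\<^sub>F n in sequentially. exp (- (1 / (real n * t))) = flat_exp 0 (real n * t)"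
      using eventually_gt_at_top[of 0] by eventually_elim (use True in \<open>simp add: flat_exp_def\<close>)
    ultimately have "(\<lambda>n. flat_exp 0 (real n * t)) \<longlonglongrightarrow> 1"
      by (rule Lim_transform_eventually)
    then show ?thesis using True by simp
  next
    case False
    then have "\<not> 0 < real n * t" for n
      by (simp add: zero_less_mult_iff)
    then show ?thesis using False by (simp add: flat_exp_def)
  qed
  have "(\<lambda>n. bump a b n x) \<longlonglongrightarrow> (if x - a > 0 then 1 else 0) * (if b - x > 0 then 1 else 0)"
    unfolding bump_def by (intro tendsto_mult *)
  moreover have "(if x - a > 0 then 1 else 0) * (if b - x > 0 then 1 else 0) = (indicator {a<..<b} x :: real)"
    by (simp add: indicator_def)
  ultimately show ?thesis by simp
qed

lemma AE_eq_0_if_interval_integrals_0_real: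
  fixes D :: "real \<Rightarrow> real"
  assumes D: "integrable lborel D"
    and 0: "\<And>a b. (LINT x|lborel. D x * indicator {a<..<b} x) = 0"
  shows "AE x in lborel. D x = 0"
proof -
  have [measurable]: "D \<in> borel_measurable borel"
    using borel_measurable_integrable[OF D] by simp
  have tail: "(LINT x|lborel. D x * indicator {a<..} x) = 0" for a
  proof -
    have "(\<lambda>n. LINT x|lborel. D x * indicator {a<..<real n} x) \<longlonglongrightarrow> (LINT x|lborel. D x * indicator {a<..} x)"
    proof (rule integral_dominated_convergence[where w = "\<lambda>x. \<bar>D x\<bar>"])
      show "AE x in lborel. (\<lambda>n. D x * indicator {a<..<real n} x) \<longlonglongrightarrow> D x * indicator {a<..} x"
      proof (intro AE_I2 tendsto_mult tendsto_const)
        fix x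
        obtain N where N: "x < real N" using reals_Archimedean2 by blast
        have "\<forall>\<^sub>F n in sequentially. indicator {a<..} x = (indicator {a<..<real n} x :: real)"
          using eventually_ge_at_top[of N] by eventually_elim (use N in \<open>auto simp: indicator_def\<close>)
        then show "(\<lambda>n. indicator {a<..<real n} x) \<longlonglongrightarrow> (indicator {a<..} x :: real)"
          by (rule Lim_transform_eventually[OF tendsto_const])
      qed
      show "AE x in lborel. norm (D x * indicator {a<..<real n} x) \<le> \<bar>D x\<bar>" for n
        by (auto simp: indicator_def)
    qed (use D in auto)
    then show ?thesis
      unfolding 0 by (simp add: LIMSEQ_const_iff)
  qed
  \<comment> \<open>Since \<open>ennreal\<close> truncates at 0, these are the densities of the
    positive and the negative part of \<open>D\<close>. The measures agree on all half lines, hence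
    everywhere, and a number with the same truncation as its negative is 0.\<close>
  have "density lborel (\<lambda>x. ennreal (D x)) = density lborel (\<lambda>x. ennreal (- D x))"
  proof (rule measure_eqI_lessThan)
    fix a
    have int: "integrable lborel (\<lambda>x. D x * indicator {a<..} x)"
      by (rule Bochner_Integration.integrable_bound[OF D]) (auto simp: indicator_def)
    have i: "integrable lborel (\<lambda>x. max (c * (D x * indicator {a<..} x)) 0)" for c :: real
      using int by (intro integrable_max integrable_mult_right) auto
    have em: "emeasure (density lborel (\<lambda>x. ennreal (c * D x))) {a<..}
      = ennreal (LINT x|lborel. max (c * (D x * indicator {a<..} x)) 0)" for c :: real
    proof -
      have "emeasure (density lborel (\<lambda>x. ennreal (c * D x))) {a<..}
        = (\<integral>\<^sup>+x. ennreal (max (c * (D x * indicator {a<..} x)) 0) \<partial>lborel)"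
        by (subst emeasure_density) (auto intro!: nn_integral_cong split: split_indicator simp: max_def ennreal_neg)
      also have "\<dots> = ennreal (LINT x|lborel. max (c * (D x * indicator {a<..} x)) 0)"
        by (intro nn_integral_eq_integral i) auto
      finally show ?thesis .
    qed
    have "(LINT x|lborel. max (1 * (D x * indicator {a<..} x)) 0) - (LINT x|lborel. max (- 1 * (D x * indicator {a<..} x)) 0)
      = (LINT x|lborel. max (1 * (D x * indicator {a<..} x)) 0 - max (- 1 * (D x * indicator {a<..} x)) 0)"
      by (intro Bochner_Integration.integral_diff[symmetric] i)
    also have "\<dots> = (LINT x|lborel. D x * indicator {a<..} x)"
      by (intro Bochner_Integration.integral_cong refl) (simp add: max_def)
    finally show "emeasure (density lborel (\<lambda>x. ennreal (D x))) {a<..}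
        = emeasure (density lborel (\<lambda>x. ennreal (- D x))) {a<..}"
      using em[of 1] em[of "-1"] tail[of a] by simp
    show "emeasure (density lborel (\<lambda>x. ennreal (D x))) {a<..} < \<infinity>"
      using em[of 1] by simp
  qed auto
  then have "AE x in lborel. ennreal (D x) = ennreal (- D x)"
    by (intro sigma_finite_measure.density_unique[OF sigma_finite_lborel]) auto
  then show ?thesis
  proof eventually_elim
    case (elim x)
    then show ?case
      by (cases "D x" "0::real" rule: linorder_cases) (auto simp: ennreal_neg)
  qed
qed

lemma AE_eq_0_if_interval_integrals_0:
  fixes D :: "real \<Rightarrow> complex"
  assumes D: "integrable lborel D"
    and 0: "\<And>a b. (LINT x|lborel. D x * of_real (indicator {a<..<b} x)) = 0"
  shows "AE x in lborel. D x = 0"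
proof -
  have int: "integrable lborel (\<lambda>x. D x * of_real (indicator {a<..<b} x))" for a b
    by (rule Bochner_Integration.integrable_bound[OF D])
      (use borel_measurable_integrable[OF D] in \<open>auto simp: indicator_def\<close>)
  have "AE x in lborel. Re (D x) = 0"
    using integral_Re[OF int] 0 by (intro AE_eq_0_if_interval_integrals_0_real integrable_Re D) simp
  moreover have "AE x in lborel. Im (D x) = 0"
    using integral_Im[OF int] 0 by (intro AE_eq_0_if_interval_integrals_0_real integrable_Im D) simp
  ultimately show ?thesis
    by eventually_elim (simp add: complex_eq_iff)
qed

lemma integrable_mult_bounded:
  fixes D :: "'a \<Rightarrow> complex"
  assumes "integrable M D" "g \<in> borel_measurable M" "\<And>x. cmod (g x) \<le> B"
  shows "integrable M (\<lambda>x. D x * g x)"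
proof (rule Bochner_Integration.integrable_bound)
  show "integrable M (\<lambda>x. B * cmod (D x))"
    using assms by auto
  show "(\<lambda>x. D x * g x) \<in> borel_measurable M"
    using borel_measurable_integrable[OF assms(1)] assms(2) by (rule borel_measurable_times)
  have "cmod (D x) * cmod (g x) \<le> cmod (D x) * B" for x
    by (intro mult_left_mono assms) simp
  then have "cmod (D x * g x) \<le> \<bar>B * cmod (D x)\<bar>" for x
    unfolding norm_mult by (smt (verit) mult.commute)
  then show "AE x in M. norm (D x * g x) \<le> norm (B * cmod (D x))"
    by simp
qed

text \<open>Indicators of open intervals are bounded limits of the functions \<open>bump\<close>, so
  dominated convergence reduces the claim to integrals over intervals.\<close>

lemma AE_eq_0_if_test_integrals_0:
  fixes D :: "real \<Rightarrow> complex"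
  assumes D: "integrable lborel D"
    and 0: "\<And>\<phi>. test_function \<phi> \<Longrightarrow> (LINT x|lborel. D x * of_real (\<phi> x)) = 0"
  shows "AE x in lborel. D x = 0"
proof (rule AE_eq_0_if_interval_integrals_0[OF D])
  fix a b :: real
  have m: "(\<lambda>x. bump a b n x) \<in> borel_measurable borel" for n
    using test_function_bounded(1)[OF test_function_bump] by (rule borel_measurable_continuous_onI)
  have [measurable]: "D \<in> borel_measurable borel"
    using borel_measurable_integrable[OF D] by simp
  have "(\<lambda>n. LINT x|lborel. D x * of_real (bump a b n x)) \<longlonglongrightarrow> (LINT x|lborel. D x * of_real (indicator {a<..<b} x))"
  proof (rule integral_dominated_convergence[where w = "\<lambda>x. cmod (D x)"])
    show "(\<lambda>x. D x * of_real (bump a b n x)) \<in> borel_measurable lborel" for n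
      using m[of n] by simp
    show "AE x in lborel. (\<lambda>n. D x * of_real (bump a b n x)) \<longlonglongrightarrow> D x * of_real (indicator {a<..<b} x)"
      by (intro AE_I2 tendsto_intros bump_tendsto)
    have "cmod (D x) * \<bar>bump a b n x\<bar> \<le> cmod (D x) * 1" for n x
      by (intro mult_left_mono bump_bounded) simp
    then show "AE x in lborel. norm (D x * of_real (bump a b n x)) \<le> cmod (D x)" for n
      by (simp add: norm_mult)
  qed (use D in auto)
  then show "(LINT x|lborel. D x * of_real (indicator {a<..<b} x)) = 0"
    unfolding 0[OF test_function_bump] by (simp add: LIMSEQ_const_iff)
qed

lemma integral_shift:
  fixes f :: "real \<Rightarrow> 'a::{banach, second_countable_topology}"
  shows "(LINT x|lborel. f (x + s)) = (LINT x|lborel. f x)"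
  using lborel_integral_real_affine[of 1 f s] by (simp add: add.commute)

lemma integrable_shift:
  fixes f :: "real \<Rightarrow> 'a::{banach, second_countable_topology}"
  shows "integrable lborel (\<lambda>x. f (x + s)) \<longleftrightarrow> integrable lborel f"
  using lborel_integrable_real_affine_iff[of 1 f s] by (simp add: add.commute)

section \<open>Weak derivatives and Hoelder continuity\<close>

text \<open>The counterpart of \<open>is_weak_deriv\<close> over \<open>lborel\<close>, meant for
  the unweighted products \<open>f w\<close>.\<close>

definition weakly_differentiable :: "(real \<Rightarrow> complex) \<Rightarrow> (real \<Rightarrow> complex) \<Rightarrow> bool" where
  "weakly_differentiable p p' \<longleftrightarrow> (\<forall>\<phi>. test_function \<phi> \<longrightarrow>
     (LINT x|lborel. p x * of_real (deriv \<phi> x)) = - (LINT x|lborel. p' x * of_real (\<phi> x)))"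

lemma integrable_indicator_Icc: "integrable lborel (indicator {a..b} :: real \<Rightarrow> real)" for a b :: real
  by (intro integrable_real_indicator) (auto simp: emeasure_lborel_Icc_eq)

lemma
  fixes q :: "real \<Rightarrow> complex" and K :: "real \<Rightarrow> complex"
  assumes q: "integrable lborel q" and [measurable]: "K \<in> borel_measurable borel" and B: "\<And>u. cmod (K u) \<le> B"
  shows fubini_shift_integrable: "integrable lborel (\<lambda>u. (LINT t|lborel. indicator {0..s} t *\<^sub>R q (u + t)) * K u)"
    and fubini_shift: "(LINT u|lborel. (LINT t|lborel. indicator {0..s} t *\<^sub>R q (u + t)) * K u)
      = (LINT t|lborel. indicator {0..s} t *\<^sub>R (LINT u|lborel. q (u + t) * K u))"
proof -
  have [measurable]: "q \<in> borel_measurable borel"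
    using borel_measurable_integrable[OF q] by simp
  have B0: "0 \<le> B" using order_trans[OF norm_ge_zero B] .
  have int: "integrable (lborel \<Otimes>\<^sub>M lborel) (\<lambda>(t, u). of_real (indicator {0..s} t) * (q (u + t) * K u))"
  proof (rule integrable_mult_kernel[where C = "B * (LINT u|lborel. cmod (q u))"])
    show "integrable lborel (\<lambda>t. complex_of_real (indicator {0..s} t))"
      using integrable_indicator_Icc[of 0 s] by (simp only: complex_of_real_integrable_eq)
    show i: "integrable lborel (\<lambda>u. q (u + t) * K u)" for t
      using q B by (intro integrable_mult_bounded) (auto simp: integrable_shift)
    show "(LINT u|lborel. cmod (q (u + t) * K u)) \<le> B * (LINT u|lborel. cmod (q u))" for t
    proof -
      have "(LINT u|lborel. cmod (q (u + t) * K u)) \<le> (LINT u|lborel. B * cmod (q (u + t)))"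
      proof (rule integral_mono)
        show "integrable lborel (\<lambda>u. B * cmod (q (u + t)))"
          using q integrable_shift[of q t] by auto
        show "cmod (q (u + t) * K u) \<le> B * cmod (q (u + t))" for u
          using mult_left_mono[OF B[of u] norm_ge_zero[of "q (u + t)"]] by (simp add: norm_mult mult.commute)
      qed (use i in auto)
      also have "\<dots> = B * (LINT u|lborel. cmod (q u))"
        using integral_shift[of "\<lambda>u. cmod (q u)" t] by simp
      finally show ?thesis .
    qed
  qed measurable
  have eq: "(LINT t|lborel. of_real (indicator {0..s} t) * (q (u + t) * K u))
    = (LINT t|lborel. indicator {0..s} t *\<^sub>R q (u + t)) * K u" for u
    by (simp add: scaleR_conv_of_real mult.assoc[symmetric])
  show "integrable lborel (\<lambda>u. (LINT t|lborel. indicator {0..s} t *\<^sub>R q (u + t)) * K u)"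
    using lborel_pair.integrable_snd[OF int] by (simp add: eq)
  show "(LINT u|lborel. (LINT t|lborel. indicator {0..s} t *\<^sub>R q (u + t)) * K u)
      = (LINT t|lborel. indicator {0..s} t *\<^sub>R (LINT u|lborel. q (u + t) * K u))"
    using lborel_pair.Fubini_integral[OF int] by (simp add: eq scaleR_conv_of_real)
qed

text \<open>Testing against \<open>\<phi>(x - t)\<close> and integrating over \<open>0 \<le> t \<le> s\<close> turns the weak derivative into
  a difference.\<close>

lemma weakly_differentiable_shift:
  assumes p: "integrable lborel p" and p': "integrable lborel p'"
    and weak: "weakly_differentiable p p'" and s: "s \<ge> 0"
  shows "AE y in lborel. p (y + s) - p y = (LINT t|lborel. indicator {0..s} t *\<^sub>R p' (y + t))"
proof -
  have [measurable]: "p \<in> borel_measurable borel" "p' \<in> borel_measurable borel"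
    using borel_measurable_integrable[OF p] borel_measurable_integrable[OF p'] by simp_all
  let ?I = "\<lambda>y. LINT t|lborel. indicator {0..s} t *\<^sub>R p' (y + t)"
  define D where "D = (\<lambda>y. p (y + s) - p y - ?I y)"
  have I: "integrable lborel ?I"
    using fubini_shift_integrable[OF p', of "\<lambda>_. 1" 1 s] by simp
  have D: "integrable lborel D"
    unfolding D_def using p I by (auto simp: integrable_shift)
  have "AE y in lborel. D y = 0"
  proof (rule AE_eq_0_if_test_integrals_0[OF D])
    fix \<phi> assume \<phi>: "test_function \<phi>"
    obtain B B' where B: "\<And>x. \<bar>\<phi> x\<bar> \<le> B" and B': "\<And>x. \<bar>deriv \<phi> x\<bar> \<le> B'"
      using test_function_bounded(3,4)[OF \<phi>] by metis
    have c: "continuous_on UNIV \<phi>" "continuous_on UNIV (deriv \<phi>)"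
      using test_function_bounded(1,2)[OF \<phi>] by auto
    have [measurable]: "\<phi> \<in> borel_measurable borel" "deriv \<phi> \<in> borel_measurable borel"
      using c by (auto intro: borel_measurable_continuous_onI)
    have d: "(\<phi> has_real_derivative deriv \<phi> x) (at x)" for x
      using \<phi> smooth_upto_differentiable[of 0 \<phi>] by (simp add: test_function_iff field_differentiable_derivI)
    have int1: "integrable (lborel \<Otimes>\<^sub>M lborel) (\<lambda>(x, t). p x * of_real (indicator {0..s} t * deriv \<phi> (x - t)))"
    proof (rule integrable_mult_kernel[OF p, where C = "B' * s"])
      have bd: "\<bar>indicator {0..s} t * deriv \<phi> (x - t)\<bar> \<le> B' * indicator {0..s} t" for x t
        using B'[of "x - t"] by (auto simp: indicator_def)
      have i: "integrable lborel (\<lambda>t. B' * indicator {0..s} t)"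
        by (intro integrable_mult_right integrable_indicator_Icc)
      have i': "integrable lborel (\<lambda>t. indicator {0..s} t * deriv \<phi> (x - t))" for x
        by (rule Bochner_Integration.integrable_bound[OF i]) (use bd in \<open>auto intro: order_trans[OF _ abs_ge_self]\<close>)
      then show "integrable lborel (\<lambda>t. complex_of_real (indicator {0..s} t * deriv \<phi> (x - t)))" for x
        by (simp only: integrable_of_real)
      have "(LINT t|lborel. \<bar>indicator {0..s} t * deriv \<phi> (x - t)\<bar>) \<le> (LINT t|lborel. B' * indicator {0..s} t)" for x
        by (intro integral_mono i bd integrable_abs i')
      then show "(LINT t|lborel. cmod (complex_of_real (indicator {0..s} t * deriv \<phi> (x - t)))) \<le> B' * s" for x
        using s by (simp only: norm_of_real) simp
    qed measurable
    have ftc: "(LINT t|lborel. indicator {0..s} t * deriv \<phi> (x - t)) = \<phi> x - \<phi> (x - s)" for x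
    proof -
      have "(LBINT t. indicator {0..s} t *\<^sub>R deriv \<phi> (x - t)) = - \<phi> (x - s) - (- \<phi> (x - 0))"
      proof (rule integral_FTC_atLeastAtMost[OF s])
        fix t
        have "((\<lambda>t. \<phi> (x - t)) has_real_derivative deriv \<phi> (x - t) * (- 1)) (at t)"
          by (rule DERIV_chain2[OF d]) (auto intro!: derivative_eq_intros)
        then have "((\<lambda>t. - \<phi> (x - t)) has_real_derivative deriv \<phi> (x - t)) (at t)"
          by (auto dest: DERIV_minus)
        then show "((\<lambda>t. - \<phi> (x - t)) has_vector_derivative deriv \<phi> (x - t)) (at t within {0..s})"
          by (simp add: has_real_derivative_iff_has_vector_derivative has_vector_derivative_at_within)
      next
        show "continuous_on {0..s} (\<lambda>t. deriv \<phi> (x - t))"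
          by (rule continuous_on_compose2[OF c(2)]) (auto intro!: continuous_intros)
      qed
      then show ?thesis by simp
    qed
    have ip: "integrable lborel (\<lambda>x. p x * of_real (\<phi> x))"
      using B by (intro integrable_mult_bounded[OF p]) auto
    have ips: "integrable lborel (\<lambda>x. p x * of_real (\<phi> (x - s)))"
      using B by (intro integrable_mult_bounded[OF p]) auto
    have ips': "integrable lborel (\<lambda>x. p (x + s) * of_real (\<phi> x))"
      using B p by (intro integrable_mult_bounded) (auto simp: integrable_shift)
    have iI: "integrable lborel (\<lambda>x. ?I x * of_real (\<phi> x))"
      using B by (intro integrable_mult_bounded[OF I]) auto
    have "(LINT x|lborel. p x * of_real (\<phi> x)) - (LINT x|lborel. p (x + s) * of_real (\<phi> x))
      = (LINT x|lborel. p x * of_real (\<phi> x)) - (LINT x|lborel. p x * of_real (\<phi> (x - s)))"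
      using integral_shift[of "\<lambda>x. p x * of_real (\<phi> (x - s))" s] by simp
    also have "\<dots> = (LINT x|lborel. p x * of_real (\<phi> x - \<phi> (x - s)))"
      using ip ips by (simp add: right_diff_distrib)
    also have "\<dots> = (LINT x|lborel. LINT t|lborel. p x * of_real (indicator {0..s} t * deriv \<phi> (x - t)))"
      unfolding ftc[symmetric] by (simp only: integral_mult_right_zero integral_complex_of_real)
    also have "\<dots> = (LINT t|lborel. LINT x|lborel. p x * of_real (indicator {0..s} t * deriv \<phi> (x - t)))"
      using lborel_pair.Fubini_integral[OF int1] by simp
    also have "\<dots> = (LINT t|lborel. - (indicator {0..s} t *\<^sub>R (LINT u|lborel. p' (u + t) * of_real (\<phi> u))))"
    proof (intro Bochner_Integration.integral_cong refl)
      fix t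
      have "(LINT x|lborel. p x * of_real (deriv \<phi> (x - t))) = - (LINT x|lborel. p' x * of_real (\<phi> (x - t)))"
        using weak test_function_translate[OF \<phi>, of t] by (auto simp: weakly_differentiable_def)
      also have "(LINT x|lborel. p' x * of_real (\<phi> (x - t))) = (LINT u|lborel. p' (u + t) * of_real (\<phi> u))"
        using integral_shift[of "\<lambda>x. p' x * of_real (\<phi> (x - t))" t] by simp
      finally have *: "(LINT x|lborel. p x * of_real (deriv \<phi> (x - t))) = - (LINT u|lborel. p' (u + t) * of_real (\<phi> u))" .
      have "(LINT x|lborel. p x * of_real (indicator {0..s} t * deriv \<phi> (x - t)))
        = of_real (indicator {0..s} t) * (LINT x|lborel. p x * of_real (deriv \<phi> (x - t)))"
        by (simp only: integral_mult_right_zero[symmetric] of_real_mult mult.left_commute)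
      then show "(LINT x|lborel. p x * of_real (indicator {0..s} t * deriv \<phi> (x - t)))
        = - (indicator {0..s} t *\<^sub>R (LINT u|lborel. p' (u + t) * of_real (\<phi> u)))"
        by (simp add: * scaleR_conv_of_real)
    qed
    also have "\<dots> = - (LINT u|lborel. ?I u * of_real (\<phi> u))"
      using fubini_shift[OF p', of "\<lambda>u. of_real (\<phi> u)" B s] B by simp
    finally have "(LINT x|lborel. p x * of_real (\<phi> x)) - (LINT x|lborel. p (x + s) * of_real (\<phi> x))
      = - (LINT u|lborel. ?I u * of_real (\<phi> u))" .
    from arg_cong[OF this, of uminus]
    have "(LINT x|lborel. p (x + s) * of_real (\<phi> x)) - (LINT x|lborel. p x * of_real (\<phi> x))
      = (LINT u|lborel. ?I u * of_real (\<phi> u))"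
      by (simp only: minus_diff_eq minus_minus)
    moreover have "(LINT x|lborel. D x * of_real (\<phi> x)) = (LINT x|lborel. p (x + s) * of_real (\<phi> x))
      - (LINT x|lborel. p x * of_real (\<phi> x)) - (LINT u|lborel. ?I u * of_real (\<phi> u))"
      unfolding D_def using ip ips' iI by (simp add: left_diff_distrib)
    ultimately show "(LINT x|lborel. D x * of_real (\<phi> x)) = 0"
      by simp
  qed
  then show ?thesis
    by eventually_elim (simp add: D_def)
qed

text \<open>The origin of the Hoelder exponent \<open>1 / 2\<close>: the norm of the indicator of an
  interval is the square root of its length.\<close>

lemma Cauchy_Schwarz_Icc:
  fixes q :: "real \<Rightarrow> complex"
  assumes [measurable]: "q \<in> borel_measurable borel" and q: "integrable lborel (\<lambda>x. (cmod (q x))\<^sup>2)"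
    and "a \<le> b" "(LINT x|lborel. (cmod (q x))\<^sup>2) \<le> N\<^sup>2" "N \<ge> 0"
  shows "integrable lborel (\<lambda>x. indicator {a..b} x *\<^sub>R q x)"
    "cmod (LINT x|lborel. indicator {a..b} x *\<^sub>R q x) \<le> N * sqrt (b - a)"
proof -
  have ind: "(cmod (complex_of_real (indicator {a..b} x)))\<^sup>2 = indicator {a..b} x" for x
    by (simp add: indicator_def)
  show "integrable lborel (\<lambda>x. indicator {a..b} x *\<^sub>R q x)"
    unfolding scaleR_conv_of_real
    by (rule integrable_mult_of_square_integrable) (use q integrable_indicator_Icc in \<open>auto simp only: ind\<close>, measurable)
  have "(cmod (LINT x|lborel. of_real (indicator {a..b} x) * q x))\<^sup>2 \<le> (b - a) * (LINT x|lborel. (cmod (q x))\<^sup>2)"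
    using Cauchy_Schwarz_integral[of "\<lambda>x. of_real (indicator {a..b} x)" lborel q, unfolded ind] q integrable_indicator_Icc[of a b] \<open>a \<le> b\<close>
    by simp
  also have "\<dots> \<le> (b - a) * N\<^sup>2"
    using assms by (intro mult_left_mono) auto
  also have "\<dots> = (N * sqrt (b - a))\<^sup>2"
    using \<open>a \<le> b\<close> by (simp add: power_mult_distrib)
  finally show "cmod (LINT x|lborel. indicator {a..b} x *\<^sub>R q x) \<le> N * sqrt (b - a)"
    unfolding scaleR_conv_of_real by (rule power2_le_imp_le) (use assms in simp)
qed

text \<open>On \<open>[x, x + 1]\<close> the function varies by at most \<open>B\<close> from its
  value at \<open>x\<close>, and its mean modulus there is at most \<open>N\<close> by
  Cauchy-Schwarz.\<close>

lemma holder_half_bounded: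
  fixes q :: "real \<Rightarrow> complex"
  assumes [measurable]: "q \<in> borel_measurable borel" and q: "integrable lborel (\<lambda>x. (cmod (q x))\<^sup>2)"
    and N: "(LINT x|lborel. (cmod (q x))\<^sup>2) \<le> N\<^sup>2" "N \<ge> 0"
    and H: "\<And>x y. cmod (q x - q y) \<le> B * sqrt \<bar>x - y\<bar>" and B: "B \<ge> 0"
  shows "cmod (q x) \<le> N + B"
proof -
  let ?i = "\<lambda>y. indicator {x..x + 1} y :: real"
  note CS = Cauchy_Schwarz_Icc[of q x "x + 1" N] Cauchy_Schwarz_Icc[of "\<lambda>y. of_real (cmod (q y))" x "x + 1" N]
  have i1: "integrable lborel (\<lambda>y. ?i y * cmod (q y))"
    using CS(3) q N by (simp add: scaleR_conv_of_real complex_of_real_integrable_eq flip: of_real_mult)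
  have "cmod (LINT y|lborel. ?i y *\<^sub>R complex_of_real (cmod (q y))) \<le> N"
    using CS(4) q N by simp
  then have i2: "(LINT y|lborel. ?i y * cmod (q y)) \<le> N"
    by (simp add: scaleR_conv_of_real flip: of_real_mult)
  have "cmod (q x) = (LINT y|lborel. ?i y * cmod (q x))"
    by simp
  also have "\<dots> \<le> (LINT y|lborel. ?i y * cmod (q y) + B * ?i y)"
  proof (rule integral_mono)
    show "integrable lborel (\<lambda>y. ?i y * cmod (q x))" "integrable lborel (\<lambda>y. ?i y * cmod (q y) + B * ?i y)"
      using integrable_indicator_Icc i1 by auto
    fix y
    have "cmod (q x) \<le> cmod (q y) + B" if y: "y \<in> {x..x + 1}"
    proof -
      have "cmod (q x) \<le> cmod (q y) + cmod (q x - q y)"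
        by (metis norm_triangle_sub add.commute)
      also have "cmod (q x - q y) \<le> B * sqrt \<bar>x - y\<bar>" by (rule H)
      also have "\<dots> \<le> B * 1"
        using y B by (intro mult_left_mono) auto
      finally show ?thesis by simp
    qed
    then show "?i y * cmod (q x) \<le> ?i y * cmod (q y) + B * ?i y"
      by (simp add: indicator_def)
  qed
  also have "\<dots> = (LINT y|lborel. ?i y * cmod (q y)) + B"
    using i1 integrable_indicator_Icc[of x "x + 1"] by simp
  finally show ?thesis using i2 by simp
qed

text \<open>The transform commutes with translations, so the difference formula for \<open>p\<close>
  is inherited: at a fixed height the transform of \<open>p'\<close> is the derivative of the
  transform of \<open>p\<close>.\<close>

lemma cauchy_transform_shift:
  assumes p: "integrable lborel p" and p': "integrable lborel p'"
    and weak: "weakly_differentiable p p'" and s: "s \<ge> 0" and \<eta>: "\<eta> \<noteq> 0"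
  shows "cauchy_transform p \<eta> (l + s) - cauchy_transform p \<eta> l
    = (LINT t|lborel. indicator {0..s} t *\<^sub>R cauchy_transform p' \<eta> (l + t))"
proof -
  have [measurable]: "p \<in> borel_measurable borel" "p' \<in> borel_measurable borel"
    using borel_measurable_integrable[OF p] borel_measurable_integrable[OF p'] by simp_all
  let ?K = "\<lambda>u. cauchy_kernel \<eta> (u - l)"
  have sh: "cauchy_transform q \<eta> (l + t) = (LINT u|lborel. q (u + t) * ?K u)" for q t
    unfolding cauchy_transform_def
    using integral_shift[of "\<lambda>z. q z * cauchy_kernel \<eta> (z - (l + t))" t] by (simp add: algebra_simps)
  have i1: "integrable lborel (\<lambda>u. p (u + s) * ?K u)" and i2: "integrable lborel (\<lambda>u. p u * ?K u)"
    using p integrable_shift[of p s] integrable_mult_cauchy_kernel[OF _ \<eta>, of "\<lambda>u. p (u + s)" l]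
      integrable_mult_cauchy_kernel[OF p \<eta>, of l] by auto
  have "cauchy_transform p \<eta> (l + s) - cauchy_transform p \<eta> l = (LINT u|lborel. (p (u + s) - p u) * ?K u)"
    using i1 i2 sh[of p s] sh[of p 0] by (simp add: left_diff_distrib)
  also have "\<dots> = (LINT u|lborel. (LINT t|lborel. indicator {0..s} t *\<^sub>R p' (u + t)) * ?K u)"
    using weakly_differentiable_shift[OF p p' weak s] by (intro integral_cong_AE) (auto, measurable)
  also have "\<dots> = (LINT t|lborel. indicator {0..s} t *\<^sub>R (LINT u|lborel. p' (u + t) * ?K u))"
    by (rule fubini_shift[OF p', of ?K "1 / \<bar>\<eta>\<bar>"]) (auto intro: norm_cauchy_kernel_le[OF \<eta>])
  finally show ?thesis
    by (simp only: sh)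
qed

lemma AE_lborel_dense:
  assumes "AE x in lborel. P x" "a < (b::real)"
  shows "\<exists>x. a < x \<and> x < b \<and> P x"
proof (rule ccontr)
  assume "\<not> ?thesis"
  then have "AE x in lborel. x \<notin> {a<..<b}"
    using assms(1) by (auto elim!: eventually_mono)
  then have "emeasure lborel {a<..<b} = 0"
    using AE_iff_null_sets[of "{a<..<b}" lborel] by (auto dest: null_setsD1)
  then show False
    using assms(2) by simp
qed

text \<open>The transform of \<open>p'\<close> has a norm bounded independently of the height, so
  its integral over an interval is controlled by the root of the length. Independence of
  \<open>\<eta>\<close> is what makes the family equicontinuous.\<close>

lemma cauchy_transform_holder:
  assumes p: "integrable lborel p" and p': "integrable lborel p'"
    and p'2: "integrable lborel (\<lambda>x. (cmod (p' x))\<^sup>2)"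
    and N: "(LINT x|lborel. (cmod (p' x))\<^sup>2) \<le> N\<^sup>2" "N \<ge> 0"
    and weak: "weakly_differentiable p p'" and \<eta>: "\<eta> \<noteq> 0"
  shows "cmod (cauchy_transform p \<eta> x - cauchy_transform p \<eta> y) \<le> 2 * pi * N * sqrt \<bar>x - y\<bar>"
proof -
  have [measurable]: "p' \<in> borel_measurable borel"
    using borel_measurable_integrable[OF p'] by simp
  have *: "cmod (cauchy_transform p \<eta> (l + s) - cauchy_transform p \<eta> l) \<le> 2 * pi * N * sqrt s" if s: "s \<ge> 0" for l s
  proof -
    let ?q = "\<lambda>t. cauchy_transform p' \<eta> (l + t)"
    have "(LINT t|lborel. (cmod (?q t))\<^sup>2) = (LINT t|lborel. (cmod (cauchy_transform p' \<eta> t))\<^sup>2)"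
      using integral_shift[of "\<lambda>t. (cmod (cauchy_transform p' \<eta> t))\<^sup>2" l] by (simp add: add.commute)
    also have "\<dots> \<le> (2 * pi)\<^sup>2 * (LINT x|lborel. (cmod (p' x))\<^sup>2)"
      by (rule cauchy_transform_L2_bound'[OF p' p'2 \<eta>])
    also have "\<dots> \<le> (2 * pi * N)\<^sup>2"
      unfolding power_mult_distrib by (intro mult_left_mono N) auto
    finally have "(LINT t|lborel. (cmod (?q t))\<^sup>2) \<le> (2 * pi * N)\<^sup>2" .
    moreover have "integrable lborel (\<lambda>t. (cmod (?q t))\<^sup>2)"
      using integrable_shift[of "\<lambda>t. (cmod (cauchy_transform p' \<eta> t))\<^sup>2" l] integrable_cauchy_transform_sq[OF p' \<eta>]
      by (simp add: add.commute)
    ultimately show ?thesis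
      unfolding cauchy_transform_shift[OF p p' weak s \<eta>]
      using Cauchy_Schwarz_Icc(2)[of ?q 0 s "2 * pi * N"] s N by simp
  qed
  show ?thesis
  proof (cases "x \<le> y")
    case True
    then show ?thesis using *[of "y - x" x] by (simp add: norm_minus_commute)
  next
    case False
    then show ?thesis using *[of "x - y" y] by simp
  qed
qed

text \<open>Equicontinuity upgrades almost everywhere convergence to convergence everywhere.\<close>

lemma cauchy_transform_boundary_right:
  assumes p: "integrable lborel p" and p': "integrable lborel p'"
    and p2: "integrable lborel (\<lambda>x. (cmod (p x))\<^sup>2)" and p'2: "integrable lborel (\<lambda>x. (cmod (p' x))\<^sup>2)"
    and M: "(LINT x|lborel. (cmod (p x))\<^sup>2) \<le> N\<^sup>2"
    and N: "(LINT x|lborel. (cmod (p' x))\<^sup>2) \<le> N\<^sup>2" "N \<ge> 0"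
    and weak: "weakly_differentiable p p'"
  shows "\<exists>G. (\<forall>x. ((\<lambda>\<eta>. cauchy_transform p \<eta> x) \<longlongrightarrow> G x) (at_right 0)) \<and>
    (\<forall>x. cmod (G x) \<le> 4 * pi * N) \<and> (\<forall>x y. cmod (G x - G y) \<le> 4 * pi * N * sqrt \<bar>x - y\<bar>)"
proof -
  let ?F = "cauchy_transform p"
  have [measurable]: "p \<in> borel_measurable borel"
    using borel_measurable_integrable[OF p] by simp
  note hol = cauchy_transform_holder[OF p p' p'2 N weak]
  have bd: "cmod (?F \<eta> x) \<le> 4 * pi * N" if \<eta>: "\<eta> \<noteq> 0" for \<eta> x
  proof -
    have "(LINT t|lborel. (cmod (?F \<eta> t))\<^sup>2) \<le> (2 * pi)\<^sup>2 * (LINT x|lborel. (cmod (p x))\<^sup>2)"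
      by (rule cauchy_transform_L2_bound'[OF p p2 \<eta>])
    also have "\<dots> \<le> (2 * pi * N)\<^sup>2"
      unfolding power_mult_distrib by (intro mult_left_mono M) auto
    finally have "cmod (?F \<eta> x) \<le> 2 * pi * N + 2 * pi * N"
      using hol[OF \<eta>] N by (intro holder_half_bounded integrable_cauchy_transform_sq p \<eta>) auto
    then show ?thesis by (simp add: mult_ac)
  qed
  have "\<exists>L. ((\<lambda>\<eta>. ?F \<eta> x) \<longlongrightarrow> L) (at_right 0)" for x
  proof (rule convergent_at_right_if_cauchy)
    fix r :: real assume r: "r > 0"
    \<comment> \<open>A point \<open>y\<close> within distance \<open>\<rho>\<close> changes every
      transform by less than \<open>r / 3\<close>, whatever the height. The summand 1 guards against
      \<open>N = 0\<close>.\<close>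
    define \<rho> where "\<rho> = (r / 3 / (2 * pi * N + 1))\<^sup>2"
    have d0: "2 * pi * N + 1 > 0" using N by (simp add: add_nonneg_pos)
    then have "\<rho> > 0" using r by (simp add: \<rho>_def)
    then obtain y where y: "x - \<rho> < y" "y < x" "\<exists>L. ((\<lambda>\<eta>. ?F \<eta> y) \<longlongrightarrow> L) (at_right 0)"
      using AE_lborel_dense[OF AE_cauchy_transform_convergent[OF p p2], of "x - \<rho>" x] by auto
    have sq: "sqrt \<bar>x - y\<bar> \<le> r / 3 / (2 * pi * N + 1)"
      using y r d0 by (intro real_le_lsqrt) (auto simp: \<rho>_def)
    have near: "cmod (?F \<eta> x - ?F \<eta> y) < r / 3" if "\<eta> \<noteq> 0" for \<eta>
    proof -
      have "cmod (?F \<eta> x - ?F \<eta> y) \<le> 2 * pi * N * (r / 3 / (2 * pi * N + 1))"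
        using hol[OF that, of x y] sq N by (meson mult_left_mono mult_nonneg_nonneg order_trans pi_ge_zero zero_le_numeral)
      also have "\<dots> = (2 * pi * N / (2 * pi * N + 1)) * (r / 3)"
        by simp
      also have "\<dots> < 1 * (r / 3)"
        using r d0 by (intro mult_strict_right_mono) auto
      finally show ?thesis by simp
    qed
    obtain L where L: "((\<lambda>\<eta>. ?F \<eta> y) \<longlongrightarrow> L) (at_right 0)"
      using y(3) by blast
    have "\<forall>\<^sub>F \<eta> in at_right 0. dist (?F \<eta> y) L < r / 6"
      using r by (intro tendstoD[OF L]) simp
    then obtain d where d: "d > 0" "\<And>\<eta>. 0 < \<eta> \<Longrightarrow> \<eta> < d \<Longrightarrow> dist (?F \<eta> y) L < r / 6"
      unfolding eventually_at_right_field by blast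
    show "\<exists>d>0. \<forall>a b. 0 < a \<and> a < d \<and> 0 < b \<and> b < d \<longrightarrow> dist (?F a x) (?F b x) < r"
    proof (intro exI[of _ d] conjI allI impI d(1))
      fix a b assume ab: "0 < a \<and> a < d \<and> 0 < b \<and> b < d"
      have "dist (?F a y) (?F b y) < r / 3"
        using dist_triangle_half_l[of "?F a y" L "r / 3" "?F b y"] d(2)[of a] d(2)[of b] ab by simp
      moreover have "dist (?F a x) (?F a y) < r / 3" "dist (?F b y) (?F b x) < r / 3"
        using near[of a] near[of b] ab by (auto simp: dist_norm norm_minus_commute)
      ultimately show "dist (?F a x) (?F b x) < r"
        using dist_triangle[of "?F a x" "?F b x" "?F a y"] dist_triangle[of "?F a y" "?F b x" "?F b y"] by simp
    qed
  qed
  then obtain G where G: "\<And>x. ((\<lambda>\<eta>. ?F \<eta> x) \<longlongrightarrow> G x) (at_right 0)"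
    by metis
  have nz: "\<forall>\<^sub>F \<eta> in at_right (0::real). \<eta> \<noteq> 0"
    unfolding eventually_at_right_field by (intro exI[of _ 1]) auto
  have "cmod (G x) \<le> 4 * pi * N" for x
    using nz by (intro tendsto_upperbound[OF tendsto_norm[OF G]]) (auto elim: eventually_mono intro: bd)
  moreover have "cmod (G x - G y) \<le> 4 * pi * N * sqrt \<bar>x - y\<bar>" for x y
  proof -
    have "cmod (G x - G y) \<le> 2 * pi * N * sqrt \<bar>x - y\<bar>"
      using nz by (intro tendsto_upperbound[OF tendsto_norm[OF tendsto_diff[OF G G]]]) (auto elim: eventually_mono intro: hol)
    also have "\<dots> \<le> 4 * pi * N * sqrt \<bar>x - y\<bar>"
      using N by (intro mult_right_mono) auto
    finally show ?thesis .
  qed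
  ultimately show ?thesis
    using G by blast
qed

lemma weakly_differentiable_cnj:
  assumes "weakly_differentiable p p'"
  shows "weakly_differentiable (\<lambda>x. cnj (p x)) (\<lambda>x. cnj (p' x))"
  unfolding weakly_differentiable_def
proof (intro allI impI)
  fix \<phi> assume "test_function \<phi>"
  then have "(LINT x|lborel. p x * of_real (deriv \<phi> x)) = - (LINT x|lborel. p' x * of_real (\<phi> x))"
    using assms by (simp add: weakly_differentiable_def)
  from arg_cong[OF this, of cnj]
  show "(LINT x|lborel. cnj (p x) * of_real (deriv \<phi> x)) = - (LINT x|lborel. cnj (p' x) * of_real (\<phi> x))"
    unfolding complex_cnj_minus Bochner_Integration.integral_cnj[symmetric] by simp
qed

lemma cauchy_transform_boundary_left:
  assumes p: "integrable lborel p" and p': "integrable lborel p'"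
    and p2: "integrable lborel (\<lambda>x. (cmod (p x))\<^sup>2)" and p'2: "integrable lborel (\<lambda>x. (cmod (p' x))\<^sup>2)"
    and M: "(LINT x|lborel. (cmod (p x))\<^sup>2) \<le> N\<^sup>2"
    and N: "(LINT x|lborel. (cmod (p' x))\<^sup>2) \<le> N\<^sup>2" "N \<ge> 0"
    and weak: "weakly_differentiable p p'"
  shows "\<exists>G. (\<forall>x. ((\<lambda>\<eta>. cauchy_transform p \<eta> x) \<longlongrightarrow> G x) (at_left 0)) \<and>
    (\<forall>x. cmod (G x) \<le> 4 * pi * N) \<and> (\<forall>x y. cmod (G x - G y) \<le> 4 * pi * N * sqrt \<bar>x - y\<bar>)"
proof -
  obtain G where G: "\<And>x. ((\<lambda>\<eta>. cauchy_transform (\<lambda>x. cnj (p x)) \<eta> x) \<longlongrightarrow> G x) (at_right 0)"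
    "\<And>x. cmod (G x) \<le> 4 * pi * N" "\<And>x y. cmod (G x - G y) \<le> 4 * pi * N * sqrt \<bar>x - y\<bar>"
    using cauchy_transform_boundary_right[of "\<lambda>x. cnj (p x)" "\<lambda>x. cnj (p' x)" N]
      weakly_differentiable_cnj[OF weak] assms by auto
  have "((\<lambda>\<eta>. cauchy_transform p \<eta> x) \<longlongrightarrow> cnj (G x)) (at_left 0)" for x
  proof -
    have "((\<lambda>\<eta>. cauchy_transform p (- \<eta>) x) \<longlongrightarrow> cnj (G x)) (at_right 0)"
      unfolding cauchy_transform_cnj by (intro tendsto_cnj G(1))
    then show ?thesis by (simp add: filterlim_at_left_to_right)
  qed
  moreover have "cmod (cnj (G x) - cnj (G y)) \<le> 4 * pi * N * sqrt \<bar>x - y\<bar>" for x y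
    using G(3)[of x y] by (simp flip: complex_cnj_diff)
  ultimately show ?thesis
    using G(2) by (intro exI[of _ "\<lambda>x. cnj (G x)"]) auto
qed

text \<open>The primitive \<open>P\<close> of \<open>p'\<close> is Hoelder continuous by
  Cauchy-Schwarz, and \<open>p - P\<close> is invariant under every translation up to null sets. It
  is therefore constant almost everywhere, and \<open>P\<close> plus that constant is the
  representative.\<close>

lemma weakly_differentiable_holder_representative:
  assumes p: "integrable lborel p" and p': "integrable lborel p'"
    and p2: "integrable lborel (\<lambda>x. (cmod (p x))\<^sup>2)" and p'2: "integrable lborel (\<lambda>x. (cmod (p' x))\<^sup>2)"
    and M: "(LINT x|lborel. (cmod (p x))\<^sup>2) \<le> N\<^sup>2"
    and N: "(LINT x|lborel. (cmod (p' x))\<^sup>2) \<le> N\<^sup>2" "N \<ge> 0"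
    and weak: "weakly_differentiable p p'"
  shows "\<exists>q. (AE x in lborel. p x = q x) \<and> (\<forall>x. cmod (q x) \<le> 2 * N) \<and>
    (\<forall>x y. cmod (q x - q y) \<le> 2 * N * sqrt \<bar>x - y\<bar>)"
proof -
  have [measurable]: "p \<in> borel_measurable borel" "p' \<in> borel_measurable borel"
    using borel_measurable_integrable[OF p] borel_measurable_integrable[OF p'] by simp_all
  define P where "P = (\<lambda>x. LINT t|lborel. indicator {..x} t *\<^sub>R p' t)"
  have Pi: "integrable lborel (\<lambda>t. indicator {..x} t *\<^sub>R p' t)" for x
    by (rule Bochner_Integration.integrable_bound[OF p']) (auto simp: indicator_def)
  have diff: "P (y + s) - P y = (LINT t|lborel. indicator {y..y + s} t *\<^sub>R p' t)" if "s \<ge> 0" for y s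
  proof -
    have "P (y + s) - P y = (LINT t|lborel. indicator {..y + s} t *\<^sub>R p' t - indicator {..y} t *\<^sub>R p' t)"
      unfolding P_def using Pi by simp
    also have "\<dots> = (LINT t|lborel. indicator {y..y + s} t *\<^sub>R p' t)"
    proof (rule integral_cong_AE)
      show "AE t in lborel. indicator {..y + s} t *\<^sub>R p' t - indicator {..y} t *\<^sub>R p' t = indicator {y..y + s} t *\<^sub>R p' t"
        using AE_lborel_singleton[of y] by eventually_elim (use that in \<open>auto simp: indicator_def\<close>)
    qed auto
    finally show ?thesis .
  qed
  have hol: "cmod (P x - P y) \<le> N * sqrt \<bar>x - y\<bar>" for x y
  proof -
    have *: "cmod (P (y + s) - P y) \<le> N * sqrt s" if "s \<ge> 0" for y s
      unfolding diff[OF that] using Cauchy_Schwarz_Icc(2)[OF _ p'2, of y "y + s" N] N that by simp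
    show ?thesis
      using *[of "x - y" y] *[of "y - x" x] by (cases "y \<le> x") (auto simp: norm_minus_commute)
  qed
  have "continuous_on UNIV P"
  proof (intro continuous_at_imp_continuous_on ballI)
    fix x
    have "((\<lambda>y. N * sqrt \<bar>y - x\<bar>) \<longlongrightarrow> N * sqrt \<bar>x - x\<bar>) (at x)"
      by (intro tendsto_intros)
    then have "((\<lambda>y. N * sqrt \<bar>y - x\<bar>) \<longlongrightarrow> 0) (at x)"
      by simp
    then have "((\<lambda>y. P y - P x) \<longlongrightarrow> 0) (at x)"
      by (rule Lim_null_comparison[rotated]) (intro always_eventually allI hol)
    then show "isCont P x"
      by (simp add: isCont_def LIM_zero_iff)
  qed
  then have [measurable]: "P \<in> borel_measurable borel"
    by (rule borel_measurable_continuous_onI)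
  define Q where "Q = (\<lambda>x. p x - P x)"
  have [measurable]: "Q \<in> borel_measurable borel"
    unfolding Q_def by measurable
  have pos: "AE y in lborel. Q (y + s) = Q y" if s: "s \<ge> 0" for s
    using weakly_differentiable_shift[OF p p' weak s]
  proof eventually_elim
    case (elim y)
    have "(LINT t|lborel. indicator {0..s} t *\<^sub>R p' (y + t)) = (LINT t|lborel. indicator {y..y + s} t *\<^sub>R p' t)"
      using integral_shift[of "\<lambda>t. indicator {y..y + s} t *\<^sub>R p' t" y]
      by (simp add: add.commute indicator_def)
    then show ?case
      using elim diff[OF s, of y] by (simp add: Q_def algebra_simps)
  qed
  have all: "AE y in lborel. Q (y + s) = Q y" for s
  proof (cases "s \<ge> 0")
    case False
    then have "AE y in lborel. Q (y + (- s)) = Q y"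
      by (intro pos) simp
    \<comment> \<open>Substituting \<open>s + y\<close> for \<open>y\<close> turns invariance under
      the shift by \<open>- s\<close> into invariance under the shift by \<open>s\<close>.\<close>
    then have "AE y in lborel. Q ((s + 1 * y) + (- s)) = Q (s + 1 * y)"
      by (rule AE_borel_affine[rotated 2]) auto
    then show ?thesis
      by eventually_elim (simp add: add.commute)
  qed (rule pos)
  have meas: "{x \<in> space (lborel \<Otimes>\<^sub>M lborel). Q (fst x + snd x) = Q (fst x)} \<in> sets (lborel \<Otimes>\<^sub>M lborel)"
    by measurable
  have "AE s in lborel. AE y in lborel. Q (y + s) = Q y"
    using all by simp
  \<comment> \<open>The exceptional null set depends on the shift. Exchanging the two quantifiers by
    Fubini yields one point \<open>y\<close> that serves almost all shifts, so \<open>Q\<close>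
    equals \<open>Q y\<close> almost everywhere.\<close>
  then have "AE y in lborel. AE s in lborel. Q (y + s) = Q y"
    using lborel_pair.AE_commute[OF meas] by simp
  then have "\<exists>y. 0 < y \<and> y < 1 \<and> (AE s in lborel. Q (y + s) = Q y)"
    by (rule AE_lborel_dense) simp
  then obtain y where y: "AE s in lborel. Q (y + s) = Q y"
    by blast
  have "AE s in lborel. Q (y + (- y + 1 * s)) = Q y"
    by (rule AE_borel_affine[OF _ _ y]) auto
  then have eq: "AE x in lborel. p x = Q y + P x"
    by eventually_elim (simp add: Q_def diff_eq_eq)
  let ?q = "\<lambda>x. Q y + P x"
  have hol': "cmod (?q x - ?q z) \<le> N * sqrt \<bar>x - z\<bar>" for x z
    using hol[of x z] by simp
  have "integrable lborel (\<lambda>x. (cmod (?q x))\<^sup>2)"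
    using p2 eq by (subst integrable_cong_AE[where g = "\<lambda>x. (cmod (p x))\<^sup>2"]) (auto elim: eventually_mono)
  moreover have "(LINT x|lborel. (cmod (?q x))\<^sup>2) = (LINT x|lborel. (cmod (p x))\<^sup>2)"
    using eq by (intro integral_cong_AE) (auto elim: eventually_mono)
  ultimately have "cmod (?q x) \<le> N + N" for x
    using hol' M N by (intro holder_half_bounded) auto
  \<comment> \<open>The Hoelder constant \<open>N\<close> is weakened to the constant
    \<open>2 * N\<close> of the supremum bound, so that one number serves for both.\<close>
  moreover have "cmod (?q x - ?q z) \<le> 2 * N * sqrt \<bar>x - z\<bar>" for x z
  proof -
    have "cmod (?q x - ?q z) \<le> N * sqrt \<bar>x - z\<bar>" by (rule hol')
    also have "\<dots> \<le> 2 * N * sqrt \<bar>x - z\<bar>"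
      using N by (intro mult_right_mono) auto
    finally show ?thesis .
  qed
  ultimately show ?thesis
    using eq by (intro exI[of _ ?q]) auto
qed

section \<open>The Gaussian weight and its Hilbert transform\<close>

lemma w_eq_normal_density: "w = normal_density 0 (1 / sqrt 2)"
  by (auto simp: w_def normal_density_def fun_eq_iff power_divide)

lemma w_pos: "0 < w v"
  by (simp add: w_def)

lemma w_nonneg: "0 \<le> w v"
  using w_pos[of v] by simp

lemma w_le_1: "w v \<le> 1"
proof -
  have "exp (- v\<^sup>2) / sqrt pi \<le> 1 / 1"
    using pi_ge_two by (intro frac_le) auto
  then show ?thesis by (simp add: w_def)
qed

lemma integrable_w: "integrable lborel w"
  by (simp add: w_eq_normal_density)

lemma integral_w: "(LINT v|lborel. w v) = 1"
  by (simp add: w_eq_normal_density)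

lemma borel_measurable_w [measurable]: "w \<in> borel_measurable borel"
  by (simp add: w_eq_normal_density)

lemma DERIV_w: "(w has_real_derivative - 2 * v * w v) (at v)"
proof -
  have "((\<lambda>v. exp (- v\<^sup>2)) has_real_derivative - 2 * v * exp (- v\<^sup>2)) (at v)"
    by (auto intro!: derivative_eq_intros)
  from DERIV_cdivide[OF this, of "sqrt pi"] show ?thesis
    by (simp add: w_def[abs_def])
qed

lemma mult_w_le_1: "v\<^sup>2 * w v \<le> 1" "\<bar>v\<bar> * w v \<le> 1"
proof -
  have "v\<^sup>2 \<le> exp (v\<^sup>2)"
    using exp_ge_add_one_self[of "v\<^sup>2"] by linarith
  then have "v\<^sup>2 * exp (- v\<^sup>2) \<le> 1"
    by (simp add: exp_minus field_simps)
  then have "v\<^sup>2 * exp (- v\<^sup>2) / sqrt pi \<le> 1 / 1"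
    using pi_ge_two by (intro frac_le) auto
  then show v2: "v\<^sup>2 * w v \<le> 1"
    by (simp add: w_def)
  have "(\<bar>v\<bar> * w v)\<^sup>2 = (v\<^sup>2 * w v) * w v"
    by (simp add: power2_eq_square)
  also have "\<dots> \<le> 1 * 1"
    using v2 w_le_1 w_nonneg by (intro mult_mono) auto
  finally have "(\<bar>v\<bar> * w v)\<^sup>2 \<le> 1\<^sup>2" by simp
  then show "\<bar>v\<bar> * w v \<le> 1"
    by (rule power2_le_imp_le) simp
qed

lemma smooth_upto_w: "smooth_upto n w"
proof (induction n)
  case 0
  show ?case using DERIV_w by (auto simp: smooth_upto_0 real_differentiable_def)
next
  case (Suc n)
  have "deriv w = (\<lambda>v. (- 2 * v) * w v)"
    using DERIV_w by (intro ext DERIV_imp_deriv) simp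
  moreover have "smooth_upto n (\<lambda>v. (- 2 * v) * w v)"
    by (rule smooth_upto_mult[OF smooth_upto_mult[OF smooth_upto_const smooth_upto_ident] Suc.IH])
  ultimately show ?case
    using DERIV_w by (auto simp: smooth_upto_Suc real_differentiable_def)
qed

lemma deriv_w: "deriv w v = - 2 * v * w v"
  using DERIV_w by (rule DERIV_imp_deriv)

lemma integrable_moment_w: "integrable lborel (\<lambda>v. v * w v)"
  using integrable_normal_moment[of "1 / sqrt 2" 0 1] by (simp add: w_eq_normal_density mult.commute)

lemma integrable_w_sq:
  "integrable lborel (\<lambda>v. (cmod (of_real (w v)))\<^sup>2)" "(LINT v|lborel. (cmod (of_real (w v)))\<^sup>2) \<le> 2\<^sup>2"
proof -
  have le: "(w v)\<^sup>2 \<le> w v" for v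
    using mult_left_mono[OF w_le_1 w_nonneg, of v v] by (simp add: power2_eq_square)
  show int: "integrable lborel (\<lambda>v. (cmod (of_real (w v)))\<^sup>2)"
    by (rule Bochner_Integration.integrable_bound[OF integrable_w]) (use le w_nonneg in auto)
  have "(LINT v|lborel. (cmod (of_real (w v)))\<^sup>2) \<le> (LINT v|lborel. w v)"
    using int integrable_w le by (intro integral_mono) auto
  then show "(LINT v|lborel. (cmod (of_real (w v)))\<^sup>2) \<le> 2\<^sup>2"
    by (simp add: integral_w)
qed

lemma integrable_w_deriv_sq:
  "integrable lborel (\<lambda>v. (cmod (of_real (- 2 * v * w v)))\<^sup>2)"
  "(LINT v|lborel. (cmod (of_real (- 2 * v * w v)))\<^sup>2) \<le> 2\<^sup>2"
proof -
  have le: "(2 * v * w v)\<^sup>2 \<le> 4 * w v" for v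
  proof -
    have "(2 * v * w v)\<^sup>2 = 4 * ((v\<^sup>2 * w v) * w v)"
      by (simp add: power2_eq_square)
    also have "\<dots> \<le> 4 * (1 * w v)"
      by (intro mult_left_mono mult_right_mono mult_w_le_1 w_nonneg) auto
    finally show ?thesis by simp
  qed
  have i4: "integrable lborel (\<lambda>v. 4 * w v)"
    using integrable_w by simp
  show int: "integrable lborel (\<lambda>v. (cmod (of_real (- 2 * v * w v)))\<^sup>2)"
    by (rule Bochner_Integration.integrable_bound[OF i4])
      (use le w_nonneg in \<open>auto simp del: of_real_mult simp: power2_abs\<close>)
  have "(LINT v|lborel. (cmod (of_real (- 2 * v * w v)))\<^sup>2) \<le> (LINT v|lborel. 4 * w v)"
    using int i4 le by (intro integral_mono) (auto simp del: of_real_mult simp: power2_abs)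
  then show "(LINT v|lborel. (cmod (of_real (- 2 * v * w v)))\<^sup>2) \<le> 2\<^sup>2"
    by (simp add: integral_w)
qed

text \<open>Integration by parts; the product of \<open>w\<close> with a test function vanishes near
  both ends of the line. With this fact the results on weak derivatives apply to the Gaussian
  itself.\<close>

lemma weakly_differentiable_w: "weakly_differentiable (\<lambda>v. of_real (w v)) (\<lambda>v. of_real (- 2 * v * w v))"
  unfolding weakly_differentiable_def
proof (intro allI impI)
  fix \<phi> assume \<phi>: "test_function \<phi>"
  have s: "smooth_upto 0 \<phi>" using \<phi> unfolding test_function_iff by blast
  have d: "(\<phi> has_real_derivative deriv \<phi> x) (at x)" for x
    using smooth_upto_differentiable[OF s] by (simp add: field_differentiable_derivI)
  obtain B B' where B: "\<And>x. \<bar>\<phi> x\<bar> \<le> B" and B': "\<And>x. \<bar>deriv \<phi> x\<bar> \<le> B'"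
    using test_function_bounded(3,4)[OF \<phi>] by metis
  have c: "continuous_on UNIV \<phi>" "continuous_on UNIV (deriv \<phi>)"
    using test_function_bounded(1,2)[OF \<phi>] by auto
  have [measurable]: "\<phi> \<in> borel_measurable borel" "deriv \<phi> \<in> borel_measurable borel"
    using c by (auto intro: borel_measurable_continuous_onI)
  obtain R where R: "\<And>x. \<bar>x\<bar> > R \<Longrightarrow> \<phi> x = 0"
    using \<phi> unfolding test_function_iff by blast
  have ir: "integrable lborel (\<lambda>x. f x * g x)"
    if "integrable lborel f" "g \<in> borel_measurable borel" "\<And>x. \<bar>g x\<bar> \<le> K" for f g :: "real \<Rightarrow> real" and K
  proof -
    have "integrable lborel (\<lambda>x. complex_of_real (f x) * complex_of_real (g x))"
      using that by (intro integrable_mult_bounded[where B = K]) (auto simp: complex_of_real_integrable_eq)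
    then show ?thesis by (simp add: complex_of_real_integrable_eq flip: of_real_mult)
  qed
  have i1: "integrable lborel (\<lambda>x. w x * deriv \<phi> x)"
    using B' by (intro ir integrable_w) auto
  have iw': "integrable lborel (\<lambda>x. - 2 * x * w x)"
    using integrable_mult_right[OF integrable_moment_w, of "- 2"] by (simp add: mult.assoc)
  then have i2: "integrable lborel (\<lambda>x. - 2 * x * w x * \<phi> x)"
    by (rule ir[OF _ _ B]) simp
  have "(LINT x|lborel. w x * deriv \<phi> x + - 2 * x * w x * \<phi> x) = 0 - 0"
  proof (rule integral_FTC_real_line[where F = "\<lambda>x. w x * \<phi> x"])
    show "((\<lambda>x. w x * \<phi> x) has_vector_derivative w x * deriv \<phi> x + - 2 * x * w x * \<phi> x) (at x)" for x
      unfolding has_real_derivative_iff_has_vector_derivative[symmetric]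
      using DERIV_mult[OF DERIV_w d, of x] by (simp add: algebra_simps)
    show "isCont (\<lambda>x. w x * deriv \<phi> x + - 2 * x * w x * \<phi> x) x" for x
      using c DERIV_isCont[OF DERIV_w]
      by (intro continuous_intros) (auto simp: continuous_on_eq_continuous_at)
    show "integrable lborel (\<lambda>x. w x * deriv \<phi> x + - 2 * x * w x * \<phi> x)"
      using i1 i2 by simp
    have "\<forall>\<^sub>F x in at_bot. w x * \<phi> x = 0"
      unfolding eventually_at_bot_dense using R by (intro exI[of _ "- \<bar>R\<bar>"]) auto
    then show "((\<lambda>x. w x * \<phi> x) \<longlongrightarrow> 0) at_bot"
      by (rule tendsto_eventually)
    have "\<forall>\<^sub>F x in at_top. w x * \<phi> x = 0"
      unfolding eventually_at_top_dense using R by (intro exI[of _ "\<bar>R\<bar>"]) auto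
    then show "((\<lambda>x. w x * \<phi> x) \<longlongrightarrow> 0) at_top"
      by (rule tendsto_eventually)
  qed
  then have "(LINT x|lborel. w x * deriv \<phi> x) = - (LINT x|lborel. - 2 * x * w x * \<phi> x)"
    using i1 i2 by simp
  then show "(LINT x|lborel. of_real (w x) * of_real (deriv \<phi> x))
    = - (LINT x|lborel. complex_of_real (- 2 * x * w x) * of_real (\<phi> x))"
    by (simp only: of_real_mult[symmetric] integral_complex_of_real of_real_minus[symmetric])
qed

section \<open>Boundary values of the transform of the Gaussian\<close>

lemma has_vector_derivative_if_shift_integral:
  fixes f g :: "real \<Rightarrow> complex"
  assumes f: "continuous_on UNIV f"
    and g: "\<And>l s. s \<ge> 0 \<Longrightarrow> g (l + s) - g l = (LINT t|lborel. indicator {0..s} t *\<^sub>R f (l + t))"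
  shows "(g has_vector_derivative f x) (at x)"
proof -
  \<comment> \<open>The base point \<open>x - 1\<close> lies to the left of \<open>x\<close>, so
    nonnegative shifts from it cover a neighbourhood of \<open>x\<close> on both sides.\<close>
  have eq: "g y = g (x - 1) + integral {x - 1..y} f" if y: "y \<ge> x - 1" for y
  proof -
    have si: "set_integrable lborel {x - 1..y} f"
      by (intro borel_integrable_atLeastAtMost' continuous_on_subset[OF f]) auto
    have "g (x - 1 + (y - (x - 1))) - g (x - 1) = (LINT t|lborel. indicator {0..y - (x - 1)} t *\<^sub>R f (x - 1 + t))"
      using y by (intro g) simp
    also have "\<dots> = (LINT t|lborel. indicator {x - 1..y} (t + (x - 1)) *\<^sub>R f (t + (x - 1)))"
      by (intro Bochner_Integration.integral_cong refl) (auto simp: indicator_def add.commute)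
    also have "\<dots> = (LINT t|lborel. indicator {x - 1..y} t *\<^sub>R f t)"
      by (rule integral_shift)
    also have "\<dots> = integral {x - 1..y} f"
      using set_borel_integral_eq_integral(2)[OF si] by (simp add: set_lebesgue_integral_def)
    finally show ?thesis by (simp add: algebra_simps)
  qed
  have "((\<lambda>y. g (x - 1) + integral {x - 1..y} f) has_vector_derivative f x) (at x within {x - 1..x + 1})"
    by (auto intro!: derivative_eq_intros integral_has_vector_derivative continuous_on_subset[OF f])
  then have "((\<lambda>y. g (x - 1) + integral {x - 1..y} f) has_vector_derivative f x) (at x)"
    by (simp add: at_within_Icc_at)
  then show ?thesis
    by (rule has_vector_derivative_transform_within_open[where S = "{x - 1<..<x + 1}"]) (auto intro!: eq[symmetric])
qed

text \<open>The two limits are the Plemelj formulas for \<open>w\<close>, with \<open>H\<close> its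
  principal value transform. The differential equation with \<open>H 0 = 0\<close> identifies
  \<open>H\<close> as minus twice the Dawson function.\<close>

definition gauss_hilbert_rel :: "(real \<Rightarrow> real) \<Rightarrow> bool" where
  "gauss_hilbert_rel H \<longleftrightarrow> H 0 = 0 \<and> (\<forall>l. (H has_real_derivative - 2 - 2 * l * H l) (at l)) \<and>
    (\<forall>l. ((\<lambda>\<eta>. cauchy_transform (\<lambda>v. of_real (w v)) \<eta> l) \<longlongrightarrow> of_real (H l) + \<i> * of_real (pi * w l)) (at_right 0)) \<and>
    (\<forall>l. ((\<lambda>\<eta>. cauchy_transform (\<lambda>v. of_real (w v)) \<eta> l) \<longlongrightarrow> of_real (H l) - \<i> * of_real (pi * w l)) (at_left 0))"

text \<open>The derivative of the Gaussian is \<open>- 2 v w v\<close>, and the factor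
  \<open>v\<close> is removed from under the integral by
  \<open>z / (z - u) = 1 + u / (z - u)\<close> with \<open>u = l + \<i> \<eta>\<close>. In the limit
  this becomes the differential equation for the boundary values.\<close>

lemma cauchy_transform_w_deriv:
  assumes "\<eta> \<noteq> 0"
  shows "cauchy_transform (\<lambda>v. of_real (- 2 * v * w v)) \<eta> l
    = - 2 - 2 * (of_real l + \<i> * of_real \<eta>) * cauchy_transform (\<lambda>v. of_real (w v)) \<eta> l"
proof -
  have iw: "integrable lborel (\<lambda>v. complex_of_real (w v))"
    using integrable_w by (simp add: complex_of_real_integrable_eq)
  have "complex_of_real (- 2 * z * w z) * cauchy_kernel \<eta> (z - l)
    = - 2 * of_real (w z) + (- 2 * (of_real l + \<i> * of_real \<eta>)) * (of_real (w z) * cauchy_kernel \<eta> (z - l))" for z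
  proof -
    have "of_real z * cauchy_kernel \<eta> (z - l) = 1 + (of_real l + \<i> * of_real \<eta>) * cauchy_kernel \<eta> (z - l)"
      using cauchy_kernel_denom_nonzero[OF assms, of "z - l"]
      by (simp add: cauchy_kernel_def field_simps)
    then have "complex_of_real (- 2 * z * w z) * cauchy_kernel \<eta> (z - l)
      = - 2 * of_real (w z) * (1 + (of_real l + \<i> * of_real \<eta>) * cauchy_kernel \<eta> (z - l))"
      by (simp add: mult_ac)
    then show ?thesis by (simp add: algebra_simps)
  qed
  then have "cauchy_transform (\<lambda>v. of_real (- 2 * v * w v)) \<eta> l
    = (LINT z|lborel. - 2 * of_real (w z) + (- 2 * (of_real l + \<i> * of_real \<eta>)) * (of_real (w z) * cauchy_kernel \<eta> (z - l)))"
    unfolding cauchy_transform_def by (simp only:)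
  also have "\<dots> = (LINT z|lborel. - 2 * complex_of_real (w z))
      + (LINT z|lborel. (- 2 * (of_real l + \<i> * of_real \<eta>)) * (of_real (w z) * cauchy_kernel \<eta> (z - l)))"
    using iw integrable_mult_cauchy_kernel[OF iw assms, of l]
    by (intro Bochner_Integration.integral_add integrable_mult_right) auto
  also have "\<dots> = - 2 - 2 * (of_real l + \<i> * of_real \<eta>) * cauchy_transform (\<lambda>v. of_real (w v)) \<eta> l"
    unfolding cauchy_transform_def integral_mult_right_zero integral_complex_of_real integral_w by (simp add: algebra_simps)
  finally show ?thesis .
qed

text \<open>The initial value. Since \<open>w\<close> is even, the real part at \<open>l = 0\<close>
  vanishes at every height; the substitution \<open>z = \<eta> u\<close> turns the imaginary part
  into the integral of \<open>w (\<eta> u) / (u\<^sup>2 + 1)\<close>, which tends to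
  \<open>w 0 * pi = sqrt pi\<close>.\<close>

lemma cauchy_transform_w_0:
  assumes "((\<lambda>\<eta>. cauchy_transform (\<lambda>v. of_real (w v)) \<eta> 0) \<longlongrightarrow> G) (at_right 0)"
  shows "G = \<i> * of_real (sqrt pi)"
proof -
  define e where "e = (\<lambda>n. 1 / real (Suc n))"
  have e: "e n > 0" for n by (simp add: e_def)
  have "e \<longlonglongrightarrow> 0"
    unfolding e_def using LIMSEQ_inverse_real_of_nat by (simp add: inverse_eq_divide)
  then have ee: "filterlim e (at_right 0) sequentially"
    using e by (intro tendsto_imp_filterlim_at_right) auto
  have re: "Re (cauchy_transform (\<lambda>v. of_real (w v)) \<eta> 0) = 0" if "\<eta> \<noteq> 0" for \<eta>
  proof -
    have iw: "integrable lborel (\<lambda>v. complex_of_real (w v))"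
      using integrable_w by (simp add: complex_of_real_integrable_eq)
    let ?F = "cauchy_transform (\<lambda>v. of_real (w v)) \<eta> 0"
    have "?F = (LINT z|lborel. of_real (w (- z)) * cauchy_kernel \<eta> (- z))"
      unfolding cauchy_transform_def diff_zero
      by (rule trans[OF lborel_integral_real_affine[of "- 1" _ 0]]) simp_all
    also have "\<dots> = (LINT z|lborel. - cnj (of_real (w z) * cauchy_kernel \<eta> z))"
      by (simp add: cauchy_kernel_minus cnj_cauchy_kernel w_def)
    also have "\<dots> = - cnj ?F"
      unfolding cauchy_transform_def
      by (simp only: integral_minus Bochner_Integration.integral_cnj diff_zero)
    finally show ?thesis
      by (simp add: complex_eq_iff)
  qed
  have im: "Im (cauchy_transform (\<lambda>v. of_real (w v)) \<eta> 0) = (LINT u|lborel. w (\<eta> * u) * (1 / (u\<^sup>2 + 1)))"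
    if "\<eta> > 0" for \<eta>
  proof -
    have iw: "integrable lborel (\<lambda>v. complex_of_real (w v))"
      using integrable_w by (simp add: complex_of_real_integrable_eq)
    have ck: "Im (cauchy_kernel \<eta> z) = \<eta> / (z\<^sup>2 + \<eta>\<^sup>2)" for z
      by (simp add: cauchy_kernel_def Im_divide)
    have "Im (cauchy_transform (\<lambda>v. of_real (w v)) \<eta> 0) = (LINT z|lborel. w z * (\<eta> / (z\<^sup>2 + \<eta>\<^sup>2)))"
      unfolding cauchy_transform_def
      using integral_Im[OF integrable_mult_cauchy_kernel[OF iw, of \<eta> 0]] that by (simp add: ck)
    also have "\<dots> = \<eta> * (LINT u|lborel. w (\<eta> * u) * (\<eta> / ((\<eta> * u)\<^sup>2 + \<eta>\<^sup>2)))"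
      using lborel_integral_real_affine[of \<eta> "\<lambda>z. w z * (\<eta> / (z\<^sup>2 + \<eta>\<^sup>2))" 0] that by simp
    also have "\<dots> = (LINT u|lborel. \<eta> * (w (\<eta> * u) * (\<eta> / ((\<eta> * u)\<^sup>2 + \<eta>\<^sup>2))))"
      by (rule integral_mult_right_zero[symmetric])
    also have "\<dots> = (LINT u|lborel. w (\<eta> * u) * (1 / (u\<^sup>2 + 1)))"
    proof (intro Bochner_Integration.integral_cong refl)
      fix u
      have "(\<eta> * u)\<^sup>2 + \<eta>\<^sup>2 = \<eta> * \<eta> * (u\<^sup>2 + 1)"
        by (simp add: power2_eq_square algebra_simps)
      then show "\<eta> * (w (\<eta> * u) * (\<eta> / ((\<eta> * u)\<^sup>2 + \<eta>\<^sup>2))) = w (\<eta> * u) * (1 / (u\<^sup>2 + 1))"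
        using that by simp
    qed
    finally show ?thesis .
  qed
  have lim: "(\<lambda>n. LINT u|lborel. w (e n * u) * (1 / (u\<^sup>2 + 1))) \<longlonglongrightarrow> (LINT u|lborel. w 0 * (1 / (u\<^sup>2 + 1)))"
  proof (rule integral_dominated_convergence[where w = "\<lambda>u. 1 / (u\<^sup>2 + 1)"])
    show "integrable lborel (\<lambda>u::real. 1 / (u\<^sup>2 + 1))"
      using integrable_inverse_square_plus[of 1] by simp
    have "(\<lambda>n. w (e n * u)) \<longlonglongrightarrow> w (0 * u)" for u
      by (rule isCont_tendsto_compose[OF DERIV_isCont[OF DERIV_w]]) (intro tendsto_intros \<open>e \<longlonglongrightarrow> 0\<close>)
    then show "AE u in lborel. (\<lambda>n. w (e n * u) * (1 / (u\<^sup>2 + 1))) \<longlonglongrightarrow> w 0 * (1 / (u\<^sup>2 + 1))"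
      by (intro AE_I2 tendsto_mult tendsto_const) simp
    have "w x * (1 / (u\<^sup>2 + 1)) \<le> 1 * (1 / (u\<^sup>2 + 1))" for x u :: real
      by (intro mult_right_mono w_le_1) auto
    then show "AE u in lborel. norm (w (e n * u) * (1 / (u\<^sup>2 + 1))) \<le> 1 / (u\<^sup>2 + 1)" for n
      using w_nonneg by (simp add: abs_mult)
  qed measurable
  have "(LINT u|lborel. w 0 * (1 / (u\<^sup>2 + 1))) = w 0 * pi"
    using integral_inverse_square_plus[of 1] by (simp only: integral_mult_right_zero) simp
  also have "\<dots> = sqrt pi"
    by (simp add: w_def real_div_sqrt)
  finally have "(\<lambda>n. complex_of_real (LINT u|lborel. w (e n * u) * (1 / (u\<^sup>2 + 1)))) \<longlonglongrightarrow> of_real (sqrt pi)"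
    using lim by (intro tendsto_of_real) simp
  then have "(\<lambda>n. \<i> * complex_of_real (LINT u|lborel. w (e n * u) * (1 / (u\<^sup>2 + 1)))) \<longlonglongrightarrow> \<i> * of_real (sqrt pi)"
    by (intro tendsto_mult tendsto_const)
  moreover have "\<i> * complex_of_real (LINT u|lborel. w (e n * u) * (1 / (u\<^sup>2 + 1))) = cauchy_transform (\<lambda>v. of_real (w v)) (e n) 0" for n
    using im[OF e] re[of "e n"] e[of n] by (auto simp: complex_eq_iff)
  ultimately have "(\<lambda>n. cauchy_transform (\<lambda>v. of_real (w v)) (e n) 0) \<longlonglongrightarrow> \<i> * of_real (sqrt pi)"
    by (simp only:)
  moreover have "(\<lambda>n. cauchy_transform (\<lambda>v. of_real (w v)) (e n) 0) \<longlonglongrightarrow> G"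
    by (rule filterlim_compose[OF assms ee])
  ultimately show ?thesis
    by (rule LIMSEQ_unique[rotated])
qed

text \<open>The difference formula for the transform of \<open>w\<close> passes to the limit along
  heights tending to 0, so the boundary value \<open>G\<close> solves a linear differential
  equation. Its real and imaginary parts decouple; the imaginary part is found explicitly, and the
  real part is \<open>H\<close>.\<close>

lemma gauss_hilbert_exists: "\<exists>H. gauss_hilbert_rel H"
proof -
  let ?w = "\<lambda>v. complex_of_real (w v)" and ?w' = "\<lambda>v. complex_of_real (- 2 * v * w v)"
  have iw: "integrable lborel ?w"
    using integrable_w by (simp add: complex_of_real_integrable_eq)
  have iw': "integrable lborel ?w'"
    using integrable_mult_right[OF integrable_moment_w, of "- 2"]
    unfolding complex_of_real_integrable_eq by (simp add: mult.assoc)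
  obtain G where G: "\<And>x. ((\<lambda>\<eta>. cauchy_transform ?w \<eta> x) \<longlongrightarrow> G x) (at_right 0)"
    "\<And>x. cmod (G x) \<le> 4 * pi * 2" "\<And>x y. cmod (G x - G y) \<le> 4 * pi * 2 * sqrt \<bar>x - y\<bar>"
    using cauchy_transform_boundary_right[OF iw iw' integrable_w_sq(1) integrable_w_deriv_sq(1) integrable_w_sq(2)
        integrable_w_deriv_sq(2) _ weakly_differentiable_w] by auto
  have contG: "isCont G x" for x
  proof -
    have "((\<lambda>y. 4 * pi * 2 * sqrt \<bar>y - x\<bar>) \<longlongrightarrow> 4 * pi * 2 * sqrt \<bar>x - x\<bar>) (at x)"
      by (intro tendsto_intros)
    then have "((\<lambda>y. 4 * pi * 2 * sqrt \<bar>y - x\<bar>) \<longlongrightarrow> 0) (at x)"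
      by simp
    then have "((\<lambda>y. G y - G x) \<longlongrightarrow> 0) (at x)"
      by (rule Lim_null_comparison[rotated]) (intro always_eventually allI G(3))
    then show ?thesis by (simp add: isCont_def LIM_zero_iff)
  qed
  define f where "f = (\<lambda>l. - 2 - 2 * of_real l * G l)"
  have contf: "continuous_on UNIV f"
    unfolding f_def using contG by (intro continuous_intros continuous_at_imp_continuous_on) auto
  have [measurable]: "f \<in> borel_measurable borel"
    using contf by (rule borel_measurable_continuous_onI)
  define e where "e = (\<lambda>n. 1 / real (Suc n))"
  have e: "e n > 0" "e n \<le> 1" for n by (simp_all add: e_def)
  have e0: "e \<longlonglongrightarrow> 0"
    unfolding e_def using LIMSEQ_inverse_real_of_nat by (simp add: inverse_eq_divide)
  then have ee: "filterlim e (at_right 0) sequentially"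
    using e by (intro tendsto_imp_filterlim_at_right) auto
  have Ge: "(\<lambda>n. cauchy_transform ?w (e n) x) \<longlonglongrightarrow> G x" for x
    by (rule filterlim_compose[OF G(1) ee])
  have bd: "cmod (cauchy_transform ?w (e n) x) \<le> 16 * pi" for n x
  proof -
    have "(LINT t|lborel. (cmod (cauchy_transform ?w (e n) t))\<^sup>2) \<le> (2 * pi)\<^sup>2 * (LINT x|lborel. (cmod (?w x))\<^sup>2)"
      using e[of n] by (intro cauchy_transform_L2_bound' iw integrable_w_sq(1)) auto
    also have "\<dots> \<le> (2 * pi * 2)\<^sup>2"
      unfolding power_mult_distrib by (intro mult_left_mono integrable_w_sq(2)[unfolded power_mult_distrib]) auto
    finally have "cmod (cauchy_transform ?w (e n) x) \<le> 2 * pi * 2 + 2 * pi * 2"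
      using cauchy_transform_holder[OF iw iw' integrable_w_deriv_sq _ weakly_differentiable_w, of "e n"] e[of n]
      by (intro holder_half_bounded integrable_cauchy_transform_sq iw) auto
    then show ?thesis using pi_ge_zero by linarith
  qed
  have "(G has_vector_derivative f x) (at x)" for x
  proof (rule has_vector_derivative_if_shift_integral[OF contf])
    fix l s :: real assume s: "s \<ge> 0"
    let ?h = "\<lambda>n t. indicator {0..s} t *\<^sub>R cauchy_transform ?w' (e n) (l + t)"
    have "(\<lambda>n. LINT t|lborel. ?h n t) \<longlonglongrightarrow> (LINT t|lborel. indicator {0..s} t *\<^sub>R f (l + t))"
    \<comment> \<open>The majorant is read off from \<open>cauchy_transform_w_deriv\<close>, with
      heights at most 1 and transforms of \<open>w\<close> bounded by
      \<open>16 * pi\<close>.\<close>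
    proof (rule integral_dominated_convergence[where w = "\<lambda>t. (2 + 2 * (\<bar>l\<bar> + s + 1) * (16 * pi)) * indicator {0..s} t"])
      show "integrable lborel (\<lambda>t. (2 + 2 * (\<bar>l\<bar> + s + 1) * (16 * pi)) * indicator {0..s} t)"
        by (intro integrable_mult_right integrable_indicator_Icc)
      have "(\<lambda>n. cauchy_transform ?w' (e n) x) \<longlonglongrightarrow> f x" for x
      proof -
        have "(\<lambda>n. - 2 - 2 * (of_real x + \<i> * of_real (e n)) * cauchy_transform ?w (e n) x)
          \<longlonglongrightarrow> - 2 - 2 * (of_real x + \<i> * of_real 0) * G x"
          by (intro tendsto_intros Ge e0)
        moreover have "cauchy_transform ?w' (e n) x
          = - 2 - 2 * (of_real x + \<i> * of_real (e n)) * cauchy_transform ?w (e n) x" for n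
          using e[of n] by (intro cauchy_transform_w_deriv) auto
        ultimately show ?thesis by (simp add: f_def)
      qed
      then show "AE t in lborel. (\<lambda>n. ?h n t) \<longlonglongrightarrow> indicator {0..s} t *\<^sub>R f (l + t)"
        by (intro AE_I2 tendsto_scaleR tendsto_const)
      have "cmod (cauchy_transform ?w' (e n) (l + t)) \<le> 2 + 2 * (\<bar>l\<bar> + s + 1) * (16 * pi)" if t: "t \<in> {0..s}" for n t
      proof -
        have "cauchy_transform ?w' (e n) (l + t)
          = - 2 - 2 * (of_real (l + t) + \<i> * of_real (e n)) * cauchy_transform ?w (e n) (l + t)"
          using e[of n] by (intro cauchy_transform_w_deriv) auto
        also have "cmod \<dots> \<le> 2 + cmod (2 * (of_real (l + t) + \<i> * of_real (e n)) * cauchy_transform ?w (e n) (l + t))"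
          using norm_triangle_ineq4[of "- 2" "2 * (of_real (l + t) + \<i> * of_real (e n)) * cauchy_transform ?w (e n) (l + t)"]
          by simp
        also have "cmod (2 * (of_real (l + t) + \<i> * of_real (e n)) * cauchy_transform ?w (e n) (l + t))
          = 2 * cmod (of_real (l + t) + \<i> * of_real (e n)) * cmod (cauchy_transform ?w (e n) (l + t))"
          by (simp only: norm_mult) simp
        also have "\<dots> \<le> 2 * (\<bar>l\<bar> + s + 1) * (16 * pi)"
        proof (intro mult_mono mult_left_mono bd)
          have "cmod (of_real (l + t) + \<i> * of_real (e n)) \<le> \<bar>l + t\<bar> + \<bar>e n\<bar>"
            by (rule order_trans[OF norm_triangle_ineq]) (simp only: norm_mult norm_of_real norm_ii mult_1 order_refl)
          also have "\<dots> \<le> \<bar>l\<bar> + s + 1"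
            using t e[of n] by auto
          finally show "cmod (of_real (l + t) + \<i> * of_real (e n)) \<le> \<bar>l\<bar> + s + 1" .
        qed (use s in auto)
        finally show ?thesis by simp
      qed
      then show "AE t in lborel. norm (?h n t) \<le> (2 + 2 * (\<bar>l\<bar> + s + 1) * (16 * pi)) * indicator {0..s} t" for n
        by (intro AE_I2) (auto simp: indicator_def)
    qed measurable
    moreover have "(LINT t|lborel. ?h n t) = cauchy_transform ?w (e n) (l + s) - cauchy_transform ?w (e n) l" for n
      using e[of n] by (intro cauchy_transform_shift[symmetric] iw iw' weakly_differentiable_w s) auto
    moreover have "(\<lambda>n. cauchy_transform ?w (e n) (l + s) - cauchy_transform ?w (e n) l) \<longlonglongrightarrow> G (l + s) - G l"
      by (intro tendsto_diff Ge)
    ultimately show "G (l + s) - G l = (LINT t|lborel. indicator {0..s} t *\<^sub>R f (l + t))"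
      using LIMSEQ_unique by simp
  qed
  note dG = this
  have dRe: "((\<lambda>x. Re (G x)) has_real_derivative - 2 - 2 * x * Re (G x)) (at x)"
    and dIm: "((\<lambda>x. Im (G x)) has_real_derivative - 2 * x * Im (G x)) (at x)" for x
    using bounded_linear.has_vector_derivative[OF bounded_linear_Re dG, of x]
      bounded_linear.has_vector_derivative[OF bounded_linear_Im dG, of x]
    by (simp_all add: has_real_derivative_iff_has_vector_derivative f_def)
  have G0: "G 0 = \<i> * of_real (sqrt pi)"
    by (rule cauchy_transform_w_0[OF G(1)])
  \<comment> \<open>The integrating factor \<open>exp (x\<^sup>2)\<close> makes the imaginary part
    constant; its value at 0 then gives
    \<open>sqrt pi * exp (- x\<^sup>2) = pi * w x\<close>.\<close>
  have "((\<lambda>x. Im (G x) * exp (x\<^sup>2)) has_real_derivative 0) (at x)" for x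
  proof -
    have "((\<lambda>x. exp (x\<^sup>2)) has_real_derivative 2 * x * exp (x\<^sup>2)) (at x)"
      by (auto intro!: derivative_eq_intros)
    from DERIV_mult[OF dIm this] show ?thesis by (simp add: algebra_simps)
  qed
  then have "Im (G x) * exp (x\<^sup>2) = Im (G 0) * exp (0\<^sup>2)" for x
    using DERIV_isconst_all by blast
  then have "Im (G x) * exp (x\<^sup>2) = sqrt pi" for x
    by (simp add: G0)
  then have "Im (G x) = sqrt pi * exp (- x\<^sup>2)" for x
    by (simp add: exp_minus field_simps)
  moreover have "pi * w x = (pi / sqrt pi) * exp (- x\<^sup>2)" for x
    by (simp add: w_def)
  ultimately have Im: "Im (G x) = pi * w x" for x
    by (simp add: real_div_sqrt)
  have "((\<lambda>\<eta>. cauchy_transform ?w \<eta> x) \<longlongrightarrow> cnj (G x)) (at_left 0)" for x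
  proof -
    have "((\<lambda>\<eta>. cauchy_transform ?w (- \<eta>) x) \<longlongrightarrow> cnj (G x)) (at_right 0)"
      using tendsto_cnj[OF G(1)[of x]] by (simp add: cauchy_transform_cnj)
    then show ?thesis by (simp add: filterlim_at_left_to_right)
  qed
  moreover have "G x = of_real (Re (G x)) + \<i> * of_real (pi * w x)" "cnj (G x) = of_real (Re (G x)) - \<i> * of_real (pi * w x)" for x
    using Im[of x] by (auto simp: complex_eq_iff)
  ultimately have "gauss_hilbert_rel (\<lambda>x. Re (G x))"
    using G(1) G0 dRe unfolding gauss_hilbert_rel_def by simp
  then show ?thesis by blast
qed

definition gauss_hilbert :: "real \<Rightarrow> real" where
  "gauss_hilbert = (SOME H. gauss_hilbert_rel H)"

lemma gauss_hilbert_rel: "gauss_hilbert_rel gauss_hilbert"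
  unfolding gauss_hilbert_def using gauss_hilbert_exists by (rule someI_ex)

lemma gauss_hilbert_0: "gauss_hilbert 0 = 0"
  and DERIV_gauss_hilbert: "(gauss_hilbert has_real_derivative - 2 - 2 * l * gauss_hilbert l) (at l)"
  and cauchy_transform_w_right: "((\<lambda>\<eta>. cauchy_transform (\<lambda>v. of_real (w v)) \<eta> l)
    \<longlongrightarrow> of_real (gauss_hilbert l) + \<i> * of_real (pi * w l)) (at_right 0)"
  and cauchy_transform_w_left: "((\<lambda>\<eta>. cauchy_transform (\<lambda>v. of_real (w v)) \<eta> l)
    \<longlongrightarrow> of_real (gauss_hilbert l) - \<i> * of_real (pi * w l)) (at_left 0)"
  using gauss_hilbert_rel unfolding gauss_hilbert_rel_def by blast+

lemma DERIV_gauss_hilbert_exp: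
  "((\<lambda>l. gauss_hilbert l * exp (l\<^sup>2)) has_real_derivative - 2 * exp (l\<^sup>2)) (at l)"
proof -
  have "((\<lambda>x. exp (x\<^sup>2)) has_real_derivative 2 * l * exp (l\<^sup>2)) (at l)"
    by (auto intro!: derivative_eq_intros)
  from DERIV_mult[OF DERIV_gauss_hilbert this] show ?thesis by (simp add: algebra_simps)
qed

text \<open>After multiplication by \<open>exp (l\<^sup>2)\<close> the derivative is even and the
  value at 0 is 0, so the product is odd.\<close>

lemma gauss_hilbert_minus: "gauss_hilbert (- l) = - gauss_hilbert l"
proof -
  let ?u = "\<lambda>l. gauss_hilbert l * exp (l\<^sup>2)"
  have "((\<lambda>l. ?u l + ?u (- l)) has_real_derivative 0) (at l)" for l
  proof -
    have "((\<lambda>l. ?u (- l)) has_real_derivative - 2 * exp ((- l)\<^sup>2) * - 1) (at l)"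
      by (rule DERIV_chain2[OF DERIV_gauss_hilbert_exp]) (auto intro!: derivative_eq_intros)
    from DERIV_add[OF DERIV_gauss_hilbert_exp this] show ?thesis by simp
  qed
  then have "?u l + ?u (- l) = ?u 0 + ?u (- 0)"
    using DERIV_isconst_all by blast
  then have "(gauss_hilbert l + gauss_hilbert (- l)) * exp (l\<^sup>2) = 0"
    by (simp add: gauss_hilbert_0 algebra_simps)
  then show ?thesis by simp
qed

text \<open>On \<open>[0, l]\<close> the derivative \<open>- 2 exp (t\<^sup>2)\<close> is compared with \<open>- 2 (t / l) exp (t\<^sup>2)\<close>, with
  \<open>- 2\<close> and with \<open>- 2 exp (l\<^sup>2)\<close>.\<close>

lemma gauss_hilbert_bounds:
  assumes "l > 0"
  shows "gauss_hilbert l \<le> - (1 - exp (- l\<^sup>2)) / l" "- 2 * l \<le> gauss_hilbert l" "gauss_hilbert l \<le> - 2 * l * exp (- l\<^sup>2)"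
proof -
  let ?u = "\<lambda>l. gauss_hilbert l * exp (l\<^sup>2)"
  have ee: "exp (- l\<^sup>2) * exp (l\<^sup>2) = 1"
    by (simp add: exp_minus)
  have mono: "?u l \<le> c l - c 0" if c: "\<And>t. (c has_real_derivative c' t) (at t)"
    and le: "\<And>t. 0 \<le> t \<Longrightarrow> t \<le> l \<Longrightarrow> - 2 * exp (t\<^sup>2) \<le> c' t" for c c'
  proof -
    have "c 0 - ?u 0 \<le> c l - ?u l"
    proof (rule DERIV_nonneg_imp_nondecreasing[where f = "\<lambda>t. c t - ?u t" and a = 0 and b = l])
      fix x assume x: "0 \<le> x" "x \<le> l"
      show "\<exists>y. ((\<lambda>t. c t - ?u t) has_real_derivative y) (at x) \<and> 0 \<le> y"
        using DERIV_diff[OF c DERIV_gauss_hilbert_exp, of x] le[OF x] by auto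
    qed (use assms in simp)
    then show ?thesis by (simp add: gauss_hilbert_0)
  qed
  have mono': "c l - c 0 \<le> ?u l" if c: "\<And>t. (c has_real_derivative c' t) (at t)"
    and le: "\<And>t. 0 \<le> t \<Longrightarrow> t \<le> l \<Longrightarrow> c' t \<le> - 2 * exp (t\<^sup>2)" for c c'
  proof -
    have "?u 0 - c 0 \<le> ?u l - c l"
    proof (rule DERIV_nonneg_imp_nondecreasing[where f = "\<lambda>t. ?u t - c t" and a = 0 and b = l])
      fix x assume x: "0 \<le> x" "x \<le> l"
      show "\<exists>y. ((\<lambda>t. ?u t - c t) has_real_derivative y) (at x) \<and> 0 \<le> y"
        using DERIV_diff[OF DERIV_gauss_hilbert_exp c, of x] le[OF x] by auto
    qed (use assms in simp)
    then show ?thesis by (simp add: gauss_hilbert_0)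
  qed
  define U where "U = ?u l"
  have H: "gauss_hilbert l = U * exp (- l\<^sup>2)"
    unfolding U_def mult.assoc by (simp add: exp_minus)
  have "?u l \<le> - (exp (l\<^sup>2) / l) - - (exp (0\<^sup>2) / l)"
  proof (rule mono)
    show "((\<lambda>t. - (exp (t\<^sup>2) / l)) has_real_derivative - (2 * t * exp (t\<^sup>2) / l)) (at t)" for t
      using assms by (auto intro!: derivative_eq_intros)
    fix t :: real assume t: "0 \<le> t" "t \<le> l"
    have "t / l * (2 * exp (t\<^sup>2)) \<le> 1 * (2 * exp (t\<^sup>2))"
      using t assms by (intro mult_right_mono) auto
    then show "- 2 * exp (t\<^sup>2) \<le> - (2 * t * exp (t\<^sup>2) / l)"
      by (simp add: mult_ac)
  qed
  then have "U * exp (- l\<^sup>2) \<le> (- (exp (l\<^sup>2) / l) - - (exp (0\<^sup>2) / l)) * exp (- l\<^sup>2)"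
    unfolding U_def by (rule mult_right_mono) simp
  also have "\<dots> = - (exp (- l\<^sup>2) * exp (l\<^sup>2) - exp (- l\<^sup>2)) / l"
    by (simp add: algebra_simps diff_divide_distrib)
  finally show "gauss_hilbert l \<le> - (1 - exp (- l\<^sup>2)) / l"
    unfolding ee H .
  have "- 2 * exp (l\<^sup>2) * l - - 2 * exp (l\<^sup>2) * 0 \<le> ?u l"
  proof (rule mono')
    show "((\<lambda>t. - 2 * exp (l\<^sup>2) * t) has_real_derivative - 2 * exp (l\<^sup>2)) (at t)" for t
      by (auto intro!: derivative_eq_intros)
  qed (use power_mono[of _ l 2] in auto)
  then have "- 2 * exp (l\<^sup>2) * l * exp (- l\<^sup>2) \<le> U * exp (- l\<^sup>2)"
    unfolding U_def by (intro mult_right_mono) auto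
  also have "- 2 * exp (l\<^sup>2) * l * exp (- l\<^sup>2) = - 2 * l * (exp (- l\<^sup>2) * exp (l\<^sup>2))"
    by (simp add: mult_ac)
  finally show "- 2 * l \<le> gauss_hilbert l"
    unfolding ee H by simp
  have "?u l \<le> - 2 * l - - 2 * 0"
  proof (rule mono)
    show "((\<lambda>t. - 2 * t) has_real_derivative - 2) (at t)" for t :: real
      by (auto intro!: derivative_eq_intros)
  qed auto
  then have "U * exp (- l\<^sup>2) \<le> - 2 * l * exp (- l\<^sup>2)"
    unfolding U_def by (intro mult_right_mono) auto
  then show "gauss_hilbert l \<le> - 2 * l * exp (- l\<^sup>2)"
    unfolding H .
qed

section \<open>The weighted spaces\<close>

text \<open>Elements of the weighted spaces are only Lebesgue measurable, while the transform is
  developed for Borel functions over \<open>lborel\<close>.\<close>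

lemma lebesgue_borel_representative:
  fixes f :: "real \<Rightarrow> complex"
  assumes "f \<in> borel_measurable lebesgue"
  shows "\<exists>g\<in>borel_measurable borel. AE x in lborel. f x = g x"
proof -
  have "(\<lambda>x. Re (f x)) \<in> borel_measurable lebesgue" "(\<lambda>x. Im (f x)) \<in> borel_measurable lebesgue"
    using assms by (auto intro: borel_measurable_continuous_on[of Re] borel_measurable_continuous_on[of Im] continuous_intros)
  then obtain u v where uv: "u \<in> borel_measurable borel" "v \<in> borel_measurable borel"
    "AE x in lborel. Re (f x) = u x" "AE x in lborel. Im (f x) = v x"
    by (auto dest!: completion_ex_borel_measurable_real)
  have [measurable]: "u \<in> borel_measurable borel" "v \<in> borel_measurable borel"
    using uv by auto
  show ?thesis
  proof (rule bexI[of _ "\<lambda>x. of_real (u x) + \<i> * of_real (v x)"])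
    show "AE x in lborel. f x = of_real (u x) + \<i> * of_real (v x)"
      using uv(3,4) by eventually_elim (simp add: complex_eq_iff)
  qed measurable
qed

lemma AE_eq_borel:
  fixes f g :: "real \<Rightarrow> 'a::{banach, second_countable_topology}"
  assumes ae: "AE x in lborel. f x = g x" and g: "g \<in> borel_measurable borel"
  shows borel_measurable_lebesgue_AE_eq: "f \<in> borel_measurable lebesgue"
    and integrable_lebesgue_AE_eq: "integrable lebesgue f \<longleftrightarrow> integrable lborel g"
    and integral_lebesgue_AE_eq: "(LINT x|lebesgue. f x) = (LINT x|lborel. g x)"
proof -
  have ae': "AE x in lebesgue. f x = g x"
    by (rule AE_completion[OF ae])
  have gl: "g \<in> borel_measurable lebesgue"
    using g by (simp add: measurable_completion)
  show fl: "f \<in> borel_measurable lebesgue"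
  proof (rule borel_measurableI)
    fix S :: "'a set" assume "open S"
    show "f -` S \<inter> space lebesgue \<in> sets lebesgue"
    proof (rule completion.in_sets_AE)
      show "g -` S \<inter> space lebesgue \<in> sets lebesgue"
        using gl \<open>open S\<close> by (intro measurable_sets) auto
      show "AE x in lebesgue. x \<in> g -` S \<inter> space lebesgue \<longleftrightarrow> x \<in> f -` S \<inter> space lebesgue"
        using ae' by eventually_elim simp
    qed auto
  qed
  have gb: "g \<in> borel_measurable lborel" using g by simp
  show "integrable lebesgue f \<longleftrightarrow> integrable lborel g"
    using integrable_cong_AE[OF fl gl ae'] integrable_completion[OF gb] by simp
  show "(LINT x|lebesgue. f x) = (LINT x|lborel. g x)"
    using integral_cong_AE[OF fl gl ae'] integral_completion[OF gb] by simp
qed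

lemma norm_L2w_nonneg: "0 \<le> norm_L2w f"
  by (simp add: norm_L2w_def w_nonneg)

lemma norm_L2w_sq: "(norm_L2w f)\<^sup>2 = (LINT v|lebesgue. (cmod (f v))\<^sup>2 * w v)"
  by (simp add: norm_L2w_def w_nonneg)

lemma L2wD: "f \<in> L2w \<Longrightarrow> f \<in> borel_measurable lebesgue"
  "f \<in> L2w \<Longrightarrow> integrable lebesgue (\<lambda>v. (cmod (f v))\<^sup>2 * w v)"
  by (auto simp: L2w_def)

lemma L2w_representative:
  assumes "f \<in> L2w"
  obtains g where "g \<in> borel_measurable borel" "AE x in lborel. f x = g x"
    "integrable lborel (\<lambda>v. (cmod (g v))\<^sup>2 * w v)" "(norm_L2w f)\<^sup>2 = (LINT v|lborel. (cmod (g v))\<^sup>2 * w v)"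
proof -
  obtain g where [measurable]: "g \<in> borel_measurable borel" and ae: "AE x in lborel. f x = g x"
    using lebesgue_borel_representative[OF L2wD(1)[OF assms]] by auto
  have ae': "AE x in lborel. (cmod (f x))\<^sup>2 * w x = (cmod (g x))\<^sup>2 * w x"
    using ae by eventually_elim simp
  have m: "(\<lambda>x. (cmod (g x))\<^sup>2 * w x) \<in> borel_measurable borel"
    by measurable
  show ?thesis
    using that[of g] ae integrable_lebesgue_AE_eq[OF ae' m] integral_lebesgue_AE_eq[OF ae' m] L2wD(2)[OF assms]
    by (simp add: norm_L2w_sq)
qed

text \<open>The weight \<open>w\<close> is integrable and at most 1: the square of
  \<open>g w\<close> is dominated by \<open>(cmod (g v))\<^sup>2 * w v\<close>, and
  \<open>g w\<close> itself by that plus \<open>w v\<close>.\<close>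

lemma mult_w_integrable:
  assumes [measurable]: "g \<in> borel_measurable borel" and g: "integrable lborel (\<lambda>v. (cmod (g v))\<^sup>2 * w v)"
  shows "integrable lborel (\<lambda>v. g v * of_real (w v))"
    "integrable lborel (\<lambda>v. (cmod (g v * of_real (w v)))\<^sup>2)"
    "(LINT v|lborel. (cmod (g v * of_real (w v)))\<^sup>2) \<le> (LINT v|lborel. (cmod (g v))\<^sup>2 * w v)"
proof -
  have le: "(cmod (g v * of_real (w v)))\<^sup>2 \<le> (cmod (g v))\<^sup>2 * w v" for v
  proof -
    have "(cmod (g v * of_real (w v)))\<^sup>2 = ((cmod (g v))\<^sup>2 * w v) * w v"
      using w_nonneg[of v] by (simp add: norm_mult power2_eq_square)
    also have "\<dots> \<le> ((cmod (g v))\<^sup>2 * w v) * 1"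
      using w_nonneg by (intro mult_left_mono w_le_1) auto
    finally show ?thesis by simp
  qed
  have le1: "cmod (g v * of_real (w v)) \<le> w v + (cmod (g v))\<^sup>2 * w v" for v
  proof -
    have "cmod (g v) \<le> 1 + (cmod (g v))\<^sup>2"
      using mult_le_sum_squares[of "cmod (g v)" 1] by simp
    then have "cmod (g v) * w v \<le> (1 + (cmod (g v))\<^sup>2) * w v"
      using w_nonneg by (rule mult_right_mono)
    then show ?thesis
      using w_nonneg[of v] by (simp add: norm_mult algebra_simps)
  qed
  show "integrable lborel (\<lambda>v. g v * of_real (w v))"
  proof (rule Bochner_Integration.integrable_bound)
    show "integrable lborel (\<lambda>v. w v + (cmod (g v))\<^sup>2 * w v)"
      using integrable_w g by simp
    show "AE v in lborel. norm (g v * of_real (w v)) \<le> norm (w v + (cmod (g v))\<^sup>2 * w v)"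
      using le1 by (intro AE_I2 order_trans[OF le1]) simp
  qed measurable
  show i: "integrable lborel (\<lambda>v. (cmod (g v * of_real (w v)))\<^sup>2)"
  proof (rule Bochner_Integration.integrable_bound[OF g])
    show "AE v in lborel. norm ((cmod (g v * of_real (w v)))\<^sup>2) \<le> norm ((cmod (g v))\<^sup>2 * w v)"
    proof (intro AE_I2)
      fix v show "norm ((cmod (g v * of_real (w v)))\<^sup>2) \<le> norm ((cmod (g v))\<^sup>2 * w v)"
        using le[of v] w_nonneg[of v] by simp
    qed
  qed measurable
  show "(LINT v|lborel. (cmod (g v * of_real (w v)))\<^sup>2) \<le> (LINT v|lborel. (cmod (g v))\<^sup>2 * w v)"
    by (intro integral_mono i g le)
qed

lemma L2w_mult_w:
  assumes "f \<in> L2w"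
  obtains p where "p \<in> borel_measurable borel" "AE x in lborel. f x * of_real (w x) = p x"
    "integrable lborel p" "integrable lborel (\<lambda>v. (cmod (p v))\<^sup>2)" "(LINT v|lborel. (cmod (p v))\<^sup>2) \<le> (norm_L2w f)\<^sup>2"
proof -
  obtain g where [measurable]: "g \<in> borel_measurable borel" and g: "AE x in lborel. f x = g x"
    "integrable lborel (\<lambda>v. (cmod (g v))\<^sup>2 * w v)" "(norm_L2w f)\<^sup>2 = (LINT v|lborel. (cmod (g v))\<^sup>2 * w v)"
    by (rule L2w_representative[OF assms])
  have "AE x in lborel. f x * of_real (w x) = g x * of_real (w x)"
    using g(1) by eventually_elim simp
  moreover have "(\<lambda>x. g x * of_real (w x)) \<in> borel_measurable borel"
    by measurable
  ultimately show ?thesis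
    using mult_w_integrable[of g] g by (intro that[of "\<lambda>x. g x * of_real (w x)"]) simp_all
qed

lemma weak_deriv:
  assumes "f \<in> H1w"
  shows "f \<in> L2w" "weak_deriv f \<in> L2w" "is_weak_deriv f (weak_deriv f)"
proof -
  have ex: "\<exists>f'. f' \<in> L2w \<and> is_weak_deriv f f'" and "f \<in> L2w"
    using assms by (auto simp: H1w_def)
  then show "f \<in> L2w" by simp
  show "weak_deriv f \<in> L2w" "is_weak_deriv f (weak_deriv f)"
    unfolding weak_deriv_def using someI_ex[OF ex] by auto
qed

lemma norm_H1w_nonneg: "0 \<le> norm_H1w f"
  by (simp add: norm_H1w_def)

lemma norm_L2w_le_norm_H1w: "norm_L2w f \<le> norm_H1w f"
  unfolding norm_H1w_def by (rule real_le_rsqrt) simp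

text \<open>Passing from \<open>f\<close> to \<open>f w\<close> leads from the weighted to the unweighted Sobolev space, since
  \<open>w\<close> times a test function is a test function.\<close>

lemma H1w_mult_w:
  assumes f: "f \<in> H1w"
  obtains p p' where "p \<in> borel_measurable borel" "AE x in lborel. f x * of_real (w x) = p x"
    "integrable lborel p" "integrable lborel p'" "weakly_differentiable p p'"
    "integrable lborel (\<lambda>v. (cmod (p v))\<^sup>2)" "integrable lborel (\<lambda>v. (cmod (p' v))\<^sup>2)"
    "(LINT v|lborel. (cmod (p v))\<^sup>2) \<le> (3 * norm_H1w f)\<^sup>2" "(LINT v|lborel. (cmod (p' v))\<^sup>2) \<le> (3 * norm_H1w f)\<^sup>2"
proof -
  obtain g where [measurable]: "g \<in> borel_measurable borel" and g: "AE x in lborel. f x = g x"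
    "integrable lborel (\<lambda>v. (cmod (g v))\<^sup>2 * w v)" "(norm_L2w f)\<^sup>2 = (LINT v|lborel. (cmod (g v))\<^sup>2 * w v)"
    by (rule L2w_representative[OF weak_deriv(1)[OF f]])
  obtain g' where [measurable]: "g' \<in> borel_measurable borel" and g': "AE x in lborel. weak_deriv f x = g' x"
    "integrable lborel (\<lambda>v. (cmod (g' v))\<^sup>2 * w v)" "(norm_L2w (weak_deriv f))\<^sup>2 = (LINT v|lborel. (cmod (g' v))\<^sup>2 * w v)"
    by (rule L2w_representative[OF weak_deriv(2)[OF f]])
  define p where "p = (\<lambda>x. g x * of_real (w x))"
  \<comment> \<open>The product rule for \<open>g w\<close>, with the derivative of the Gaussian
    written out.\<close>
  define p' where "p' = (\<lambda>x. g' x * of_real (w x) + g x * of_real (- 2 * x * w x))"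
  have [measurable]: "p \<in> borel_measurable borel" "p' \<in> borel_measurable borel"
    unfolding p_def p'_def by measurable
  have N: "(norm_H1w f)\<^sup>2 = (LINT v|lborel. (cmod (g v))\<^sup>2 * w v) + (LINT v|lborel. (cmod (g' v))\<^sup>2 * w v)"
    by (simp add: norm_H1w_def g(3)[symmetric] g'(3)[symmetric])
  have g0: "0 \<le> (LINT v|lborel. (cmod (g v))\<^sup>2 * w v)" "0 \<le> (LINT v|lborel. (cmod (g' v))\<^sup>2 * w v)"
    by (simp_all add: w_nonneg)
  have ae: "AE x in lborel. f x * of_real (w x) = p x"
    using g(1) by eventually_elim (simp add: p_def)
  have xw: "(cmod (g x * of_real (- 2 * x * w x)))\<^sup>2 \<le> 4 * ((cmod (g x))\<^sup>2 * w x)" for x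
  proof -
    have "(cmod (g x * of_real (- 2 * x * w x)))\<^sup>2 = 4 * ((cmod (g x))\<^sup>2 * w x) * (x\<^sup>2 * w x)"
      by (simp only: norm_mult norm_of_real power_mult_distrib power2_abs) (simp add: power2_eq_square)
    also have "\<dots> \<le> 4 * ((cmod (g x))\<^sup>2 * w x) * 1"
      using w_nonneg by (intro mult_left_mono mult_w_le_1) auto
    finally show ?thesis by simp
  qed
  have dv: "integrable lborel (\<lambda>x. g x * of_real (- 2 * x * w x))"
  proof (rule Bochner_Integration.integrable_bound)
    have "integrable lborel (\<lambda>x. x\<^sup>2 * w x)"
      using integrable_normal_moment[of "1 / sqrt 2" 0 2] by (simp add: w_eq_normal_density mult.commute)
    then show "integrable lborel (\<lambda>x. 2 * (cmod (g x))\<^sup>2 * w x + 2 * x\<^sup>2 * w x)"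
      using g(2) by (simp add: mult.assoc)
    show "AE x in lborel. norm (g x * of_real (- 2 * x * w x)) \<le> norm (2 * (cmod (g x))\<^sup>2 * w x + 2 * x\<^sup>2 * w x)"
    proof (intro AE_I2)
      fix x
      have "cmod (g x * of_real (- 2 * x * w x)) = 2 * (cmod (g x) * \<bar>x\<bar>) * w x"
        using w_nonneg[of x] by (simp add: norm_mult abs_mult)
      also have "\<dots> \<le> 2 * ((cmod (g x))\<^sup>2 + \<bar>x\<bar>\<^sup>2) * w x"
        by (intro mult_right_mono mult_left_mono mult_le_sum_squares w_nonneg) auto
      also have "\<dots> = 2 * (cmod (g x))\<^sup>2 * w x + 2 * x\<^sup>2 * w x"
        by (simp add: algebra_simps)
      finally show "norm (g x * of_real (- 2 * x * w x)) \<le> norm (2 * (cmod (g x))\<^sup>2 * w x + 2 * x\<^sup>2 * w x)"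
        by simp
    qed
  qed measurable
  have p'1: "integrable lborel p'"
    unfolding p'_def by (intro Bochner_Integration.integrable_add dv mult_w_integrable(1) g'(2)) measurable
  have bound: "(cmod (p' x))\<^sup>2 \<le> 2 * ((cmod (g' x))\<^sup>2 * w x) + 8 * ((cmod (g x))\<^sup>2 * w x)" for x
  proof -
    have sq: "(cmod (a + b))\<^sup>2 \<le> 2 * (cmod a)\<^sup>2 + 2 * (cmod b)\<^sup>2" for a b
    proof -
      have "(cmod (a + b))\<^sup>2 \<le> (cmod a + cmod b)\<^sup>2"
        by (intro power_mono norm_triangle_ineq) simp
      then show ?thesis
        using sum_squares_bound[of "cmod a" "cmod b"] by (simp add: power2_sum)
    qed
    have "(cmod (g' x * of_real (w x)))\<^sup>2 \<le> (cmod (g' x))\<^sup>2 * w x"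
    proof -
      have "(cmod (g' x * of_real (w x)))\<^sup>2 = ((cmod (g' x))\<^sup>2 * w x) * w x"
        using w_nonneg[of x] by (simp add: norm_mult power2_eq_square)
      also have "\<dots> \<le> ((cmod (g' x))\<^sup>2 * w x) * 1"
        using w_nonneg by (intro mult_left_mono w_le_1) auto
      finally show ?thesis by simp
    qed
    then show ?thesis
      using sq[of "g' x * of_real (w x)" "g x * of_real (- 2 * x * w x)"] xw[of x] unfolding p'_def by linarith
  qed
  have bi: "integrable lborel (\<lambda>x. 2 * ((cmod (g' x))\<^sup>2 * w x) + 8 * ((cmod (g x))\<^sup>2 * w x))"
    using g(2) g'(2) by simp
  have p'2: "integrable lborel (\<lambda>x. (cmod (p' x))\<^sup>2)"
  proof (rule Bochner_Integration.integrable_bound[OF bi])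
    show "AE x in lborel. norm ((cmod (p' x))\<^sup>2) \<le> norm (2 * ((cmod (g' x))\<^sup>2 * w x) + 8 * ((cmod (g x))\<^sup>2 * w x))"
    proof (intro AE_I2)
      fix x show "norm ((cmod (p' x))\<^sup>2) \<le> norm (2 * ((cmod (g' x))\<^sup>2 * w x) + 8 * ((cmod (g x))\<^sup>2 * w x))"
        using bound[of x] w_nonneg[of x] by simp
    qed
  qed measurable
  have "(LINT x|lborel. (cmod (p' x))\<^sup>2) \<le> (LINT x|lborel. 2 * ((cmod (g' x))\<^sup>2 * w x) + 8 * ((cmod (g x))\<^sup>2 * w x))"
    by (intro integral_mono p'2 bi bound)
  also have "\<dots> = 2 * (LINT v|lborel. (cmod (g' v))\<^sup>2 * w v) + 8 * (LINT v|lborel. (cmod (g v))\<^sup>2 * w v)"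
    using g(2) g'(2) by simp
  \<comment> \<open>The coefficients 2 and 8 are both at most \<open>3\<^sup>2\<close>; hence the
    factor 3.\<close>
  also have "\<dots> \<le> (3 * norm_H1w f)\<^sup>2"
    using g0 unfolding power_mult_distrib N by simp
  finally have n': "(LINT x|lborel. (cmod (p' x))\<^sup>2) \<le> (3 * norm_H1w f)\<^sup>2" .
  have n: "(LINT x|lborel. (cmod (p x))\<^sup>2) \<le> (3 * norm_H1w f)\<^sup>2"
    using mult_w_integrable(3)[of g] g(2) g0 unfolding power_mult_distrib N p_def by simp
  have "weakly_differentiable p p'"
    unfolding weakly_differentiable_def
  proof (intro allI impI)
    fix \<phi> assume \<phi>: "test_function \<phi>"
    obtain B B' where B: "\<And>x. \<bar>\<phi> x\<bar> \<le> B" and B': "\<And>x. \<bar>deriv \<phi> x\<bar> \<le> B'"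
      using test_function_bounded(3,4)[OF \<phi>] by metis
    have [measurable]: "\<phi> \<in> borel_measurable borel" "deriv \<phi> \<in> borel_measurable borel"
      using test_function_bounded(1,2)[OF \<phi>] by (auto intro: borel_measurable_continuous_onI)
    note T = test_function_mult[OF \<phi> smooth_upto_w]
    have "(LINT x|lebesgue. f x * of_real (w x * deriv \<phi> x + deriv w x * \<phi> x))
      = - (LINT x|lebesgue. weak_deriv f x * of_real (w x * \<phi> x))"
      using weak_deriv(3)[OF f, unfolded is_weak_deriv_def, rule_format, OF T(1)] unfolding T(2) .
    moreover have "(LINT x|lebesgue. f x * of_real (w x * deriv \<phi> x + deriv w x * \<phi> x))
      = (LINT x|lborel. g x * of_real (w x * deriv \<phi> x + - 2 * x * w x * \<phi> x))"
    proof (rule integral_lebesgue_AE_eq)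
      show "AE x in lborel. f x * of_real (w x * deriv \<phi> x + deriv w x * \<phi> x)
        = g x * of_real (w x * deriv \<phi> x + - 2 * x * w x * \<phi> x)"
        using g(1) by eventually_elim (simp add: deriv_w)
    qed measurable
    moreover have "(LINT x|lebesgue. weak_deriv f x * of_real (w x * \<phi> x)) = (LINT x|lborel. g' x * of_real (w x * \<phi> x))"
    proof (rule integral_lebesgue_AE_eq)
      show "AE x in lborel. weak_deriv f x * of_real (w x * \<phi> x) = g' x * of_real (w x * \<phi> x)"
        using g'(1) by eventually_elim simp
    qed measurable
    ultimately have *: "(LINT x|lborel. g x * of_real (w x * deriv \<phi> x + - 2 * x * w x * \<phi> x))
      = - (LINT x|lborel. g' x * of_real (w x * \<phi> x))"
      by simp
    have i1: "integrable lborel (\<lambda>x. (g x * of_real (w x)) * of_real (deriv \<phi> x))"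
      using B' g(2) by (intro integrable_mult_bounded[where B = B'] mult_w_integrable) auto
    have i2: "integrable lborel (\<lambda>x. (g x * of_real (- 2 * x * w x)) * of_real (\<phi> x))"
      by (rule integrable_mult_bounded[where B = B, OF dv]) (use B in auto)
    have i3: "integrable lborel (\<lambda>x. (g' x * of_real (w x)) * of_real (\<phi> x))"
      using B g'(2) by (intro integrable_mult_bounded[where B = B] mult_w_integrable) auto
    have "(LINT x|lborel. g x * of_real (w x * deriv \<phi> x + - 2 * x * w x * \<phi> x))
      = (LINT x|lborel. (g x * of_real (w x)) * of_real (deriv \<phi> x) + (g x * of_real (- 2 * x * w x)) * of_real (\<phi> x))"
      by (intro Bochner_Integration.integral_cong refl) (simp add: algebra_simps)
    also have "\<dots> = (LINT x|lborel. p x * of_real (deriv \<phi> x)) + (LINT x|lborel. (g x * of_real (- 2 * x * w x)) * of_real (\<phi> x))"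
      unfolding p_def by (intro Bochner_Integration.integral_add i1 i2)
    finally have "(LINT x|lborel. p x * of_real (deriv \<phi> x))
      = - (LINT x|lborel. g' x * of_real (w x * \<phi> x)) - (LINT x|lborel. (g x * of_real (- 2 * x * w x)) * of_real (\<phi> x))"
      using * by (simp only: eq_diff_eq)
    also have "(LINT x|lborel. g' x * of_real (w x * \<phi> x)) = (LINT x|lborel. (g' x * of_real (w x)) * of_real (\<phi> x))"
      by (simp add: mult.assoc)
    also have "- (LINT x|lborel. (g' x * of_real (w x)) * of_real (\<phi> x)) - (LINT x|lborel. (g x * of_real (- 2 * x * w x)) * of_real (\<phi> x))
      = - (LINT x|lborel. (g' x * of_real (w x)) * of_real (\<phi> x) + (g x * of_real (- 2 * x * w x)) * of_real (\<phi> x))"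
      using Bochner_Integration.integral_add[OF i3 i2] by simp
    also have "\<dots> = - (LINT x|lborel. p' x * of_real (\<phi> x))"
      unfolding p'_def by (simp only: distrib_right)
    finally show "(LINT x|lborel. p x * of_real (deriv \<phi> x)) = - (LINT x|lborel. p' x * of_real (\<phi> x))" .
  qed
  moreover have "integrable lborel p" "integrable lborel (\<lambda>v. (cmod (p v))\<^sup>2)"
    unfolding p_def by (intro mult_w_integrable g(2), measurable)+
  ultimately show ?thesis
    using that[of p p'] ae p'1 p'2 n n' by simp
qed

section \<open>The boundary operator on the weighted spaces\<close>

lemma at_zero_side_neq_bot: "at_zero_side s \<noteq> bot"
  by (simp add: at_zero_side_def trivial_limit_at_right_real trivial_limit_at_left_real)

text \<open>Changing \<open>h\<close> on a null set changes none of the integrals inside the limit,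
  so \<open>S_hat\<close> agrees at the given point \<open>l\<close> itself and not merely almost
  everywhere.\<close>

lemma S_hat_eq:
  assumes ae: "AE x in lborel. h x = p x" and [measurable]: "p \<in> borel_measurable borel"
    and lim: "((\<lambda>\<eta>. cauchy_transform p \<eta> l) \<longlongrightarrow> L) (at_zero_side s)"
  shows "S_hat s h l = L"
proof -
  have "(LINT z|lebesgue. h z / (of_real z - (of_real l + \<i> * of_real \<eta>))) = cauchy_transform p \<eta> l" for \<eta>
    unfolding cauchy_transform_def
  proof (rule integral_lebesgue_AE_eq)
    show "AE z in lborel. h z / (of_real z - (of_real l + \<i> * of_real \<eta>)) = p z * cauchy_kernel \<eta> (z - l)"
      using ae by eventually_elim (simp add: cauchy_kernel_def diff_diff_eq)
  qed measurable
  then show ?thesis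
    unfolding S_hat_def using lim by (simp add: tendsto_Lim at_zero_side_neq_bot)
qed

text \<open>A sequence of heights on the prescribed side: limits along it are measurable and open to
  Fatou's lemma.\<close>

definition side_seq :: "real \<Rightarrow> nat \<Rightarrow> real" where
  "side_seq s n = (if s > 0 then 1 else - 1) / real (Suc n)"

lemma side_seq: "side_seq s n \<noteq> 0" "filterlim (side_seq s) (at_zero_side s) sequentially"
proof -
  show "side_seq s n \<noteq> 0" by (simp add: side_seq_def)
  have e: "(\<lambda>n. 1 / real (Suc n)) \<longlonglongrightarrow> 0"
    using LIMSEQ_inverse_real_of_nat by (simp add: inverse_eq_divide)
  have s: "side_seq s \<longlonglongrightarrow> 0"
  proof (cases "s > 0")
    case True
    then show ?thesis using e by (simp add: side_seq_def[abs_def])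
  next
    case False
    then show ?thesis using tendsto_minus[OF e] by (simp add: side_seq_def[abs_def])
  qed
  have "side_seq s n \<in> (if s > 0 then {0<..} else {..<0})" for n
    by (simp add: side_seq_def)
  then show "filterlim (side_seq s) (at_zero_side s) sequentially"
    using s unfolding at_zero_side_def
    by (cases "s > 0") (auto intro!: tendsto_imp_filterlim_at_right tendsto_imp_filterlim_at_left)
qed

text \<open>\<open>S\<close> is the limit along \<open>side_seq\<close>, hence measurable; it equals
  \<open>S_hat\<close> wherever the full one-sided limit exists. The norm bound is in the unweighted
  space, which leaves the whole weight free to absorb the growth of the multipliers.\<close>

lemma L2w_S_hat:
  assumes f: "f \<in> L2w"
  obtains S where "S \<in> borel_measurable borel" "AE l in lborel. S_hat s (\<lambda>v. f v * of_real (w v)) l = S l"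
    "integrable lborel (\<lambda>l. (cmod (S l))\<^sup>2)" "(LINT l|lborel. (cmod (S l))\<^sup>2) \<le> (2 * pi * norm_L2w f)\<^sup>2"
proof -
  obtain p where p [measurable]: "p \<in> borel_measurable borel" and ae: "AE x in lborel. f x * of_real (w x) = p x"
    and p1: "integrable lborel p" and p2: "integrable lborel (\<lambda>v. (cmod (p v))\<^sup>2)"
    and n: "(LINT v|lborel. (cmod (p v))\<^sup>2) \<le> (norm_L2w f)\<^sup>2"
    by (rule L2w_mult_w[OF f])
  define S where "S = (\<lambda>l. lim (\<lambda>n. cauchy_transform p (side_seq s n) l))"
  have [measurable]: "S \<in> borel_measurable borel"
    unfolding S_def by measurable
  have conv: "AE l in lborel. \<exists>L. ((\<lambda>\<eta>. cauchy_transform p \<eta> l) \<longlongrightarrow> L) (at_zero_side s)"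
    using AE_cauchy_transform_convergent[OF p1 p2] AE_cauchy_transform_convergent_left[OF p1 p2]
    by (simp add: at_zero_side_def)
  have both: "AE l in lborel. S_hat s (\<lambda>v. f v * of_real (w v)) l = S l \<and> (\<lambda>n. cauchy_transform p (side_seq s n) l) \<longlonglongrightarrow> S l"
    using conv
  proof eventually_elim
    case (elim l)
    then obtain L where L: "((\<lambda>\<eta>. cauchy_transform p \<eta> l) \<longlongrightarrow> L) (at_zero_side s)" by blast
    have "(\<lambda>n. cauchy_transform p (side_seq s n) l) \<longlonglongrightarrow> L"
      by (rule filterlim_compose[OF L side_seq(2)])
    then show ?case
      using S_hat_eq[OF ae p L] by (simp add: S_def limI)
  qed
  have lim: "AE l in lborel. (\<lambda>n. cauchy_transform p (side_seq s n) l) \<longlonglongrightarrow> S l"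
    using both by eventually_elim simp
  have SS: "AE l in lborel. S_hat s (\<lambda>v. f v * of_real (w v)) l = S l"
    using both by eventually_elim simp
  note F = cauchy_transform_fatou[OF p1 p2 side_seq(1) \<open>S \<in> borel_measurable borel\<close> lim]
  have "(LINT l|lborel. (cmod (S l))\<^sup>2) \<le> (2 * pi)\<^sup>2 * (norm_L2w f)\<^sup>2"
    by (rule order_trans[OF F(2) mult_left_mono[OF n]]) simp
  then show ?thesis
    using that[of S] SS F(1) by (simp add: power_mult_distrib)
qed

text \<open>Supremum bound and Hoelder bound of exponent \<open>1 / 2\<close> with a common
  constant, so that products and sums are tracked by a single number.\<close>

definition holder_on :: "real set \<Rightarrow> real \<Rightarrow> (real \<Rightarrow> complex) \<Rightarrow> bool" where
  "holder_on X A k \<longleftrightarrow> (\<forall>x\<in>X. cmod (k x) \<le> A) \<and> (\<forall>x\<in>X. \<forall>y\<in>X. cmod (k x - k y) \<le> A * sqrt \<bar>x - y\<bar>)"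

lemma borel_measurable_if_holder:
  assumes "holder_on UNIV A k"
  shows "k \<in> borel_measurable borel"
proof -
  have "isCont k x" for x
  proof -
    have "((\<lambda>y. A * sqrt \<bar>y - x\<bar>) \<longlongrightarrow> A * sqrt \<bar>x - x\<bar>) (at x)"
      by (intro tendsto_intros)
    then have "((\<lambda>y. A * sqrt \<bar>y - x\<bar>) \<longlongrightarrow> 0) (at x)"
      by simp
    then have "((\<lambda>y. k y - k x) \<longlongrightarrow> 0) (at x)"
      by (rule Lim_null_comparison[rotated])
        (use assms in \<open>auto simp: holder_on_def\<close>)
    then show ?thesis by (simp add: isCont_def LIM_zero_iff)
  qed
  then show ?thesis
    by (intro borel_measurable_continuous_onI continuous_at_imp_continuous_on) auto
qed

text \<open>For \<open>f\<close> in \<open>H1w\<close> the limit exists at every point, so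
  \<open>S_hat\<close> itself is continuous and needs no representative. The factor 12 is 4 from the
  boundary values times 3 from passing to \<open>f w\<close>.\<close>

lemma H1w_S_hat_holder:
  assumes f: "f \<in> H1w"
  shows "holder_on UNIV (12 * pi * norm_H1w f) (S_hat s (\<lambda>v. f v * of_real (w v)))"
proof -
  obtain p p' where p: "p \<in> borel_measurable borel" "AE x in lborel. f x * of_real (w x) = p x"
    "integrable lborel p" "integrable lborel p'" "weakly_differentiable p p'"
    "integrable lborel (\<lambda>v. (cmod (p v))\<^sup>2)" "integrable lborel (\<lambda>v. (cmod (p' v))\<^sup>2)"
    "(LINT v|lborel. (cmod (p v))\<^sup>2) \<le> (3 * norm_H1w f)\<^sup>2" "(LINT v|lborel. (cmod (p' v))\<^sup>2) \<le> (3 * norm_H1w f)\<^sup>2"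
    by (rule H1w_mult_w[OF f])
  have N0: "0 \<le> 3 * norm_H1w f" by (simp add: norm_H1w_nonneg)
  have "\<exists>G. (\<forall>x. ((\<lambda>\<eta>. cauchy_transform p \<eta> x) \<longlongrightarrow> G x) (at_zero_side s)) \<and>
    (\<forall>x. cmod (G x) \<le> 4 * pi * (3 * norm_H1w f)) \<and> (\<forall>x y. cmod (G x - G y) \<le> 4 * pi * (3 * norm_H1w f) * sqrt \<bar>x - y\<bar>)"
    using cauchy_transform_boundary_right[OF p(3,4,6,7,8,9) N0 p(5)] cauchy_transform_boundary_left[OF p(3,4,6,7,8,9) N0 p(5)]
    by (simp add: at_zero_side_def)
  then obtain G where G: "\<And>x. ((\<lambda>\<eta>. cauchy_transform p \<eta> x) \<longlongrightarrow> G x) (at_zero_side s)"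
    "\<And>x. cmod (G x) \<le> 4 * pi * (3 * norm_H1w f)" "\<And>x y. cmod (G x - G y) \<le> 4 * pi * (3 * norm_H1w f) * sqrt \<bar>x - y\<bar>"
    by blast
  have "S_hat s (\<lambda>v. f v * of_real (w v)) = G"
    by (intro ext S_hat_eq[OF p(2,1) G(1)])
  then show ?thesis
    using G(2,3) by (simp add: holder_on_def mult_ac)
qed

lemma H1w_mult_w_holder:
  assumes f: "f \<in> H1w"
  obtains q where "AE x in lborel. f x * of_real (w x) = q x" "holder_on UNIV (6 * norm_H1w f) q"
proof -
  obtain p p' where p: "p \<in> borel_measurable borel" "AE x in lborel. f x * of_real (w x) = p x"
    "integrable lborel p" "integrable lborel p'" "weakly_differentiable p p'"
    "integrable lborel (\<lambda>v. (cmod (p v))\<^sup>2)" "integrable lborel (\<lambda>v. (cmod (p' v))\<^sup>2)"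
    "(LINT v|lborel. (cmod (p v))\<^sup>2) \<le> (3 * norm_H1w f)\<^sup>2" "(LINT v|lborel. (cmod (p' v))\<^sup>2) \<le> (3 * norm_H1w f)\<^sup>2"
    by (rule H1w_mult_w[OF f])
  have N0: "0 \<le> 3 * norm_H1w f" by (simp add: norm_H1w_nonneg)
  obtain q where q: "AE x in lborel. p x = q x" "\<And>x. cmod (q x) \<le> 2 * (3 * norm_H1w f)"
    "\<And>x y. cmod (q x - q y) \<le> 2 * (3 * norm_H1w f) * sqrt \<bar>x - y\<bar>"
    using weakly_differentiable_holder_representative[OF p(3,4,6,7,8,9) N0 p(5)] by blast
  have "AE x in lborel. f x * of_real (w x) = q x"
    using p(2) q(1) by eventually_elim simp
  then show ?thesis
    using that[of q] q(2,3) by (simp add: holder_on_def)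
qed

section \<open>The multipliers\<close>

lemma borel_measurable_gauss_hilbert [measurable]: "gauss_hilbert \<in> borel_measurable borel"
  by (intro borel_measurable_continuous_onI continuous_at_imp_continuous_on ballI DERIV_isCont[OF DERIV_gauss_hilbert])

text \<open>The factor \<open>1 / (\<i> \<xi> cnj \<omega>)\<close> in front of the boundary
  operator with the boundary value of \<open>\<omega>\<close> inserted; \<open>b_mult\<close> is the
  same for \<open>omega_minus\<close>.\<close>

definition u_mult :: "real \<Rightarrow> real \<Rightarrow> complex" where
  "u_mult \<xi> l = 1 / (of_real (gauss_hilbert l) + \<i> * of_real (\<xi> - sgn \<xi> * (pi * w l)))"

definition b_mult :: "real \<Rightarrow> real \<Rightarrow> complex" where
  "b_mult \<xi> l = 1 / (\<i> * of_real (\<xi> + sgn \<xi> * (pi * w l)) - of_real (gauss_hilbert l))"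

lemma borel_measurable_u_mult [measurable]: "u_mult \<xi> \<in> borel_measurable borel"
  unfolding u_mult_def[abs_def] by measurable

lemma borel_measurable_b_mult [measurable]: "b_mult \<xi> \<in> borel_measurable borel"
  unfolding b_mult_def[abs_def] by measurable

lemma cauchy_transform_w_side:
  assumes "\<xi> \<noteq> 0"
  shows "((\<lambda>\<eta>. cauchy_transform (\<lambda>v. of_real (w v)) \<eta> l)
    \<longlongrightarrow> of_real (gauss_hilbert l) + \<i> * of_real (sgn \<xi> * (pi * w l))) (at_zero_side \<xi>)"
  using cauchy_transform_w_right[of l] cauchy_transform_w_left[of l] assms
  by (cases "\<xi> > 0") (simp_all add: at_zero_side_def)

lemma filterlim_divide_at_zero_side:
  assumes "\<xi> \<noteq> 0"
  shows "filterlim (\<lambda>\<delta>. \<delta> / \<xi>) (at_zero_side \<xi>) (at_right 0)"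
proof -
  have t: "((\<lambda>\<delta>. \<delta> / \<xi>) \<longlongrightarrow> 0) (at_right 0)"
    using assms by (auto intro!: tendsto_eq_intros)
  have ev: "\<forall>\<^sub>F \<delta> in at_right (0::real). \<delta> > 0"
    by (simp add: eventually_at_right_less)
  show ?thesis
  proof (cases "\<xi> > 0")
    case True
    have "\<forall>\<^sub>F \<delta> in at_right 0. \<delta> / \<xi> > 0"
      using ev by eventually_elim (use True in simp)
    then show ?thesis
      using True tendsto_imp_filterlim_at_right[OF t] by (simp add: at_zero_side_def)
  next
    case False
    have "\<forall>\<^sub>F \<delta> in at_right 0. \<delta> / \<xi> < 0"
      using ev by eventually_elim (use False assms in \<open>simp add: divide_less_0_iff\<close>)
    then show ?thesis
      using False tendsto_imp_filterlim_at_left[OF t] by (simp add: at_zero_side_def)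
  qed
qed

lemma omega_eq_cauchy_transform:
  assumes "\<xi> \<noteq> 0"
  shows "(LINT v|lebesgue. of_real (w v) / (\<i> * of_real \<xi> * (of_real (v - l) - \<i> * of_real (\<delta> / \<xi>))))
    = 1 / (\<i> * of_real \<xi>) * cauchy_transform (\<lambda>v. of_real (w v)) (\<delta> / \<xi>) l"
proof -
  have "(LINT v|lebesgue. of_real (w v) / (\<i> * of_real \<xi> * (of_real (v - l) - \<i> * of_real (\<delta> / \<xi>))))
    = (LINT v|lborel. 1 / (\<i> * of_real \<xi>) * (of_real (w v) * cauchy_kernel (\<delta> / \<xi>) (v - l)))"
    by (rule integral_lebesgue_AE_eq) (simp add: cauchy_kernel_def, measurable)
  then show ?thesis
    by (simp only: cauchy_transform_def integral_mult_right_zero)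
qed

text \<open>Factoring \<open>\<i> \<xi>\<close> out of the denominator makes the integral a Cauchy
  transform of \<open>w\<close> at height \<open>\<delta> / \<xi>\<close>, which has the sign of
  \<open>\<xi>\<close>; this selects the one-sided boundary value and explains
  \<open>sgn \<xi>\<close>.\<close>

lemma omega_plus_eq:
  assumes "\<xi> \<noteq> 0"
  shows "omega_plus (- 1 - \<i> * of_real l * of_real \<xi>) \<xi>
    = 1 - 1 / (\<i> * of_real \<xi>) * (of_real (gauss_hilbert l) + \<i> * of_real (sgn \<xi> * (pi * w l)))"
proof -
  have d: "\<i> * of_real v * of_real \<xi> + 1 + (- 1 - \<i> * of_real l * of_real \<xi> + of_real \<delta>)
    = \<i> * of_real \<xi> * (of_real (v - l) - \<i> * of_real (\<delta> / \<xi>))" for v \<delta>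
    using assms by (simp add: complex_eq_iff algebra_simps)
  have "((\<lambda>\<delta>. omega (- 1 - \<i> * of_real l * of_real \<xi> + of_real \<delta>) \<xi>)
    \<longlongrightarrow> 1 - 1 / (\<i> * of_real \<xi>) * (of_real (gauss_hilbert l) + \<i> * of_real (sgn \<xi> * (pi * w l)))) (at_right 0)"
    unfolding omega_def d omega_eq_cauchy_transform[OF assms]
    by (intro tendsto_intros filterlim_compose[OF cauchy_transform_w_side[OF assms] filterlim_divide_at_zero_side[OF assms]])
  then show ?thesis
    unfolding omega_plus_def by (intro tendsto_Lim) (simp_all add: trivial_limit_at_right_real)
qed

text \<open>Reversing both \<open>\<delta>\<close> and \<open>\<xi>\<close> only changes the sign of
  the denominator. The same boundary value therefore appears, now with a plus sign.\<close>

lemma omega_minus_eq: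
  assumes "\<xi> \<noteq> 0"
  shows "omega_minus (- 1 + \<i> * of_real l * of_real \<xi>) (- \<xi>)
    = 1 + 1 / (\<i> * of_real \<xi>) * (of_real (gauss_hilbert l) + \<i> * of_real (sgn \<xi> * (pi * w l)))"
proof -
  have d: "\<i> * of_real v * of_real (- \<xi>) + 1 + (- 1 + \<i> * of_real l * of_real \<xi> - of_real \<delta>)
    = - (\<i> * of_real \<xi> * (of_real (v - l) - \<i> * of_real (\<delta> / \<xi>)))" for v \<delta>
    using assms by (simp add: complex_eq_iff algebra_simps)
  have "((\<lambda>\<delta>. omega (- 1 + \<i> * of_real l * of_real \<xi> - of_real \<delta>) (- \<xi>))
    \<longlongrightarrow> 1 - - (1 / (\<i> * of_real \<xi>) * (of_real (gauss_hilbert l) + \<i> * of_real (sgn \<xi> * (pi * w l))))) (at_right 0)"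
    unfolding omega_def d divide_minus_right integral_minus omega_eq_cauchy_transform[OF assms]
    by (intro tendsto_intros filterlim_compose[OF cauchy_transform_w_side[OF assms] filterlim_divide_at_zero_side[OF assms]])
  then have "((\<lambda>\<delta>. omega (- 1 + \<i> * of_real l * of_real \<xi> - of_real \<delta>) (- \<xi>))
    \<longlongrightarrow> 1 + 1 / (\<i> * of_real \<xi>) * (of_real (gauss_hilbert l) + \<i> * of_real (sgn \<xi> * (pi * w l)))) (at_right 0)"
    by (simp only: diff_minus_eq_add)
  then show ?thesis
    unfolding omega_minus_def by (intro tendsto_Lim) (simp_all add: trivial_limit_at_right_real)
qed

lemma U_op_eq:
  assumes "\<xi> \<noteq> 0"
  shows "U_op \<xi> f l = f l + (- u_mult \<xi> l) * S_hat (- sgn \<xi>) (\<lambda>v. f v * of_real (w v)) l"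
proof -
  have "\<i> * of_real \<xi> * cnj (omega_plus (- 1 - \<i> * of_real l * of_real \<xi>) \<xi>)
    = of_real (gauss_hilbert l) + \<i> * of_real (\<xi> - sgn \<xi> * (pi * w l))"
    unfolding omega_plus_eq[OF assms] using assms by (simp add: field_simps)
  then show ?thesis
    by (simp add: U_op_def u_mult_def)
qed

lemma B_op_eq:
  assumes "\<xi> \<noteq> 0"
  shows "B_op \<xi> f l = f l + b_mult \<xi> l * S_hat (- sgn \<xi>) (\<lambda>v. f v * of_real (w v)) l"
proof -
  have "\<i> * of_real \<xi> * cnj (omega_minus (- 1 + \<i> * of_real l * of_real \<xi>) (- \<xi>))
    = \<i> * of_real (\<xi> + sgn \<xi> * (pi * w l)) - of_real (gauss_hilbert l)"
    unfolding omega_minus_eq[OF assms] using assms by (simp add: field_simps)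
  then show ?thesis
    by (simp add: B_op_def b_mult_def)
qed

section \<open>Bounds for the multipliers, uniform in the frequency\<close>

lemma gauss_hilbert_lower:
  assumes "\<bar>l\<bar> \<ge> 1 / 4"
  shows "(1 - exp (- (1 / 16))) / \<bar>l\<bar> \<le> \<bar>gauss_hilbert l\<bar>"
proof -
  have *: "(1 - exp (- (1 / 16))) / l \<le> - gauss_hilbert l" if "l \<ge> 1 / 4" for l
  proof -
    have "(1 / 4)\<^sup>2 \<le> l\<^sup>2"
      using that by (intro power_mono) auto
    then have "exp (- l\<^sup>2) \<le> exp (- (1 / 16))"
      by (simp add: power_divide)
    then have "(1 - exp (- (1 / 16))) / l \<le> (1 - exp (- l\<^sup>2)) / l"
      using that by (intro divide_right_mono) auto
    also have "\<dots> \<le> - gauss_hilbert l"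
    proof -
      have "gauss_hilbert l \<le> - (1 - exp (- l\<^sup>2)) / l"
        by (rule gauss_hilbert_bounds(1)) (use that in simp)
      then show ?thesis
        unfolding minus_divide_left[symmetric] by linarith
    qed
    finally show ?thesis .
  qed
  show ?thesis
  proof (cases "l \<ge> 0")
    case True
    then show ?thesis using *[of l] assms by simp
  next
    case False
    then show ?thesis using *[of "- l"] assms by (simp add: gauss_hilbert_minus)
  qed
qed

text \<open>The sum of the bound 2 valid for \<open>\<bar>l\<bar> \<le> 1 / 4\<close> and the
  inverse of the constant in \<open>gauss_hilbert_lower\<close>.\<close>

definition mult_const :: real where
  "mult_const = 2 + 1 / (1 - exp (- (1 / 16)))"

lemma mult_const_ge: "mult_const \<ge> 2"
  by (simp add: mult_const_def)

text \<open>Away from 0 the real part of the denominator alone suffices: it is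
  \<open>gauss_hilbert l\<close> up to sign, decays no faster than \<open>1 / \<bar>l\<bar>\<close>,
  and does not involve \<open>\<xi>\<close>.\<close>

lemma norm_mult_far:
  assumes "\<bar>l\<bar> \<ge> 1 / 4" and z: "\<bar>gauss_hilbert l\<bar> \<le> cmod z"
  shows "cmod (1 / z) \<le> mult_const * (1 + \<bar>l\<bar>)"
proof -
  have e: "0 < 1 - exp (- (1 / 16 :: real))" by simp
  have pos: "0 < (1 - exp (- (1 / 16))) / \<bar>l\<bar>"
    using assms(1) by (intro divide_pos_pos e) auto
  have "cmod (1 / z) \<le> 1 / ((1 - exp (- (1 / 16))) / \<bar>l\<bar>)"
    using pos gauss_hilbert_lower[OF assms(1)] z by (simp only: norm_divide norm_one) (intro frac_le, auto)
  also have "\<dots> = 1 / (1 - exp (- (1 / 16))) * \<bar>l\<bar>"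
    by simp
  also have "\<dots> \<le> mult_const * (1 + \<bar>l\<bar>)"
    using e by (intro mult_mono) (auto simp: mult_const_def)
  finally show ?thesis .
qed

lemma pi_w_near: "\<bar>l\<bar> \<le> 1 / 4 \<Longrightarrow> 1 / 2 \<le> pi * w l"
proof -
  assume l: "\<bar>l\<bar> \<le> 1 / 4"
  have "l\<^sup>2 \<le> (1 / 4)\<^sup>2"
    using power_mono[OF l, of 2] by simp
  then have "1 / 2 \<le> exp (- l\<^sup>2)"
    using exp_ge_add_one_self[of "- l\<^sup>2"] by (simp add: power_divide)
  moreover have "1 \<le> sqrt pi" using pi_ge_two by simp
  ultimately have "1 * (1 / 2) \<le> sqrt pi * exp (- l\<^sup>2)"
    by (intro mult_mono) auto
  moreover have "pi * w l = (pi / sqrt pi) * exp (- l\<^sup>2)"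
    by (simp add: w_def)
  ultimately show ?thesis
    by (simp add: real_div_sqrt)
qed

text \<open>In the imaginary part \<open>\<xi>\<close> and \<open>sgn \<xi> * (pi * w l)\<close>
  have the same sign, so they cannot cancel and \<open>b_mult\<close> has no pole. In
  \<open>u_mult\<close> they have opposite signs.\<close>

lemma b_mult_denom_near:
  assumes "\<xi> \<noteq> 0" "\<bar>l\<bar> \<le> 1 / 4"
  shows "1 / 2 \<le> cmod (\<i> * of_real (\<xi> + sgn \<xi> * (pi * w l)) - of_real (gauss_hilbert l))"
proof -
  have "\<bar>\<xi> + sgn \<xi> * (pi * w l)\<bar> = \<bar>\<xi>\<bar> + pi * w l"
    using mult_nonneg_nonneg[OF pi_ge_zero w_nonneg[of l]] assms(1) by (auto simp: sgn_if)
  then have "1 / 2 \<le> \<bar>\<xi> + sgn \<xi> * (pi * w l)\<bar>"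
    using pi_w_near[OF assms(2)] by simp
  also have "\<dots> = \<bar>Im (\<i> * of_real (\<xi> + sgn \<xi> * (pi * w l)) - of_real (gauss_hilbert l))\<bar>"
    by simp
  also have "\<dots> \<le> cmod (\<i> * of_real (\<xi> + sgn \<xi> * (pi * w l)) - of_real (gauss_hilbert l))"
    by (rule abs_Im_le_cmod)
  finally show ?thesis .
qed

lemma norm_b_mult_near:
  assumes "\<xi> \<noteq> 0" "\<bar>l\<bar> \<le> 1 / 4"
  shows "cmod (b_mult \<xi> l) \<le> 2"
proof -
  have "cmod (b_mult \<xi> l) \<le> 1 / (1 / 2)"
    unfolding b_mult_def norm_divide norm_one using b_mult_denom_near[OF assms]
    by (intro frac_le) auto
  then show ?thesis by simp
qed

lemma norm_b_mult:
  assumes "\<xi> \<noteq> 0"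
  shows "cmod (b_mult \<xi> l) \<le> mult_const * (1 + \<bar>l\<bar>)"
proof (cases "\<bar>l\<bar> \<ge> 1 / 4")
  case True
  have "\<bar>gauss_hilbert l\<bar> = \<bar>Re (\<i> * of_real (\<xi> + sgn \<xi> * (pi * w l)) - of_real (gauss_hilbert l))\<bar>"
    by simp
  also have "\<dots> \<le> cmod (\<i> * of_real (\<xi> + sgn \<xi> * (pi * w l)) - of_real (gauss_hilbert l))"
    by (rule abs_Re_le_cmod)
  finally show ?thesis
    unfolding b_mult_def by (rule norm_mult_far[OF True])
next
  case False
  then have "cmod (b_mult \<xi> l) \<le> 2 * 1"
    using norm_b_mult_near[OF assms, of l] by simp
  also have "\<dots> \<le> mult_const * (1 + \<bar>l\<bar>)"
    using mult_const_ge by (intro mult_mono) auto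
  finally show ?thesis .
qed

lemma norm_u_mult_far:
  assumes "\<bar>l\<bar> \<ge> 1 / 4"
  shows "cmod (u_mult \<xi> l) \<le> mult_const * (1 + \<bar>l\<bar>)"
proof -
  have "\<bar>gauss_hilbert l\<bar> = \<bar>Re (of_real (gauss_hilbert l) + \<i> * of_real (\<xi> - sgn \<xi> * (pi * w l)))\<bar>"
    by simp
  also have "\<dots> \<le> cmod (of_real (gauss_hilbert l) + \<i> * of_real (\<xi> - sgn \<xi> * (pi * w l)))"
    by (rule abs_Re_le_cmod)
  finally show ?thesis
    unfolding u_mult_def by (rule norm_mult_far[OF assms])
qed

text \<open>\<open>\<i> pole \<xi>\<close> is the zero of the linearisation \<open>- 2 l - \<i> (\<xi> - sgn \<xi> sqrt pi)\<close> of the denominator of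
  \<open>cnj (u_mult \<xi> l)\<close> at \<open>l = 0\<close>.\<close>

definition pole :: "real \<Rightarrow> real" where
  "pole \<xi> = (sgn \<xi> * sqrt pi - \<xi>) / 2"

lemma pole_eq_0_iff: "\<xi> \<noteq> 0 \<Longrightarrow> pole \<xi> = 0 \<longleftrightarrow> \<xi> = sqrt pi \<or> \<xi> = - sqrt pi"
  by (auto simp: pole_def sgn_if)

text \<open>In \<open>Z + 2 * Y\<close> the frequency cancels except for its sign; what remains is
  the error of the linear approximation \<open>- 2 l\<close> to \<open>gauss_hilbert\<close> and of
  the approximation \<open>sqrt pi\<close> to \<open>pi * w l\<close>. Hence the error bound is
  uniform in \<open>\<xi>\<close>.\<close>

lemma u_mult_denom_expansion:
  assumes "\<xi> \<noteq> 0" "\<bar>l\<bar> \<le> 1 / 4"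
  defines "Z \<equiv> complex_of_real (gauss_hilbert l) - \<i> * of_real (\<xi> - sgn \<xi> * (pi * w l))"
    and "Y \<equiv> complex_of_real l - \<i> * of_real (pole \<xi>)"
  shows "cmod (Z + 2 * Y) \<le> 4 * l\<^sup>2" "cmod Y \<le> cmod Z" "\<bar>l\<bar> \<le> cmod Y"
proof -
  have el: "1 - exp (- l\<^sup>2) \<le> l\<^sup>2"
    using exp_ge_add_one_self[of "- l\<^sup>2"] by simp
  have Hpos: "\<bar>gauss_hilbert l + 2 * l\<bar> \<le> 2 * \<bar>l\<bar> * l\<^sup>2" if "l > 0" "1 - exp (- l\<^sup>2) \<le> l\<^sup>2" for l
  proof -
    have "gauss_hilbert l + 2 * l \<le> 2 * l * (1 - exp (- l\<^sup>2))"
      using gauss_hilbert_bounds(3)[OF that(1)] by (simp add: algebra_simps)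
    also have "\<dots> \<le> 2 * l * l\<^sup>2"
      using that by (intro mult_left_mono) auto
    finally show ?thesis
      using gauss_hilbert_bounds(2)[OF that(1)] that(1) by simp
  qed
  have H: "\<bar>gauss_hilbert l + 2 * l\<bar> \<le> 2 * \<bar>l\<bar> * l\<^sup>2"
  proof -
    consider "l > 0" | "l = 0" | "l < 0" by linarith
    then show ?thesis
    proof cases
      case 1
      then show ?thesis using Hpos el by simp
    next
      case 2
      then show ?thesis by (simp add: gauss_hilbert_0)
    next
      case 3
      then show ?thesis using Hpos[of "- l"] el by (simp add: gauss_hilbert_minus)
    qed
  qed
  have "pi * w l = (pi / sqrt pi) * exp (- l\<^sup>2)"
    by (simp add: w_def)
  then have piw: "pi * w l = sqrt pi * exp (- l\<^sup>2)"
    by (simp add: real_div_sqrt)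
  have "sqrt pi \<le> sqrt 4"
    using pi_less_4 by (intro real_sqrt_le_mono) simp
  then have sp: "sqrt pi \<le> 2" by simp
  have "\<bar>pi * w l - sqrt pi\<bar> = sqrt pi * (1 - exp (- l\<^sup>2))"
    unfolding piw by (simp add: algebra_simps)
  also have "\<dots> \<le> 2 * l\<^sup>2"
    using sp el by (intro mult_mono) auto
  finally have W: "\<bar>pi * w l - sqrt pi\<bar> \<le> 2 * l\<^sup>2" .
  have eq: "Z + 2 * Y = of_real (gauss_hilbert l + 2 * l) + \<i> * of_real (sgn \<xi> * (pi * w l - sqrt pi))"
    by (simp add: Z_def Y_def pole_def complex_eq_iff field_simps)
  have "cmod (Z + 2 * Y) \<le> \<bar>gauss_hilbert l + 2 * l\<bar> + \<bar>sgn \<xi> * (pi * w l - sqrt pi)\<bar>"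
    unfolding eq by (rule order_trans[OF norm_triangle_ineq]) (simp only: norm_mult norm_of_real norm_ii mult_1 order_refl)
  also have "\<bar>sgn \<xi> * (pi * w l - sqrt pi)\<bar> = \<bar>pi * w l - sqrt pi\<bar>"
    using assms(1) by (simp add: abs_mult abs_sgn_eq)
  also have "\<bar>gauss_hilbert l + 2 * l\<bar> + \<bar>pi * w l - sqrt pi\<bar> \<le> 2 * \<bar>l\<bar> * l\<^sup>2 + 2 * l\<^sup>2"
    using H W by simp
  also have "\<dots> \<le> 2 * (1 / 4) * l\<^sup>2 + 2 * l\<^sup>2"
    using assms(2) by (intro add_right_mono mult_right_mono) auto
  also have "\<dots> \<le> 4 * l\<^sup>2" by simp
  finally show E: "cmod (Z + 2 * Y) \<le> 4 * l\<^sup>2" .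
  show lY: "\<bar>l\<bar> \<le> cmod Y"
    using abs_Re_le_cmod[of Y] by (simp add: Y_def)
  have "4 * l\<^sup>2 = 4 * \<bar>l\<bar> * \<bar>l\<bar>"
    by (simp add: power2_eq_square)
  also have "\<dots> \<le> 4 * (1 / 4) * \<bar>l\<bar>"
    using assms(2) by (intro mult_right_mono mult_left_mono) auto
  \<comment> \<open>The reason for the cutoff \<open>1 / 4\<close>: there the quadratic error is at
    most \<open>cmod Y\<close>, half of the linear term, so \<open>Z\<close> stays at least as large
    as \<open>Y\<close>.\<close>
  finally have "4 * l\<^sup>2 \<le> cmod Y"
    using lY by simp
  moreover have "2 * cmod Y \<le> cmod (Z + 2 * Y) + cmod Z"
    using norm_triangle_ineq4[of "Z + 2 * Y" Z] by (simp add: norm_mult)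
  ultimately show "cmod Y \<le> cmod Z"
    using E by simp
qed

lemma cnj_u_mult: "cnj (u_mult \<xi> l) = 1 / (complex_of_real (gauss_hilbert l) - \<i> * of_real (\<xi> - sgn \<xi> * (pi * w l)))"
  by (simp add: u_mult_def)

lemma norm_u_mult_near:
  assumes "\<xi> \<noteq> 0" "\<bar>l\<bar> \<le> 1 / 4" "pole \<xi> \<noteq> 0"
  shows "cmod (u_mult \<xi> l) \<le> 1 / \<bar>pole \<xi>\<bar>"
proof -
  have "\<bar>pole \<xi>\<bar> \<le> cmod (complex_of_real l - \<i> * of_real (pole \<xi>))"
    using abs_Im_le_cmod[of "complex_of_real l - \<i> * of_real (pole \<xi>)"] by simp
  also have "\<dots> \<le> cmod (complex_of_real (gauss_hilbert l) - \<i> * of_real (\<xi> - sgn \<xi> * (pi * w l)))"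
    by (rule u_mult_denom_expansion(2)[OF assms(1,2)])
  finally have "cmod (cnj (u_mult \<xi> l)) \<le> 1 / \<bar>pole \<xi>\<bar>"
    unfolding cnj_u_mult norm_divide norm_one using assms(3) by (intro frac_le) auto
  then show ?thesis by simp
qed

text \<open>The multiplier with its pole at \<open>\<i> pole \<xi>\<close> split off; at \<open>\<xi> = \<plusminus>sqrt pi\<close>, \<open>l = 0\<close> both summands
  are \<open>1 / 0 = 0\<close>.\<close>

definition regular_mult :: "real \<Rightarrow> real \<Rightarrow> complex" where
  "regular_mult \<xi> l = cnj (u_mult \<xi> l)
     + indicator {- (1 / 4)..1 / 4} l * (1 / (2 * (of_real l - \<i> * of_real (pole \<xi>))))"

lemma borel_measurable_regular_mult [measurable]: "regular_mult \<xi> \<in> borel_measurable borel"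
  unfolding regular_mult_def[abs_def] by measurable

text \<open>Near 0 the two fractions combine to \<open>(Z + 2 Y) / (2 Y Z)\<close>. The numerator is
  at most \<open>4 l\<^sup>2\<close>, hence at most four times the square of \<open>cmod Y\<close>,
  while the denominator is at least twice that square; the quotient 2 involves no
  \<open>\<xi>\<close>.\<close>

lemma norm_regular_mult:
  assumes "\<xi> \<noteq> 0"
  shows "cmod (regular_mult \<xi> l) \<le> mult_const * (1 + \<bar>l\<bar>)"
proof (cases "\<bar>l\<bar> \<le> 1 / 4")
  case False
  then have "regular_mult \<xi> l = cnj (u_mult \<xi> l)"
    by (auto simp: regular_mult_def indicator_def)
  then show ?thesis
    using norm_u_mult_far[of l \<xi>] False by simp
next
  case True
  let ?Z = "complex_of_real (gauss_hilbert l) - \<i> * of_real (\<xi> - sgn \<xi> * (pi * w l))"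
  let ?Y = "complex_of_real l - \<i> * of_real (pole \<xi>)"
  note exp = u_mult_denom_expansion[OF assms True]
  have eq: "regular_mult \<xi> l = 1 / ?Z + 1 / (2 * ?Y)"
    using True by (auto simp: regular_mult_def cnj_u_mult indicator_def)
  have "cmod (regular_mult \<xi> l) \<le> 2"
  proof (cases "?Y = 0")
    \<comment> \<open>The pole itself: here \<open>1 / 0 = 0\<close> makes both fractions
      vanish.\<close>
    case True
    then have "l = 0" "?Z = 0"
      using exp by (auto simp: complex_eq_iff)
    then show ?thesis
      unfolding eq True by simp
  next
    case False
    then have pos: "0 < cmod ?Y" "0 < cmod ?Z"
      using exp(2) by (auto intro: less_le_trans)
    have "1 / ?Z + 1 / (2 * ?Y) = (?Z + 2 * ?Y) / (2 * ?Y * ?Z)"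
      using pos by (simp add: add_frac_eq add.commute mult.commute)
    also have "cmod \<dots> \<le> 4 * (cmod ?Y)\<^sup>2 / (2 * cmod ?Y * cmod ?Y)"
      unfolding norm_divide norm_mult
    proof (intro frac_le)
      have "\<bar>l\<bar>\<^sup>2 \<le> (cmod ?Y)\<^sup>2"
        by (intro power_mono exp(3)) simp
      then show "cmod (?Z + 2 * ?Y) \<le> 4 * (cmod ?Y)\<^sup>2"
        using exp(1) by simp
      show "2 * cmod ?Y * cmod ?Y \<le> cmod 2 * cmod ?Y * cmod ?Z"
        using exp(2) by (simp add: mult_left_mono)
    qed (use pos in auto)
    also have "\<dots> = 2"
      using pos by (simp add: power2_eq_square)
    finally show ?thesis
      unfolding eq .
  qed
  also have "2 \<le> mult_const * (1 + \<bar>l\<bar>)"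
    using mult_mono[OF mult_const_ge, of 1 "1 + \<bar>l\<bar>"] mult_const_ge by simp
  finally show ?thesis .
qed

section \<open>Weighted bounds\<close>

lemma weight_quadratic: "(1 + \<bar>l\<bar>)\<^sup>2 * w l \<le> 4"
proof -
  have "(1 + \<bar>l\<bar>)\<^sup>2 \<le> 2 + 2 * l\<^sup>2"
    using sum_squares_bound[of 1 "\<bar>l\<bar>"] by (simp add: power2_sum)
  then have "(1 + \<bar>l\<bar>)\<^sup>2 * w l \<le> (2 + 2 * l\<^sup>2) * w l"
    by (intro mult_right_mono w_nonneg)
  then show ?thesis
    using w_le_1[of l] mult_w_le_1(1)[of l] by (simp add: algebra_simps)
qed

text \<open>The 32 collects the 2 from squaring a sum, the 4 from \<open>weight_quadratic\<close>
  and the 4 in the square of \<open>2 * pi\<close>.\<close>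

definition op_const :: "real \<Rightarrow> real" where
  "op_const K = sqrt (2 + 32 * pi\<^sup>2 * K\<^sup>2)"

lemma op_const_nonneg: "0 \<le> op_const K"
  by (simp add: op_const_def)

text \<open>As \<open>S\<close> lies in the unweighted space, the weight is spent on the multiplier
  alone: \<open>(1 + \<bar>l\<bar>)\<^sup>2 * w l\<close> is bounded.\<close>

lemma L2w_add_mult:
  assumes [measurable]: "m \<in> borel_measurable borel" "g \<in> borel_measurable borel" "S \<in> borel_measurable borel"
    and m: "\<And>l. cmod (m l) \<le> K * (1 + \<bar>l\<bar>)"
    and g: "AE x in lborel. f x = g x"
    "integrable lborel (\<lambda>v. (cmod (g v))\<^sup>2 * w v)" "(norm_L2w f)\<^sup>2 = (LINT v|lborel. (cmod (g v))\<^sup>2 * w v)"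
    and S: "AE l in lborel. R l = S l"
    "integrable lborel (\<lambda>l. (cmod (S l))\<^sup>2)" "(LINT l|lborel. (cmod (S l))\<^sup>2) \<le> (2 * pi * norm_L2w f)\<^sup>2"
  shows "(\<lambda>l. f l + m l * R l) \<in> L2w"
    "norm_L2w (\<lambda>l. f l + m l * R l) \<le> op_const K * norm_L2w f"
proof -
  let ?T = "\<lambda>l. f l + m l * R l"
  let ?U = "\<lambda>l. g l + m l * S l"
  have ae: "AE l in lborel. ?T l = ?U l"
    using g(1) S(1) by eventually_elim simp
  then have ae2: "AE l in lborel. (cmod (?T l))\<^sup>2 * w l = (cmod (?U l))\<^sup>2 * w l"
    by eventually_elim simp
  have m0: "?U \<in> borel_measurable borel" by measurable
  have m2: "(\<lambda>l. (cmod (?U l))\<^sup>2 * w l) \<in> borel_measurable borel" by measurable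
  have le: "(cmod (?U l))\<^sup>2 * w l \<le> 2 * ((cmod (g l))\<^sup>2 * w l) + 8 * K\<^sup>2 * (cmod (S l))\<^sup>2" for l
  proof -
    have "(cmod (?U l))\<^sup>2 \<le> (cmod (g l) + cmod (m l * S l))\<^sup>2"
      by (intro power_mono norm_triangle_ineq) simp
    also have "\<dots> \<le> 2 * (cmod (g l))\<^sup>2 + 2 * (cmod (m l * S l))\<^sup>2"
      using sum_squares_bound[of "cmod (g l)" "cmod (m l * S l)"] by (simp add: power2_sum)
    finally have "(cmod (?U l))\<^sup>2 * w l \<le> (2 * (cmod (g l))\<^sup>2 + 2 * (cmod (m l * S l))\<^sup>2) * w l"
      by (intro mult_right_mono w_nonneg)
    also have "\<dots> = 2 * ((cmod (g l))\<^sup>2 * w l) + 2 * (cmod (m l))\<^sup>2 * w l * (cmod (S l))\<^sup>2"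
      by (simp add: norm_mult power_mult_distrib algebra_simps)
    also have "2 * (cmod (m l))\<^sup>2 * w l \<le> 2 * (K * (1 + \<bar>l\<bar>))\<^sup>2 * w l"
      by (intro mult_right_mono mult_left_mono power_mono m w_nonneg) auto
    also have "\<dots> = 2 * K\<^sup>2 * ((1 + \<bar>l\<bar>)\<^sup>2 * w l)"
      by (simp add: power_mult_distrib mult_ac)
    also have "\<dots> \<le> 2 * K\<^sup>2 * 4"
      by (intro mult_left_mono weight_quadratic) auto
    finally show ?thesis
      by (simp add: mult_right_mono)
  qed
  have bi: "integrable lborel (\<lambda>l. 2 * ((cmod (g l))\<^sup>2 * w l) + 8 * K\<^sup>2 * (cmod (S l))\<^sup>2)"
    using g(2) S(2) by simp
  have int: "integrable lborel (\<lambda>l. (cmod (?U l))\<^sup>2 * w l)"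
  proof (rule Bochner_Integration.integrable_bound[OF bi])
    show "AE l in lborel. norm ((cmod (?U l))\<^sup>2 * w l) \<le> norm (2 * ((cmod (g l))\<^sup>2 * w l) + 8 * K\<^sup>2 * (cmod (S l))\<^sup>2)"
    proof (intro AE_I2)
      fix l show "norm ((cmod (?U l))\<^sup>2 * w l) \<le> norm (2 * ((cmod (g l))\<^sup>2 * w l) + 8 * K\<^sup>2 * (cmod (S l))\<^sup>2)"
        using le[of l] w_nonneg[of l] by simp
    qed
  qed measurable
  show "?T \<in> L2w"
    unfolding L2w_def
    using borel_measurable_lebesgue_AE_eq[OF ae m0] integrable_lebesgue_AE_eq[OF ae2 m2] int by simp
  have "(norm_L2w ?T)\<^sup>2 = (LINT l|lborel. (cmod (?U l))\<^sup>2 * w l)"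
    unfolding norm_L2w_sq by (rule integral_lebesgue_AE_eq[OF ae2 m2])
  also have "\<dots> \<le> (LINT l|lborel. 2 * ((cmod (g l))\<^sup>2 * w l) + 8 * K\<^sup>2 * (cmod (S l))\<^sup>2)"
    by (intro integral_mono int bi le)
  also have "\<dots> = 2 * (norm_L2w f)\<^sup>2 + 8 * K\<^sup>2 * (LINT l|lborel. (cmod (S l))\<^sup>2)"
    using g S(2) by simp
  also have "\<dots> \<le> 2 * (norm_L2w f)\<^sup>2 + 8 * K\<^sup>2 * (2 * pi * norm_L2w f)\<^sup>2"
    by (intro add_left_mono mult_left_mono S(3)) simp
  also have "\<dots> = (2 + 32 * pi\<^sup>2 * K\<^sup>2) * (norm_L2w f)\<^sup>2"
    by (simp add: power_mult_distrib algebra_simps)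
  also have "\<dots> = (op_const K * norm_L2w f)\<^sup>2"
    by (simp add: op_const_def power_mult_distrib)
  finally show "norm_L2w ?T \<le> op_const K * norm_L2w f"
    by (rule power2_le_imp_le) (simp add: op_const_nonneg norm_L2w_nonneg)
qed

lemma L2w_add_mult_S_hat:
  assumes f: "f \<in> L2w" and m: "m \<in> borel_measurable borel" "\<And>l. cmod (m l) \<le> K * (1 + \<bar>l\<bar>)"
  shows "(\<lambda>l. f l + m l * S_hat s (\<lambda>v. f v * of_real (w v)) l) \<in> L2w"
    "norm_L2w (\<lambda>l. f l + m l * S_hat s (\<lambda>v. f v * of_real (w v)) l) \<le> op_const K * norm_L2w f"
proof -
  obtain g where g: "g \<in> borel_measurable borel" "AE x in lborel. f x = g x"
    "integrable lborel (\<lambda>v. (cmod (g v))\<^sup>2 * w v)" "(norm_L2w f)\<^sup>2 = (LINT v|lborel. (cmod (g v))\<^sup>2 * w v)"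
    by (rule L2w_representative[OF f])
  obtain S where S: "S \<in> borel_measurable borel"
    "AE l in lborel. S_hat s (\<lambda>v. f v * of_real (w v)) l = S l"
    "integrable lborel (\<lambda>l. (cmod (S l))\<^sup>2)" "(LINT l|lborel. (cmod (S l))\<^sup>2) \<le> (2 * pi * norm_L2w f)\<^sup>2"
    by (rule L2w_S_hat[OF f, of s])
  show "(\<lambda>l. f l + m l * S_hat s (\<lambda>v. f v * of_real (w v)) l) \<in> L2w"
    by (rule L2w_add_mult(1)[OF m(1) g(1) S(1) m(2) g(2-4) S(2-4)])
  show "norm_L2w (\<lambda>l. f l + m l * S_hat s (\<lambda>v. f v * of_real (w v)) l) \<le> op_const K * norm_L2w f"
    by (rule L2w_add_mult(2)[OF m(1) g(1) S(1) m(2) g(2-4) S(2-4)])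
qed

lemma L2w_pairing:
  assumes u: "u \<in> L2w" and v: "v \<in> L2w"
  shows "integrable lebesgue (\<lambda>l. u l * cnj (v l) * of_real (w l))"
    "cmod (LINT l|lebesgue. u l * cnj (v l) * of_real (w l)) \<le> norm_L2w u * norm_L2w v"
proof -
  let ?r = "\<lambda>l. complex_of_real (sqrt (w l))"
  have wl: "w \<in> borel_measurable lebesgue"
    by (simp add: measurable_completion)
  have m: "(\<lambda>l. u l * ?r l) \<in> borel_measurable lebesgue" "(\<lambda>l. cnj (v l) * ?r l) \<in> borel_measurable lebesgue"
    using L2wD(1)[OF u] borel_measurable_cnj[OF L2wD(1)[OF v]] wl by simp_all
  have sq: "(cmod (u l * ?r l))\<^sup>2 = (cmod (u l))\<^sup>2 * w l" "(cmod (cnj (v l) * ?r l))\<^sup>2 = (cmod (v l))\<^sup>2 * w l" for l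
    using w_nonneg[of l] by (simp_all add: norm_mult power_mult_distrib)
  have i: "integrable lebesgue (\<lambda>l. (cmod (u l * ?r l))\<^sup>2)" "integrable lebesgue (\<lambda>l. (cmod (cnj (v l) * ?r l))\<^sup>2)"
    unfolding sq using L2wD(2)[OF u] L2wD(2)[OF v] by auto
  have eq: "(u l * ?r l) * (cnj (v l) * ?r l) = u l * cnj (v l) * of_real (w l)" for l
  proof -
    have "?r l * ?r l = of_real (w l)"
      using w_nonneg[of l] by (simp flip: of_real_mult)
    then show ?thesis by (metis (no_types, lifting) mult.assoc mult.left_commute)
  qed
  show "integrable lebesgue (\<lambda>l. u l * cnj (v l) * of_real (w l))"
    using integrable_mult_of_square_integrable[OF m i] unfolding eq .
  have "(cmod (LINT l|lebesgue. u l * cnj (v l) * of_real (w l)))\<^sup>2 \<le> (norm_L2w u * norm_L2w v)\<^sup>2"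
    using Cauchy_Schwarz_integral[OF m i] unfolding eq sq norm_L2w_sq[symmetric] by (simp add: power_mult_distrib)
  then show "cmod (LINT l|lebesgue. u l * cnj (v l) * of_real (w l)) \<le> norm_L2w u * norm_L2w v"
    by (rule power2_le_imp_le) (simp add: norm_L2w_nonneg)
qed

section \<open>Hoelder continuity of products near zero\<close>

lemma holder_on_mult:
  assumes f: "holder_on X A f" and g: "holder_on X B g" and "A \<ge> 0" "B \<ge> 0"
  shows "holder_on X (2 * A * B) (\<lambda>x. f x * g x)"
  unfolding holder_on_def
proof (intro conjI ballI)
  fix x assume x: "x \<in> X"
  have *: "cmod (f x * g x) \<le> A * B"
    unfolding norm_mult using f g x assms by (intro mult_mono) (auto simp: holder_on_def)
  then show "cmod (f x * g x) \<le> 2 * A * B"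
    using mult_nonneg_nonneg[OF assms(3,4)] by simp
  fix y assume y: "y \<in> X"
  have "f x * g x - f y * g y = f x * (g x - g y) + (f x - f y) * g y"
    by (simp add: algebra_simps)
  also have "cmod \<dots> \<le> cmod (f x) * cmod (g x - g y) + cmod (f x - f y) * cmod (g y)"
    by (metis norm_mult norm_triangle_ineq)
  also have "\<dots> \<le> A * (B * sqrt \<bar>x - y\<bar>) + (A * sqrt \<bar>x - y\<bar>) * B"
    using f g x y assms by (intro add_mono mult_mono) (auto simp: holder_on_def)
  also have "\<dots> = 2 * A * B * sqrt \<bar>x - y\<bar>"
    by simp
  finally show "cmod (f x * g x - f y * g y) \<le> 2 * A * B * sqrt \<bar>x - y\<bar>" .
qed

lemma holder_on_add:
  assumes f: "holder_on X A f" and g: "holder_on X B g"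
  shows "holder_on X (A + B) (\<lambda>x. f x + g x)"
  unfolding holder_on_def
proof (intro conjI ballI)
  fix x assume x: "x \<in> X"
  show "cmod (f x + g x) \<le> A + B"
    using f g x norm_triangle_ineq[of "f x" "g x"] unfolding holder_on_def by force
  fix y assume y: "y \<in> X"
  have "cmod (f x + g x - (f y + g y)) \<le> cmod (f x - f y) + cmod (g x - g y)"
    using norm_triangle_ineq[of "f x - f y" "g x - g y"] by (simp add: algebra_simps)
  also have "\<dots> \<le> A * sqrt \<bar>x - y\<bar> + B * sqrt \<bar>x - y\<bar>"
    using f g x y by (intro add_mono) (auto simp: holder_on_def)
  finally show "cmod (f x + g x - (f y + g y)) \<le> (A + B) * sqrt \<bar>x - y\<bar>"
    by (simp add: algebra_simps)
qed

lemma lipschitz_real: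
  fixes f :: "real \<Rightarrow> real"
  assumes "\<And>z. \<bar>z\<bar> \<le> r \<Longrightarrow> (f has_real_derivative f' z) (at z)" "\<And>z. \<bar>z\<bar> \<le> r \<Longrightarrow> \<bar>f' z\<bar> \<le> B"
    and "\<bar>x\<bar> \<le> r" "\<bar>y\<bar> \<le> r"
  shows "\<bar>f x - f y\<bar> \<le> B * \<bar>x - y\<bar>"
proof -
  have "norm (f x - f y) \<le> B * norm (x - y)"
  proof (rule field_differentiable_bound[where S = "{- r..r}" and f' = f'])
    show "(f has_field_derivative f' z) (at z within {- r..r})" if "z \<in> {- r..r}" for z
      using assms(1)[of z] that by (auto intro: has_field_derivative_at_within)
  qed (use assms in auto)
  then show ?thesis by simp
qed

text \<open>Uniform in \<open>\<xi>\<close>, because the frequency drops out of differences of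
  denominators. On this interval \<open>w\<close> has Lipschitz constant 2 and
  \<open>gauss_hilbert\<close> 4, so the denominator has at most \<open>4 * 2 + 4 = 12\<close>; with
  \<open>b_mult\<close> bounded by 2 this gives 48 for \<open>b_mult\<close> and
  \<open>2 * 2 + 48\<close>, rounded up to 60, for the product. Distances are at most 1, so a
  Lipschitz bound implies the Hoelder bound.\<close>

lemma b_mult_w_holder:
  assumes \<xi>: "\<xi> \<noteq> 0"
  shows "holder_on {- (1 / 4)..1 / 4} 60 (\<lambda>l. of_real (w l) * b_mult \<xi> l)"
  unfolding holder_on_def
proof (intro conjI ballI)
  fix x :: real assume "x \<in> {- (1 / 4)..1 / 4}"
  then have x: "\<bar>x\<bar> \<le> 1 / 4" by auto
  have wb: "cmod (of_real (w x) * b_mult \<xi> x) \<le> 1 * 2" if "\<bar>x\<bar> \<le> 1 / 4" for x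
    unfolding norm_mult norm_of_real using w_nonneg[of x] w_le_1[of x] norm_b_mult_near[OF \<xi> that]
    by (intro mult_mono) auto
  show "cmod (of_real (w x) * b_mult \<xi> x) \<le> 60"
    using wb[OF x] by simp
  fix y :: real assume "y \<in> {- (1 / 4)..1 / 4}"
  then have y: "\<bar>y\<bar> \<le> 1 / 4" by auto
  have wl: "\<bar>w x - w y\<bar> \<le> 2 * \<bar>x - y\<bar>"
  proof (rule lipschitz_real[OF DERIV_w _ x y])
    show "\<bar>- 2 * z * w z\<bar> \<le> 2" for z
      using mult_w_le_1(2)[of z] w_nonneg[of z] by (simp add: abs_mult)
  qed
  have Hl: "\<bar>gauss_hilbert x - gauss_hilbert y\<bar> \<le> 4 * \<bar>x - y\<bar>"
  proof (rule lipschitz_real[OF DERIV_gauss_hilbert _ x y])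
    fix z :: real assume z: "\<bar>z\<bar> \<le> 1 / 4"
    have "\<bar>gauss_hilbert z\<bar> \<le> 2 * \<bar>z\<bar>"
    proof -
      have *: "\<bar>gauss_hilbert z\<bar> \<le> 2 * z" if "z > 0" for z
      proof -
        have "- 2 * z * exp (- z\<^sup>2) \<le> 0" using that by simp
        then show ?thesis
          using gauss_hilbert_bounds(2,3)[OF that] by linarith
      qed
      show ?thesis
        using *[of z] *[of "- z"] by (cases z "0::real" rule: linorder_cases) (auto simp: gauss_hilbert_minus gauss_hilbert_0)
    qed
    then have "\<bar>z\<bar> * \<bar>gauss_hilbert z\<bar> \<le> (1 / 4) * (2 * (1 / 4))"
      using z by (intro mult_mono) auto
    then show "\<bar>- 2 - 2 * z * gauss_hilbert z\<bar> \<le> 4"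
      by (simp add: abs_mult[symmetric])
  qed
  let ?d = "\<lambda>l. \<i> * complex_of_real (\<xi> + sgn \<xi> * (pi * w l)) - of_real (gauss_hilbert l)"
  have nz: "?d x \<noteq> 0" "?d y \<noteq> 0"
    using b_mult_denom_near[OF \<xi> x] b_mult_denom_near[OF \<xi> y] by auto
  have "?d y - ?d x = \<i> * of_real (sgn \<xi> * pi * (w y - w x)) - of_real (gauss_hilbert y - gauss_hilbert x)"
    by (simp add: algebra_simps)
  also have "cmod \<dots> \<le> cmod (\<i> * of_real (sgn \<xi> * pi * (w y - w x))) + cmod (complex_of_real (gauss_hilbert y - gauss_hilbert x))"
    by (rule norm_triangle_ineq4)
  also have "\<dots> = pi * \<bar>w x - w y\<bar> + \<bar>gauss_hilbert x - gauss_hilbert y\<bar>"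
    using \<xi> by (simp only: norm_mult norm_of_real norm_ii abs_mult) (simp add: abs_sgn_eq abs_minus_commute)
  also have "\<dots> \<le> 4 * (2 * \<bar>x - y\<bar>) + 4 * \<bar>x - y\<bar>"
    using pi_less_4 wl Hl by (intro add_mono mult_mono) auto
  finally have dd: "cmod (?d y - ?d x) \<le> 12 * \<bar>x - y\<bar>" by simp
  have "b_mult \<xi> x - b_mult \<xi> y = (?d y - ?d x) * (b_mult \<xi> x * b_mult \<xi> y)"
    using nz unfolding b_mult_def by (simp add: diff_frac_eq)
  also have "cmod \<dots> \<le> 12 * \<bar>x - y\<bar> * (2 * 2)"
    unfolding norm_mult using dd norm_b_mult_near[OF \<xi> x] norm_b_mult_near[OF \<xi> y]
    by (intro mult_mono) auto
  finally have bl: "cmod (b_mult \<xi> x - b_mult \<xi> y) \<le> 48 * \<bar>x - y\<bar>" by simp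
  have "of_real (w x) * b_mult \<xi> x - of_real (w y) * b_mult \<xi> y
    = of_real (w x - w y) * b_mult \<xi> x + of_real (w y) * (b_mult \<xi> x - b_mult \<xi> y)"
    by (simp add: algebra_simps)
  also have "cmod \<dots> \<le> \<bar>w x - w y\<bar> * cmod (b_mult \<xi> x) + \<bar>w y\<bar> * cmod (b_mult \<xi> x - b_mult \<xi> y)"
    by (rule order_trans[OF norm_triangle_ineq]) (simp only: norm_mult norm_of_real order_refl)
  also have "\<dots> \<le> (2 * \<bar>x - y\<bar>) * 2 + 1 * (48 * \<bar>x - y\<bar>)"
    using wl norm_b_mult_near[OF \<xi> x] bl w_nonneg[of y] w_le_1[of y] by (intro add_mono mult_mono) auto
  also have "\<dots> \<le> 60 * \<bar>x - y\<bar>" by simp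
  also have "\<bar>x - y\<bar> \<le> sqrt \<bar>x - y\<bar>"
  proof (rule real_le_rsqrt)
    have "\<bar>x - y\<bar> \<le> 1" using x y by linarith
    then show "\<bar>x - y\<bar>\<^sup>2 \<le> \<bar>x - y\<bar>"
      using mult_left_mono[of "\<bar>x - y\<bar>" 1 "\<bar>x - y\<bar>"] by (simp add: power2_eq_square)
  qed
  finally show "cmod (of_real (w x) * b_mult \<xi> x - of_real (w y) * b_mult \<xi> y) \<le> 60 * sqrt \<bar>x - y\<bar>"
    by simp
qed

section \<open>The pairing near the pole\<close>

lemma holder_onD:
  assumes "holder_on X A k" "x \<in> X" "y \<in> X"
  shows "cmod (k x) \<le> A" "cmod (k x - k y) \<le> A * sqrt \<bar>x - y\<bar>"
  using assms unfolding holder_on_def by blast+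

lemma holder_on_mono:
  assumes k: "holder_on X A k" and "A \<le> B" "Y \<subseteq> X"
  shows "holder_on Y B k"
  unfolding holder_on_def
proof (intro conjI ballI)
  fix x y assume "x \<in> Y" "y \<in> Y"
  then have X: "x \<in> X" "y \<in> X" using assms(3) by auto
  show "cmod (k x) \<le> B"
    using holder_onD(1)[OF k X] assms(2) by linarith
  have "A * sqrt \<bar>x - y\<bar> \<le> B * sqrt \<bar>x - y\<bar>"
    using assms(2) by (intro mult_right_mono) auto
  then show "cmod (k x - k y) \<le> B * sqrt \<bar>x - y\<bar>"
    using holder_onD(2)[OF k X] by linarith
qed

lemma tendsto_zero_side: "((\<lambda>b. b) \<longlongrightarrow> 0) (at_zero_side s)"
  unfolding at_zero_side_def by (auto intro!: tendsto_ident_at)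

text \<open>Dominated convergence along a one-sided limit, reduced to sequences of nonzero
  parameters on that side.\<close>

lemma integral_tendsto_side:
  fixes f :: "real \<Rightarrow> real \<Rightarrow> complex"
  assumes g: "g \<in> borel_measurable M" and f: "\<And>b. b \<noteq> 0 \<Longrightarrow> f b \<in> borel_measurable M"
    and W: "integrable M W" and lim: "AE x in M. ((\<lambda>b. f b x) \<longlongrightarrow> g x) (at_zero_side s)"
    and bound: "\<And>b. b \<noteq> 0 \<Longrightarrow> AE x in M. norm (f b x) \<le> W x"
  shows "((\<lambda>b. LINT x|M. f b x) \<longlongrightarrow> (LINT x|M. g x)) (at_zero_side s)"
proof -
  define X where "X = (if s > 0 then {0<..} else {..<0 :: real})"
  have side: "at_zero_side s = at 0 within X"
    by (simp add: at_zero_side_def X_def)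
  show ?thesis
    unfolding side tendsto_at_iff_sequentially comp_def
  proof (intro allI impI)
    fix B :: "nat \<Rightarrow> real" assume B: "\<forall>i. B i \<in> X - {0}" "B \<longlonglongrightarrow> 0"
    have fl: "filterlim B (at_zero_side s) sequentially"
      unfolding side filterlim_at using B by auto
    show "(\<lambda>i. LINT x|M. f (B i) x) \<longlonglongrightarrow> (LINT x|M. g x)"
    proof (rule integral_dominated_convergence[OF g _ W])
      show "f (B i) \<in> borel_measurable M" for i
        using B(1) by (intro f) auto
      show "AE x in M. (\<lambda>i. f (B i) x) \<longlonglongrightarrow> g x"
        using lim by eventually_elim (rule filterlim_compose[OF _ fl])
      show "AE x in M. norm (f (B i) x) \<le> W x" for i
        using B(1) by (intro bound) auto
    qed
  qed
qed

abbreviation near_zero :: "real set" where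
  "near_zero \<equiv> {- (1 / 4)..1 / 4}"

lemma inverse_sqrt_near_zero:
  "integrable lborel (\<lambda>l. indicator near_zero l * (1 / sqrt \<bar>l\<bar>))"
  "(LINT l|lborel. indicator near_zero l * (1 / sqrt \<bar>l\<bar>)) = 2"
proof -
  define P where "P = (\<lambda>l::real. indicator {0<..<1 / 4} l * (1 / sqrt l))"
  have D: "((\<lambda>l. 2 * sqrt l) has_real_derivative 1 / sqrt l) (at l)" if "l > 0" for l
    using DERIV_cmult[OF DERIV_real_sqrt[OF that], of 2] by (simp add: inverse_eq_divide)
  have c: "isCont (\<lambda>l. 1 / sqrt l) l" if "l > 0" for l :: real
    using isCont_divide[OF continuous_const[of "at l" 1] isCont_real_sqrt[of l]] that by simp
  have q: "sqrt (1 / 4) = 1 / 2"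
    by (rule real_sqrt_unique) (auto simp: power2_eq_square)
  have l0: "(((\<lambda>l. 2 * sqrt l) \<circ> real_of_ereal) \<longlongrightarrow> 0) (at_right (ereal 0))"
    unfolding ereal_tendsto_simps by real_asymp
  have l1: "(((\<lambda>l. 2 * sqrt l) \<circ> real_of_ereal) \<longlongrightarrow> 1) (at_left (ereal (1 / 4)))"
    using tendsto_mult[OF tendsto_const[of 2] tendsto_real_sqrt[OF tendsto_ident_at[of "1 / 4" "{..<1 / 4}"]]] q
    by (simp add: ereal_tendsto_simps)
  have nonneg: "AE l in lborel. ereal 0 < ereal l \<longrightarrow> ereal l < ereal (1 / 4) \<longrightarrow> 0 \<le> 1 / sqrt l"
    by simp
  note T = interval_integral_FTC_nonneg[OF _ D c nonneg l0 l1]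
  have I: "set_integrable lborel (einterval (ereal 0) (ereal (1 / 4))) (\<lambda>l. 1 / sqrt l)"
    by (rule T(1)) auto
  have I': "(LBINT l=ereal 0..ereal (1 / 4). 1 / sqrt l) = 1 - 0"
    by (rule T(2)) auto
  have e: "einterval (ereal 0) (ereal (1 / 4)) = {0<..<1 / 4}"
    by (auto simp: einterval_def)
  have P1: "integrable lborel P"
    using I by (simp add: set_integrable_def e P_def)
  have P2: "(LINT l|lborel. P l) = 1"
    using I' by (simp add: interval_lebesgue_integral_def set_lebesgue_integral_def e P_def)
  have Q1: "integrable lborel (\<lambda>l. P (- l))"
    using lborel_integrable_real_affine_iff[of "- 1" P 0] P1 by simp
  have Q2: "(LINT l|lborel. P (- l)) = 1"
    using lborel_integral_real_affine[of "- 1" P 0] P2 by simp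
  have m: "(\<lambda>l::real. indicator near_zero l * (1 / sqrt \<bar>l\<bar>)) \<in> borel_measurable lborel"
    "(\<lambda>l. P l + P (- l)) \<in> borel_measurable lborel"
    unfolding P_def by measurable
  have ae: "AE l in lborel. indicator near_zero l * (1 / sqrt \<bar>l\<bar>) = P l + P (- l)"
    using AE_lborel_singleton[of "1 / 4"] AE_lborel_singleton[of "- (1 / 4)"]
    by eventually_elim (auto simp: P_def indicator_def)
  show "integrable lborel (\<lambda>l. indicator near_zero l * (1 / sqrt \<bar>l\<bar>))"
    using integrable_cong_AE[OF m ae] P1 Q1 by simp
  show "(LINT l|lborel. indicator near_zero l * (1 / sqrt \<bar>l\<bar>)) = 2"
    using integral_cong_AE[OF m ae] P1 P2 Q1 Q2 by simp
qed

text \<open>The interval is symmetric about 0, so the logarithmic parts of the primitive cancel.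
  What is left is bounded uniformly in \<open>c\<close> and has one-sided limits as \<open>c\<close>
  tends to 0.\<close>

lemma integral_simple_pole:
  assumes "c \<noteq> 0"
  shows "(LINT l|lborel. of_real (indicator near_zero l) * (1 / (of_real l - \<i> * of_real c)))
    = 2 * \<i> * of_real (arctan (1 / (4 * c)))"
proof -
  define f where "f = (\<lambda>l. 1 / (of_real l - \<i> * of_real c) :: complex)"
  define F where "F = (\<lambda>l. complex_of_real (ln ((l - Re (\<i> * of_real c))\<^sup>2 + (Im (\<i> * of_real c))\<^sup>2) / 2)
    + \<i> * of_real (arctan ((l - Re (\<i> * of_real c)) / Im (\<i> * of_real c))))"
  have nz: "of_real l - \<i> * of_real c \<noteq> (0::complex)" for l
    using cauchy_kernel_denom_nonzero[OF assms] .
  have D: "(F has_vector_derivative f l) (at l within near_zero)" for l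
  proof -
    have "Im (\<i> * of_real c) \<noteq> 0" using assms by simp
    then show ?thesis
      unfolding F_def f_def by (rule has_vector_derivative_at_within[OF has_vector_derivative_log_primitive])
  qed
  have f: "continuous_on near_zero f"
    unfolding f_def by (intro continuous_on_divide continuous_on_const continuous_on_diff continuous_on_of_real continuous_on_id ballI nz)
  have "(LBINT l. indicator near_zero l *\<^sub>R f l) = F (1 / 4) - F (- (1 / 4))"
    by (rule integral_FTC_atLeastAtMost[of "- (1 / 4)" "1 / 4" F f, OF _ D f]) simp
  also have "\<dots> = 2 * \<i> * of_real (arctan (1 / (4 * c)))"
  proof -
    have "Re (\<i> * of_real c) = 0" "Im (\<i> * of_real c) = c" "- (1 / 4) / c = - (1 / (4 * c))" "1 / 4 / c = 1 / (4 * c)"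
      by auto
    moreover have "a + \<i> * of_real t - (a + \<i> * of_real (- t)) = 2 * \<i> * of_real t" for a :: complex and t :: real
      by (simp add: algebra_simps)
    ultimately show ?thesis
      unfolding F_def by (simp only: diff_0_right arctan_minus power2_minus)
  qed
  finally show ?thesis
    by (simp only: f_def scaleR_conv_of_real)
qed

text \<open>Subtracting \<open>k 0\<close> leaves an integrand of size at most
  \<open>A / sqrt \<bar>l\<bar>\<close>, integrable uniformly in \<open>c\<close>, and an explicit
  multiple of the bare pole. The bound \<open>6 * A\<close> is 2 from the inverse root plus 4 from
  \<open>arctan\<close>, estimated by 2.\<close>

lemma singular_integral:
  assumes [measurable]: "k \<in> borel_measurable borel" and k: "holder_on near_zero A k" and c: "c \<noteq> 0"
  shows "integrable lborel (\<lambda>l. of_real (indicator near_zero l) * (k l / (of_real l - \<i> * of_real c)))"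
    "(LINT l|lborel. of_real (indicator near_zero l) * (k l / (of_real l - \<i> * of_real c)))
      = (LINT l|lborel. of_real (indicator near_zero l) * ((k l - k 0) / (of_real l - \<i> * of_real c)))
        + k 0 * (2 * \<i> * of_real (arctan (1 / (4 * c))))"
    "cmod (of_real (indicator near_zero l) * ((k l - k 0) / (of_real l - \<i> * of_real c)))
      \<le> A * (indicator near_zero l * (1 / sqrt \<bar>l\<bar>))"
    "cmod (LINT l|lborel. of_real (indicator near_zero l) * (k l / (of_real l - \<i> * of_real c))) \<le> 6 * A"
proof -
  let ?J = "\<lambda>l. complex_of_real (indicator near_zero l)"
  have A: "cmod (k 0) \<le> A" "A \<ge> 0"
    using k order_trans[OF norm_ge_zero[of "k 0"]] by (auto simp: holder_on_def)
  have nz: "of_real l - \<i> * of_real c \<noteq> (0::complex)" for l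
    using cauchy_kernel_denom_nonzero[OF c] .
  have lc: "\<bar>l\<bar> \<le> cmod (of_real l - \<i> * of_real c)" for l
    using abs_Re_le_cmod[of "of_real l - \<i> * of_real c"] by simp
  show dom: "cmod (?J l * ((k l - k 0) / (of_real l - \<i> * of_real c)))
      \<le> A * (indicator near_zero l * (1 / sqrt \<bar>l\<bar>))" for l
  proof (cases "l \<in> near_zero \<and> l \<noteq> 0")
    case True
    have "cmod (k l - k 0) \<le> A * sqrt \<bar>l\<bar>"
      using holder_onD(2)[OF k, of l 0] True by simp
    then have "cmod (k l - k 0) / cmod (of_real l - \<i> * of_real c) \<le> A * sqrt \<bar>l\<bar> / \<bar>l\<bar>"
      using lc[of l] True A by (intro frac_le) auto
    also have "\<dots> = A * (1 / sqrt \<bar>l\<bar>)"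
      using sqrt_divide_self_eq[of "\<bar>l\<bar>"] by (simp add: divide_inverse mult.assoc)
    finally show ?thesis
      using True by (simp add: norm_mult norm_divide)
  next
    case False
    then show ?thesis
      using A by (auto simp: indicator_def)
  qed
  have domI: "integrable lborel (\<lambda>l. A * (indicator near_zero l * (1 / sqrt \<bar>l\<bar>)))"
    by (intro integrable_mult_right inverse_sqrt_near_zero)
  have i1: "integrable lborel (\<lambda>l. ?J l * ((k l - k 0) / (of_real l - \<i> * of_real c)))"
  proof (rule Bochner_Integration.integrable_bound[OF domI])
    show "AE l in lborel. norm (?J l * ((k l - k 0) / (of_real l - \<i> * of_real c)))
      \<le> norm (A * (indicator near_zero l * (1 / sqrt \<bar>l\<bar>)))"
    proof (intro AE_I2)
      fix l show "norm (?J l * ((k l - k 0) / (of_real l - \<i> * of_real c)))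
        \<le> norm (A * (indicator near_zero l * (1 / sqrt \<bar>l\<bar>)))"
        using dom[of l] unfolding real_norm_def by linarith
    qed
  qed measurable
  have i2: "integrable lborel (\<lambda>l. ?J l * (1 / (of_real l - \<i> * of_real c)))"
  proof (rule integrable_mult_bounded[where B = "1 / \<bar>c\<bar>"])
    show "integrable lborel ?J"
      using integrable_indicator_Icc by (simp add: complex_of_real_integrable_eq)
    show "cmod (1 / (of_real l - \<i> * of_real c)) \<le> 1 / \<bar>c\<bar>" for l
      using norm_cauchy_kernel_le[OF c, of l] by (simp add: cauchy_kernel_def)
  qed measurable
  have split: "?J l * (k l / (of_real l - \<i> * of_real c))
    = ?J l * ((k l - k 0) / (of_real l - \<i> * of_real c)) + k 0 * (?J l * (1 / (of_real l - \<i> * of_real c)))" for l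
    by (simp add: diff_divide_distrib algebra_simps)
  show "integrable lborel (\<lambda>l. ?J l * (k l / (of_real l - \<i> * of_real c)))"
    unfolding split by (intro Bochner_Integration.integrable_add integrable_mult_right i1 i2)
  show eq: "(LINT l|lborel. ?J l * (k l / (of_real l - \<i> * of_real c)))
      = (LINT l|lborel. ?J l * ((k l - k 0) / (of_real l - \<i> * of_real c)))
        + k 0 * (2 * \<i> * of_real (arctan (1 / (4 * c))))"
    unfolding split Bochner_Integration.integral_add[OF i1 integrable_mult_right[OF i2]]
      integral_mult_right_zero integral_simple_pole[OF c] ..
  have "cmod (LINT l|lborel. ?J l * ((k l - k 0) / (of_real l - \<i> * of_real c)))
    \<le> (LINT l|lborel. A * (indicator near_zero l * (1 / sqrt \<bar>l\<bar>)))"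
    by (rule Bochner_Integration.integral_norm_bound_integral[OF i1 domI dom])
  also have "\<dots> = 2 * A"
    unfolding integral_mult_right_zero inverse_sqrt_near_zero(2) by simp
  finally have b1: "cmod (LINT l|lborel. ?J l * ((k l - k 0) / (of_real l - \<i> * of_real c))) \<le> 2 * A" .
  have "\<bar>arctan (1 / (4 * c))\<bar> \<le> 2"
    using arctan_bounded[of "1 / (4 * c)"] pi_less_4 by auto
  then have "cmod (k 0) * (2 * \<bar>arctan (1 / (4 * c))\<bar>) \<le> A * (2 * 2)"
    using A by (intro mult_mono) auto
  then have b2: "cmod (k 0 * (2 * \<i> * of_real (arctan (1 / (4 * c))))) \<le> 4 * A"
    by (simp add: norm_mult)
  show "cmod (LINT l|lborel. ?J l * (k l / (of_real l - \<i> * of_real c))) \<le> 6 * A"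
    unfolding eq using norm_triangle_le[OF add_mono[OF b1 b2]] by simp
qed

text \<open>The remainder converges by dominated convergence. The \<open>arctan\<close> term tends
  to \<open>pi / 2\<close> from the right and to \<open>- pi / 2\<close> from the left, which is why
  the side of approach matters.\<close>

lemma singular_integral_convergent:
  assumes [measurable]: "k \<in> borel_measurable borel" and k: "holder_on near_zero A k"
  shows "\<exists>L. ((\<lambda>b. LINT l|lborel. of_real (indicator near_zero l) * (k l / (of_real l - \<i> * of_real b))) \<longlongrightarrow> L) (at_zero_side s)"
proof -
  let ?J = "\<lambda>l. complex_of_real (indicator near_zero l)"
  have "((\<lambda>b. LINT l|lborel. ?J l * ((k l - k 0) / (of_real l - \<i> * of_real b)))
    \<longlongrightarrow> (LINT l|lborel. ?J l * ((k l - k 0) / of_real l))) (at_zero_side s)"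
  proof (rule integral_tendsto_side)
    show "integrable lborel (\<lambda>l. A * (indicator near_zero l * (1 / sqrt \<bar>l\<bar>)))"
      by (intro integrable_mult_right inverse_sqrt_near_zero)
    show "AE l in lborel. cmod (?J l * ((k l - k 0) / (of_real l - \<i> * of_real b)))
      \<le> A * (indicator near_zero l * (1 / sqrt \<bar>l\<bar>))" if "b \<noteq> 0" for b
      by (intro AE_I2 singular_integral(3) k that assms)
    have "((\<lambda>b. ?J l * ((k l - k 0) / (of_real l - \<i> * of_real b))) \<longlongrightarrow> ?J l * ((k l - k 0) / of_real l)) (at_zero_side s)"
      if "l \<noteq> 0" for l
    proof -
      have "((\<lambda>b. ?J l * ((k l - k 0) / (of_real l - \<i> * of_real b))) \<longlongrightarrow> ?J l * ((k l - k 0) / (of_real l - \<i> * of_real 0))) (at_zero_side s)"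
        using that by (intro tendsto_intros tendsto_zero_side) simp
      then show ?thesis by simp
    qed
    then show "AE l in lborel. ((\<lambda>b. ?J l * ((k l - k 0) / (of_real l - \<i> * of_real b)))
      \<longlongrightarrow> ?J l * ((k l - k 0) / of_real l)) (at_zero_side s)"
      using AE_lborel_singleton[of 0] by (auto elim: eventually_mono)
  qed measurable
  moreover have "\<exists>L. ((\<lambda>b. arctan (1 / (4 * b))) \<longlongrightarrow> L) (at_zero_side s)"
  proof -
    have "((\<lambda>b. arctan (1 / (4 * b))) \<longlongrightarrow> pi / 2) (at_right 0)" "((\<lambda>b. arctan (1 / (4 * b))) \<longlongrightarrow> - (pi / 2)) (at_left 0)"
      by real_asymp+
    then show ?thesis unfolding at_zero_side_def by auto
  qed
  then obtain L where "((\<lambda>b. arctan (1 / (4 * b))) \<longlongrightarrow> L) (at_zero_side s)" by blast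
  ultimately have "((\<lambda>b. (LINT l|lborel. ?J l * ((k l - k 0) / (of_real l - \<i> * of_real b)))
      + k 0 * (2 * \<i> * of_real (arctan (1 / (4 * b)))))
    \<longlongrightarrow> (LINT l|lborel. ?J l * ((k l - k 0) / of_real l)) + k 0 * (2 * \<i> * of_real L)) (at_zero_side s)"
    by (intro tendsto_intros)
  moreover have "\<forall>\<^sub>F b in at_zero_side s. (LINT l|lborel. ?J l * ((k l - k 0) / (of_real l - \<i> * of_real b)))
      + k 0 * (2 * \<i> * of_real (arctan (1 / (4 * b)))) = (LINT l|lborel. ?J l * (k l / (of_real l - \<i> * of_real b)))"
  proof -
    have "\<forall>\<^sub>F b in at_zero_side s. b \<noteq> 0"
      unfolding at_zero_side_def by (simp add: eventually_neq_at_within)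
    then show ?thesis
      by eventually_elim (rule singular_integral(2)[OF assms, symmetric])
  qed
  ultimately show ?thesis
    by (intro exI) (rule Lim_transform_eventually)
qed

lemma L2w_mult_unimodular_le:
  assumes h: "h \<in> L2w" and [measurable]: "\<rho> \<in> borel_measurable borel" and \<rho>: "\<And>l. cmod (\<rho> l) \<le> 1"
  shows "(\<lambda>l. \<rho> l * h l) \<in> L2w" "norm_L2w (\<lambda>l. \<rho> l * h l) \<le> norm_L2w h"
proof -
  have m: "(\<lambda>l. \<rho> l * h l) \<in> borel_measurable lebesgue"
    using L2wD(1)[OF h] measurable_completion[of \<rho> lborel borel] by simp
  have wl: "w \<in> borel_measurable lebesgue"
    by (simp add: measurable_completion)
  have le: "(cmod (\<rho> l * h l))\<^sup>2 * w l \<le> (cmod (h l))\<^sup>2 * w l" for l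
  proof -
    have "cmod (\<rho> l) * cmod (h l) \<le> 1 * cmod (h l)"
      by (intro mult_right_mono \<rho>) simp
    then show ?thesis
      by (intro mult_right_mono power_mono w_nonneg) (auto simp: norm_mult)
  qed
  have int: "integrable lebesgue (\<lambda>l. (cmod (\<rho> l * h l))\<^sup>2 * w l)"
  proof (rule Bochner_Integration.integrable_bound[OF L2wD(2)[OF h]])
    show "(\<lambda>l. (cmod (\<rho> l * h l))\<^sup>2 * w l) \<in> borel_measurable lebesgue"
      using m wl by simp
    show "AE l in lebesgue. norm ((cmod (\<rho> l * h l))\<^sup>2 * w l) \<le> norm ((cmod (h l))\<^sup>2 * w l)"
    proof (intro AE_I2)
      fix l show "norm ((cmod (\<rho> l * h l))\<^sup>2 * w l) \<le> norm ((cmod (h l))\<^sup>2 * w l)"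
        using le[of l] w_nonneg[of l] by simp
    qed
  qed
  then show "(\<lambda>l. \<rho> l * h l) \<in> L2w"
    using m by (simp add: L2w_def)
  show "norm_L2w (\<lambda>l. \<rho> l * h l) \<le> norm_L2w h"
    unfolding norm_L2w_def by (intro real_sqrt_le_mono integral_mono int L2wD(2)[OF h] le)
qed

text \<open>The second term is \<open>1 / 2 * 6 * (2 * 12 * pi)\<close>: the residue factor, the
  singular integral bound and the Hoelder constant of the product \<open>k\<close>.\<close>

definition pairing_const :: real where
  "pairing_const = op_const mult_const + 72 * pi"

text \<open>The hypotheses on \<open>h\<close> cover both uses: an arbitrary element of
  \<open>H1w\<close>, as needed for the dual norm, and \<open>B_op \<xi> f\<close>, which is
  controlled in \<open>L2w\<close> and, after multiplication by \<open>w\<close>, in the Hoelder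
  sense near 0. The number \<open>A\<close> bounds both quantities.\<close>

locale pairing =
  fixes \<xi> :: real and g h q :: "real \<Rightarrow> complex" and A :: real
  assumes \<xi>: "\<xi> \<noteq> 0" and g: "g \<in> H1w" and h: "h \<in> L2w" and hA: "norm_L2w h \<le> A"
    and q_meas [measurable]: "q \<in> borel_measurable borel"
    and hq: "AE l in lborel. h l * of_real (w l) = q l"
    and q: "holder_on near_zero A q"
begin

definition S :: "real \<Rightarrow> complex" where
  "S = S_hat (- sgn \<xi>) (\<lambda>v. g v * of_real (w v))"

text \<open>\<open>U_op \<xi> g\<close> with the pole of its multiplier removed; it lies in
  \<open>L2w\<close> with a bound independent of \<open>\<xi>\<close>.\<close>

definition g_reg :: "real \<Rightarrow> complex" where
  "g_reg l = g l + (- cnj (regular_mult \<xi> l)) * S l"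

definition k :: "real \<Rightarrow> complex" where
  "k l = q l * cnj (S l)"

lemma A_nonneg: "0 \<le> A"
  using hA norm_L2w_nonneg[of h] by simp

lemma S_holder: "holder_on UNIV (12 * pi * norm_H1w g) S"
  unfolding S_def by (rule H1w_S_hat_holder[OF g])

lemma S_meas [measurable]: "S \<in> borel_measurable borel"
  by (rule borel_measurable_if_holder[OF S_holder])

lemma k_meas [measurable]: "k \<in> borel_measurable borel"
  unfolding k_def[abs_def] by measurable

lemma k_holder: "holder_on near_zero (2 * A * (12 * pi * norm_H1w g)) k"
proof -
  have "holder_on near_zero (12 * pi * norm_H1w g) (\<lambda>l. cnj (S l))"
    using S_holder unfolding holder_on_def by (simp flip: complex_cnj_diff)
  then show ?thesis
    unfolding k_def using q A_nonneg norm_H1w_nonneg[of g] by (intro holder_on_mult) auto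
qed

lemma g_reg: "g_reg \<in> L2w" "norm_L2w g_reg \<le> op_const mult_const * norm_H1w g"
proof -
  have m: "(\<lambda>l. - cnj (regular_mult \<xi> l)) \<in> borel_measurable borel"
    by measurable
  have b: "cmod (- cnj (regular_mult \<xi> l)) \<le> mult_const * (1 + \<bar>l\<bar>)" for l
    using norm_regular_mult[OF \<xi>] by simp
  have eq: "g_reg = (\<lambda>l. g l + (- cnj (regular_mult \<xi> l)) * S_hat (- sgn \<xi>) (\<lambda>v. g v * of_real (w v)) l)"
    by (simp add: g_reg_def S_def fun_eq_iff)
  note T = L2w_add_mult_S_hat[OF weak_deriv(1)[OF g] m b, of "- sgn \<xi>"]
  show "g_reg \<in> L2w"
    unfolding eq by (rule T(1))
  have "norm_L2w g_reg \<le> op_const mult_const * norm_L2w g"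
    unfolding eq by (rule T(2))
  also have "\<dots> \<le> op_const mult_const * norm_H1w g"
    by (intro mult_left_mono norm_L2w_le_norm_H1w op_const_nonneg)
  finally show "norm_L2w g_reg \<le> op_const mult_const * norm_H1w g" .
qed

lemma cnj_U_op:
  "cnj (U_op \<xi> g l) = cnj (g_reg l) + of_real (indicator near_zero l) * (1 / (2 * (of_real l - \<i> * of_real (pole \<xi>)))) * cnj (S l)"
  unfolding U_op_eq[OF \<xi>] g_reg_def regular_mult_def S_def[symmetric]
  by (simp add: algebra_simps indicator_def)

text \<open>The regular part is an \<open>L2w\<close> pairing and the pole a singular integral. The
  factor \<open>\<rho>\<close> is 1 with \<open>c = pole \<xi>\<close> for the ordinary pairing, and
  \<open>l / (l - \<i> b)\<close> with \<open>c = b\<close> if the pole lies at 0; the bound depends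
  on neither.\<close>

lemma decomposition:
  assumes [measurable]: "\<rho> \<in> borel_measurable borel" and \<rho>: "\<And>l. cmod (\<rho> l) \<le> 1" and c: "c \<noteq> 0"
    and \<rho>c: "AE l in lborel. \<rho> l * (1 / (of_real l - \<i> * of_real (pole \<xi>))) = 1 / (of_real l - \<i> * of_real c)"
  shows "integrable lebesgue (\<lambda>l. \<rho> l * h l * cnj (U_op \<xi> g l) * of_real (w l))"
    "(LINT l|lebesgue. \<rho> l * h l * cnj (U_op \<xi> g l) * of_real (w l))
      = (LINT l|lebesgue. \<rho> l * h l * cnj (g_reg l) * of_real (w l))
        + 1 / 2 * (LINT l|lborel. of_real (indicator near_zero l) * (k l / (of_real l - \<i> * of_real c)))"
    "cmod (LINT l|lebesgue. \<rho> l * h l * cnj (U_op \<xi> g l) * of_real (w l)) \<le> pairing_const * A * norm_H1w g"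
proof -
  let ?s = "\<lambda>l. complex_of_real (indicator near_zero l) * (k l / (of_real l - \<i> * of_real c))"
  note \<rho>h = L2w_mult_unimodular_le[OF h assms(1) \<rho>]
  note P = L2w_pairing[OF \<rho>h(1) g_reg(1)]
  note sing = singular_integral[OF k_meas k_holder c]
  have sm: "?s \<in> borel_measurable borel" by measurable
  have s1: "integrable lebesgue ?s" and s2: "(LINT l|lebesgue. ?s l) = (LINT l|lborel. ?s l)"
    using integrable_lebesgue_AE_eq[OF _ sm] integral_lebesgue_AE_eq[OF _ sm] sing(1) by auto
  have "AE l in lborel. \<rho> l * h l * cnj (U_op \<xi> g l) * of_real (w l)
    = \<rho> l * h l * cnj (g_reg l) * of_real (w l) + 1 / 2 * ?s l"
    using \<rho>c hq
  proof eventually_elim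
    case (elim l)
    have "\<rho> l * h l * cnj (U_op \<xi> g l) * of_real (w l)
      = \<rho> l * h l * cnj (g_reg l) * of_real (w l)
        + 1 / 2 * (of_real (indicator near_zero l) * ((h l * of_real (w l)) * cnj (S l))
          * (\<rho> l * (1 / (of_real l - \<i> * of_real (pole \<xi>)))))"
      unfolding cnj_U_op by (simp add: algebra_simps)
    also have "\<dots> = \<rho> l * h l * cnj (g_reg l) * of_real (w l) + 1 / 2 * ?s l"
      unfolding elim by (simp add: k_def)
    finally show ?case .
  qed
  then have ae: "AE l in lebesgue. \<rho> l * h l * cnj (U_op \<xi> g l) * of_real (w l)
    = \<rho> l * h l * cnj (g_reg l) * of_real (w l) + 1 / 2 * ?s l"
    by (rule AE_completion)
  have lm: "f \<in> borel_measurable lebesgue" if "f \<in> borel_measurable borel" for f :: "real \<Rightarrow> complex"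
    using that by (simp add: measurable_completion)
  have wl: "(\<lambda>l. complex_of_real (w l)) \<in> borel_measurable lebesgue"
    by (rule lm) measurable
  have "(\<lambda>l. U_op \<xi> g l) \<in> borel_measurable lebesgue"
    unfolding U_op_eq[OF \<xi>] S_def[symmetric]
    using L2wD(1)[OF weak_deriv(1)[OF g]] lm[OF S_meas] lm[of "u_mult \<xi>"] by simp
  then have m1: "(\<lambda>l. \<rho> l * h l * cnj (U_op \<xi> g l) * of_real (w l)) \<in> borel_measurable lebesgue"
    using lm[of \<rho>] L2wD(1)[OF h] wl by (intro borel_measurable_times borel_measurable_cnj) auto
  have m2: "(\<lambda>l. \<rho> l * h l * cnj (g_reg l) * of_real (w l) + 1 / 2 * ?s l) \<in> borel_measurable lebesgue"
    by (intro borel_measurable_add borel_measurable_times borel_measurable_const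
        borel_measurable_integrable[OF P(1)] borel_measurable_integrable[OF s1])
  show "integrable lebesgue (\<lambda>l. \<rho> l * h l * cnj (U_op \<xi> g l) * of_real (w l))"
    unfolding integrable_cong_AE[OF m1 m2 ae]
    by (intro Bochner_Integration.integrable_add P(1) integrable_mult_right s1)
  show eq: "(LINT l|lebesgue. \<rho> l * h l * cnj (U_op \<xi> g l) * of_real (w l))
      = (LINT l|lebesgue. \<rho> l * h l * cnj (g_reg l) * of_real (w l)) + 1 / 2 * (LINT l|lborel. ?s l)"
    unfolding integral_cong_AE[OF m1 m2 ae] Bochner_Integration.integral_add[OF P(1) integrable_mult_right[OF s1]]
      integral_mult_right_zero s2 ..
  have "cmod (LINT l|lebesgue. \<rho> l * h l * cnj (g_reg l) * of_real (w l)) \<le> norm_L2w (\<lambda>l. \<rho> l * h l) * norm_L2w g_reg"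
    by (rule P(2))
  also have "\<dots> \<le> A * (op_const mult_const * norm_H1w g)"
    using \<rho>h(2) hA g_reg(2) A_nonneg by (intro mult_mono norm_L2w_nonneg) auto
  finally have b1: "cmod (LINT l|lebesgue. \<rho> l * h l * cnj (g_reg l) * of_real (w l)) \<le> A * (op_const mult_const * norm_H1w g)" .
  have b2: "cmod (1 / 2 * (LINT l|lborel. ?s l)) \<le> 1 / 2 * (6 * (2 * A * (12 * pi * norm_H1w g)))"
    using sing(4) by (simp add: norm_mult)
  show "cmod (LINT l|lebesgue. \<rho> l * h l * cnj (U_op \<xi> g l) * of_real (w l)) \<le> pairing_const * A * norm_H1w g"
    unfolding eq using norm_triangle_le[OF add_mono[OF b1 b2]] by (simp add: pairing_const_def algebra_simps)
qed

lemma regularizer: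
  assumes "b \<noteq> 0"
  shows "cmod (of_real l / (of_real l - \<i> * of_real b)) \<le> 1"
proof -
  have "\<bar>l\<bar> \<le> cmod (of_real l - \<i> * of_real b)"
    using abs_Re_le_cmod[of "of_real l - \<i> * of_real b"] by simp
  then show ?thesis
    using cauchy_kernel_denom_nonzero[OF assms, of l] by (simp add: norm_divide divide_le_eq)
qed

lemma reg_pairing_bound:
  "reg_pairing_exists \<xi> h (U_op \<xi> g) \<and> cmod (reg_pairing \<xi> h (U_op \<xi> g)) \<le> pairing_const * A * norm_H1w g"
proof (cases "\<xi> = sqrt pi \<or> \<xi> = - sqrt pi")
  case False
  then have "pole \<xi> \<noteq> 0"
    using pole_eq_0_iff[OF \<xi>] by simp
  then show ?thesis
    using decomposition[of "\<lambda>_. 1" "pole \<xi>"] False by (simp add: reg_pairing_exists_def reg_pairing_def)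
next
  case True
  then have p0: "pole \<xi> = 0"
    using pole_eq_0_iff[OF \<xi>] by simp
  let ?r = "\<lambda>b l. complex_of_real l / (of_real l - \<i> * of_real b)"
  let ?I = "\<lambda>b. LINT l|lebesgue. reg_integrand b h (U_op \<xi> g) l"
  have rm: "?r b \<in> borel_measurable borel" for b
    by measurable
  \<comment> \<open>The identity fails at \<open>l = 0\<close>, where the left side is 0 by the
    convention \<open>1 / 0 = 0\<close>, so it is stated almost everywhere.\<close>
  have rc: "AE l in lborel. ?r b l * (1 / (of_real l - \<i> * of_real (pole \<xi>))) = 1 / (of_real l - \<i> * of_real b)" for b
    using AE_lborel_singleton[of 0] by eventually_elim (simp add: p0)
  have dec1: "integrable lebesgue (reg_integrand b h (U_op \<xi> g))" if "b \<noteq> 0" for b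
    unfolding reg_integrand_def[abs_def] by (rule decomposition(1)[OF rm regularizer[OF that] that rc])
  have dec2: "?I b = (LINT l|lebesgue. ?r b l * h l * cnj (g_reg l) * of_real (w l))
      + 1 / 2 * (LINT l|lborel. of_real (indicator near_zero l) * (k l / (of_real l - \<i> * of_real b)))" if "b \<noteq> 0" for b
    unfolding reg_integrand_def by (rule decomposition(2)[OF rm regularizer[OF that] that rc])
  have dec3: "cmod (?I b) \<le> pairing_const * A * norm_H1w g" if "b \<noteq> 0" for b
    unfolding reg_integrand_def by (rule decomposition(3)[OF rm regularizer[OF that] that rc])
  have nz: "\<forall>\<^sub>F b in at_zero_side \<xi>. b \<noteq> 0"
    unfolding at_zero_side_def by (simp add: eventually_neq_at_within)
  have int: "\<forall>\<^sub>F b in at_zero_side \<xi>. integrable lebesgue (reg_integrand b h (U_op \<xi> g))"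
    using nz by eventually_elim (rule dec1)
  note P = L2w_pairing[OF h g_reg(1)]
  have "((\<lambda>b. LINT l|lebesgue. ?r b l * h l * cnj (g_reg l) * of_real (w l))
    \<longlongrightarrow> (LINT l|lebesgue. h l * cnj (g_reg l) * of_real (w l))) (at_zero_side \<xi>)"
  proof (rule integral_tendsto_side)
    show "(\<lambda>l. h l * cnj (g_reg l) * of_real (w l)) \<in> borel_measurable lebesgue"
      by (rule borel_measurable_integrable[OF P(1)])
    show "integrable lebesgue (\<lambda>l. cmod (h l * cnj (g_reg l) * of_real (w l)))"
      using P(1) by simp
    show "(\<lambda>l. ?r b l * h l * cnj (g_reg l) * of_real (w l)) \<in> borel_measurable lebesgue" if "b \<noteq> 0" for b
      by (rule borel_measurable_integrable[OF L2w_pairing(1)[OF L2w_mult_unimodular_le(1)[OF h rm regularizer[OF that]] g_reg(1)]])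
    show "AE l in lebesgue. norm (?r b l * h l * cnj (g_reg l) * of_real (w l)) \<le> cmod (h l * cnj (g_reg l) * of_real (w l))"
      if "b \<noteq> 0" for b
    proof (intro AE_I2)
      fix l
      have "cmod (?r b l) * cmod (h l * cnj (g_reg l) * of_real (w l)) \<le> 1 * cmod (h l * cnj (g_reg l) * of_real (w l))"
        by (intro mult_right_mono regularizer[OF that]) simp
      then show "norm (?r b l * h l * cnj (g_reg l) * of_real (w l)) \<le> cmod (h l * cnj (g_reg l) * of_real (w l))"
        by (simp only: norm_mult mult.assoc mult_1)
    qed
    have "((\<lambda>b. ?r b l * h l * cnj (g_reg l) * of_real (w l)) \<longlongrightarrow> h l * cnj (g_reg l) * of_real (w l)) (at_zero_side \<xi>)"
      if "l \<noteq> 0" for l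
    proof -
      have "((\<lambda>b. ?r b l * h l * cnj (g_reg l) * of_real (w l)) \<longlongrightarrow> ?r 0 l * h l * cnj (g_reg l) * of_real (w l)) (at_zero_side \<xi>)"
        using that by (intro tendsto_intros tendsto_zero_side) simp
      then show ?thesis using that by simp
    qed
    then have "AE l in lborel. ((\<lambda>b. ?r b l * h l * cnj (g_reg l) * of_real (w l)) \<longlongrightarrow> h l * cnj (g_reg l) * of_real (w l)) (at_zero_side \<xi>)"
      using AE_lborel_singleton[of 0] by (auto elim: eventually_mono)
    then show "AE l in lebesgue. ((\<lambda>b. ?r b l * h l * cnj (g_reg l) * of_real (w l)) \<longlongrightarrow> h l * cnj (g_reg l) * of_real (w l)) (at_zero_side \<xi>)"
      by (rule AE_completion)
  qed
  moreover obtain L where "((\<lambda>b. LINT l|lborel. of_real (indicator near_zero l) * (k l / (of_real l - \<i> * of_real b))) \<longlongrightarrow> L) (at_zero_side \<xi>)"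
    using singular_integral_convergent[OF k_meas k_holder] by blast
  ultimately have lim: "((\<lambda>b. (LINT l|lebesgue. ?r b l * h l * cnj (g_reg l) * of_real (w l))
      + 1 / 2 * (LINT l|lborel. of_real (indicator near_zero l) * (k l / (of_real l - \<i> * of_real b))))
    \<longlongrightarrow> (LINT l|lebesgue. h l * cnj (g_reg l) * of_real (w l)) + 1 / 2 * L) (at_zero_side \<xi>)"
    by (intro tendsto_intros)
  have ev: "\<forall>\<^sub>F b in at_zero_side \<xi>. (LINT l|lebesgue. ?r b l * h l * cnj (g_reg l) * of_real (w l))
      + 1 / 2 * (LINT l|lborel. of_real (indicator near_zero l) * (k l / (of_real l - \<i> * of_real b))) = ?I b"
    using nz by eventually_elim (rule dec2[symmetric])
  define L' where "L' = (LINT l|lebesgue. h l * cnj (g_reg l) * of_real (w l)) + 1 / 2 * L"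
  have L': "(?I \<longlongrightarrow> L') (at_zero_side \<xi>)"
    unfolding L'_def by (rule Lim_transform_eventually[OF lim ev])
  have "cmod L' \<le> pairing_const * A * norm_H1w g"
    using nz by (intro tendsto_upperbound[OF tendsto_norm[OF L']])
      (auto elim!: eventually_mono intro: dec3 simp: at_zero_side_neq_bot)
  then show ?thesis
    using True int L' tendsto_Lim[OF at_zero_side_neq_bot L'] by (auto simp: reg_pairing_exists_def reg_pairing_def)
qed

end

section \<open>Bounds for the two operators and for their pairing\<close>

lemma B_op_L2w:
  assumes "\<xi> \<noteq> 0" "f \<in> L2w"
  shows "B_op \<xi> f \<in> L2w" "norm_L2w (B_op \<xi> f) \<le> op_const mult_const * norm_L2w f"
proof -
  have eq: "B_op \<xi> f = (\<lambda>l. f l + b_mult \<xi> l * S_hat (- sgn \<xi>) (\<lambda>v. f v * of_real (w v)) l)"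
    by (intro ext B_op_eq assms)
  show "B_op \<xi> f \<in> L2w" "norm_L2w (B_op \<xi> f) \<le> op_const mult_const * norm_L2w f"
    unfolding eq
    using L2w_add_mult_S_hat[OF assms(2) borel_measurable_b_mult norm_b_mult[OF assms(1)]] by blast+
qed

text \<open>Here the pole stays at distance \<open>\<bar>pole \<xi>\<bar>\<close> from the real
  line, which bounds the multiplier near 0. The bound degenerates as
  \<open>\<bar>\<xi>\<bar>\<close> approaches \<open>sqrt pi\<close>; this is the source of the
  dependence on \<open>\<xi>\<close> in the \<open>L2w\<close> estimate.\<close>

lemma U_op_L2w:
  assumes \<xi>: "\<xi> \<noteq> 0" "\<xi> \<noteq> sqrt pi" "\<xi> \<noteq> - sqrt pi" and f: "f \<in> L2w"
  shows "U_op \<xi> f \<in> L2w" "norm_L2w (U_op \<xi> f) \<le> op_const (mult_const + 1 / \<bar>pole \<xi>\<bar>) * norm_L2w f"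
proof -
  have p: "pole \<xi> \<noteq> 0"
    using \<xi> pole_eq_0_iff by simp
  have eq: "U_op \<xi> f = (\<lambda>l. f l + (- u_mult \<xi> l) * S_hat (- sgn \<xi>) (\<lambda>v. f v * of_real (w v)) l)"
    by (intro ext U_op_eq \<xi>)
  have m: "(\<lambda>l. - u_mult \<xi> l) \<in> borel_measurable borel"
    by measurable
  have "cmod (- u_mult \<xi> l) \<le> (mult_const + 1 / \<bar>pole \<xi>\<bar>) * (1 + \<bar>l\<bar>)" for l
  proof (cases "\<bar>l\<bar> \<le> 1 / 4")
    case True
    have "cmod (u_mult \<xi> l) \<le> 1 / \<bar>pole \<xi>\<bar> * 1"
      using norm_u_mult_near[OF \<xi>(1) True p] by simp
    also have "\<dots> \<le> (mult_const + 1 / \<bar>pole \<xi>\<bar>) * (1 + \<bar>l\<bar>)"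
      using mult_const_ge by (intro mult_mono) auto
    finally show ?thesis by simp
  next
    case False
    then have "cmod (u_mult \<xi> l) \<le> mult_const * (1 + \<bar>l\<bar>)"
      by (intro norm_u_mult_far) simp
    also have "\<dots> \<le> (mult_const + 1 / \<bar>pole \<xi>\<bar>) * (1 + \<bar>l\<bar>)"
      by (intro mult_right_mono) auto
    finally show ?thesis by simp
  qed
  note T = L2w_add_mult_S_hat[OF f m this]
  show "U_op \<xi> f \<in> L2w" "norm_L2w (U_op \<xi> f) \<le> op_const (mult_const + 1 / \<bar>pole \<xi>\<bar>) * norm_L2w f"
    unfolding eq using T by blast+
qed

lemma reg_pairing_H1w:
  assumes \<xi>: "\<xi> \<noteq> 0" and g: "g \<in> H1w" and h: "h \<in> H1w"
  shows "reg_pairing_exists \<xi> h (U_op \<xi> g) \<and>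
    cmod (reg_pairing \<xi> h (U_op \<xi> g)) \<le> pairing_const * (6 * norm_H1w h) * norm_H1w g"
proof -
  obtain q where q: "AE x in lborel. h x * of_real (w x) = q x" "holder_on UNIV (6 * norm_H1w h) q"
    by (rule H1w_mult_w_holder[OF h])
  interpret pairing \<xi> g h q "6 * norm_H1w h"
  proof
    show "norm_L2w h \<le> 6 * norm_H1w h"
      using norm_L2w_le_norm_H1w[of h] norm_H1w_nonneg[of h] by simp
    show "holder_on near_zero (6 * norm_H1w h) q"
      by (rule holder_on_mono[OF q(2)]) auto
  qed (use \<xi> g weak_deriv(1)[OF h] q borel_measurable_if_holder in auto)
  show ?thesis
    by (rule reg_pairing_bound)
qed

text \<open>The sum of the \<open>L2w\<close> constant of \<open>B_op\<close> and the Hoelder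
  constants 6 of \<open>f w\<close> and \<open>2 * 60 * (12 * pi)\<close> of its singular
  part.\<close>

definition b_const :: real where
  "b_const = op_const mult_const + 6 + 1440 * pi"

text \<open>Near 0 the product of \<open>B_op \<xi> f\<close> with \<open>w\<close> is
  \<open>f w\<close> plus \<open>w * b_mult\<close> times the boundary operator applied to
  \<open>f w\<close>. All three are Hoelder continuous there uniformly in \<open>\<xi>\<close>, so
  the pairing estimate applies without a weak derivative of \<open>B_op \<xi> f\<close>.\<close>

lemma reg_pairing_B_op:
  assumes \<xi>: "\<xi> \<noteq> 0" and g: "g \<in> H1w" and f: "f \<in> H1w"
  shows "reg_pairing_exists \<xi> (B_op \<xi> f) (U_op \<xi> g) \<and>
    cmod (reg_pairing \<xi> (B_op \<xi> f) (U_op \<xi> g)) \<le> pairing_const * (b_const * norm_H1w f) * norm_H1w g"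
proof -
  let ?N = "norm_H1w f"
  let ?S = "S_hat (- sgn \<xi>) (\<lambda>v. f v * of_real (w v))"
  obtain q where q: "AE x in lborel. f x * of_real (w x) = q x" "holder_on UNIV (6 * ?N) q"
    by (rule H1w_mult_w_holder[OF f])
  have S: "holder_on UNIV (12 * pi * ?N) ?S"
    by (rule H1w_S_hat_holder[OF f])
  have [measurable]: "q \<in> borel_measurable borel" "?S \<in> borel_measurable borel"
    using borel_measurable_if_holder[OF q(2)] borel_measurable_if_holder[OF S] by auto
  have N0: "0 \<le> ?N" by (rule norm_H1w_nonneg)
  let ?q = "\<lambda>l. q l + of_real (w l) * b_mult \<xi> l * ?S l"
  have C: "op_const mult_const * ?N \<le> b_const * ?N" "(6 + 1440 * pi) * ?N \<le> b_const * ?N"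
    using op_const_nonneg[of mult_const] N0 by (intro mult_right_mono; simp add: b_const_def)+
  interpret pairing \<xi> g "B_op \<xi> f" ?q "b_const * ?N"
  proof
    show "B_op \<xi> f \<in> L2w"
      by (rule B_op_L2w(1)[OF \<xi> weak_deriv(1)[OF f]])
    have "norm_L2w (B_op \<xi> f) \<le> op_const mult_const * norm_L2w f"
      by (rule B_op_L2w(2)[OF \<xi> weak_deriv(1)[OF f]])
    also have "\<dots> \<le> op_const mult_const * ?N"
      by (intro mult_left_mono norm_L2w_le_norm_H1w op_const_nonneg)
    finally show "norm_L2w (B_op \<xi> f) \<le> b_const * ?N"
      using C(1) by simp
    show "?q \<in> borel_measurable borel"
      by measurable
    show "AE l in lborel. B_op \<xi> f l * of_real (w l) = ?q l"
      using q(1) by eventually_elim (simp add: B_op_eq[OF \<xi>] algebra_simps)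
    have "holder_on near_zero (6 * ?N + 2 * 60 * (12 * pi * ?N)) ?q"
      using N0 by (intro holder_on_add holder_on_mult b_mult_w_holder[OF \<xi>] holder_on_mono[OF q(2)] holder_on_mono[OF S]) auto
    then show "holder_on near_zero (b_const * ?N) ?q"
      by (rule holder_on_mono) (use C(2) in \<open>simp_all add: algebra_simps\<close>)
  qed (use \<xi> g in auto)
  show ?thesis
    by (rule reg_pairing_bound)
qed

theorem proposition7p6:
  "\<exists>(C\<^sub>\<xi> :: real \<Rightarrow> real) (C :: real) (C\<^sub>1 :: real) (C\<^sub>2 :: real).
     (\<forall>\<xi>::real. \<xi> \<noteq> 0 \<and> \<xi> \<noteq> sqrt pi \<and> \<xi> \<noteq> - sqrt pi \<longrightarrow>
        (\<forall>f \<in> L2w. \<forall>g \<in> L2w.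
           integrable lebesgue (\<lambda>l. B_op \<xi> f l * cnj (U_op \<xi> g l) * of_real (w l)) \<and>
           cmod (LINT l|lebesgue. B_op \<xi> f l * cnj (U_op \<xi> g l) * of_real (w l))
             \<le> C\<^sub>\<xi> \<xi> * norm_L2w f * norm_L2w g)) \<and>
     (\<forall>\<xi>::real. \<xi> \<noteq> 0 \<longrightarrow>
        (\<forall>f \<in> H1w. \<forall>g \<in> H1w.
           reg_pairing_exists \<xi> (B_op \<xi> f) (U_op \<xi> g) \<and>
           cmod (reg_pairing \<xi> (B_op \<xi> f) (U_op \<xi> g)) \<le> C * norm_H1w f * norm_H1w g)) \<and>
     (\<forall>\<xi>::real. \<xi> \<noteq> 0 \<longrightarrow>
        (\<forall>g \<in> H1w.
           (\<forall>h \<in> H1w. reg_pairing_exists \<xi> h (U_op \<xi> g)) \<and>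
           norm_Hminus1w \<xi> (U_op \<xi> g) \<le> ennreal (C\<^sub>1 * norm_H1w g)) \<and>
        (\<forall>f \<in> L2w.
           B_op \<xi> f \<in> L2w \<and> norm_L2w (B_op \<xi> f) \<le> C\<^sub>2 * norm_L2w f))"
proof (intro exI conjI allI impI ballI)
  fix \<xi> :: real and f g :: "real \<Rightarrow> complex"
  assume \<xi>: "\<xi> \<noteq> 0 \<and> \<xi> \<noteq> sqrt pi \<and> \<xi> \<noteq> - sqrt pi" and f: "f \<in> L2w" and g: "g \<in> L2w"
  have B: "B_op \<xi> f \<in> L2w" "norm_L2w (B_op \<xi> f) \<le> op_const mult_const * norm_L2w f"
    and U: "U_op \<xi> g \<in> L2w" "norm_L2w (U_op \<xi> g) \<le> op_const (mult_const + 1 / \<bar>pole \<xi>\<bar>) * norm_L2w g"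
    using B_op_L2w[OF _ f] U_op_L2w[OF _ _ _ g] \<xi> by auto
  show "integrable lebesgue (\<lambda>l. B_op \<xi> f l * cnj (U_op \<xi> g l) * of_real (w l))"
    by (rule L2w_pairing(1)[OF B(1) U(1)])
  have "cmod (LINT l|lebesgue. B_op \<xi> f l * cnj (U_op \<xi> g l) * of_real (w l)) \<le> norm_L2w (B_op \<xi> f) * norm_L2w (U_op \<xi> g)"
    by (rule L2w_pairing(2)[OF B(1) U(1)])
  also have "\<dots> \<le> (op_const mult_const * norm_L2w f) * (op_const (mult_const + 1 / \<bar>pole \<xi>\<bar>) * norm_L2w g)"
    by (intro mult_mono B(2) U(2) mult_nonneg_nonneg op_const_nonneg norm_L2w_nonneg)
  finally show "cmod (LINT l|lebesgue. B_op \<xi> f l * cnj (U_op \<xi> g l) * of_real (w l))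
    \<le> (\<lambda>\<xi>. op_const mult_const * op_const (mult_const + 1 / \<bar>pole \<xi>\<bar>)) \<xi> * norm_L2w f * norm_L2w g"
    by (simp add: mult_ac)
next
  fix \<xi> :: real and f g :: "real \<Rightarrow> complex"
  assume "\<xi> \<noteq> 0" "f \<in> H1w" "g \<in> H1w"
  note P = reg_pairing_B_op[OF this(1,3,2)]
  show "reg_pairing_exists \<xi> (B_op \<xi> f) (U_op \<xi> g)"
    using P by blast
  show "cmod (reg_pairing \<xi> (B_op \<xi> f) (U_op \<xi> g)) \<le> (pairing_const * b_const) * norm_H1w f * norm_H1w g"
    using P by (simp add: mult.assoc)
next
  fix \<xi> :: real and g h :: "real \<Rightarrow> complex"
  assume "\<xi> \<noteq> 0" "g \<in> H1w" "h \<in> H1w"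
  then show "reg_pairing_exists \<xi> h (U_op \<xi> g)"
    using reg_pairing_H1w by blast
next
  fix \<xi> :: real and g :: "real \<Rightarrow> complex"
  assume \<xi>: "\<xi> \<noteq> 0" and g: "g \<in> H1w"
  show "norm_Hminus1w \<xi> (U_op \<xi> g) \<le> ennreal ((pairing_const * 6) * norm_H1w g)"
    unfolding norm_Hminus1w_def
  proof (rule SUP_least)
    fix h assume "h \<in> {h \<in> H1w. norm_H1w h \<le> 1}"
    then have h: "h \<in> H1w" "norm_H1w h \<le> 1" by auto
    have pc: "0 \<le> pairing_const"
      using op_const_nonneg[of mult_const] by (simp add: pairing_const_def)
    have "cmod (reg_pairing \<xi> h (U_op \<xi> g)) \<le> pairing_const * (6 * norm_H1w h) * norm_H1w g"
      using reg_pairing_H1w[OF \<xi> g h(1)] by blast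
    also have "\<dots> \<le> pairing_const * (6 * 1) * norm_H1w g"
      using h(2) pc norm_H1w_nonneg[of g] by (intro mult_right_mono mult_left_mono) auto
    finally show "ennreal (cmod (reg_pairing \<xi> h (U_op \<xi> g))) \<le> ennreal ((pairing_const * 6) * norm_H1w g)"
      by (intro ennreal_leI) simp
  qed
next
  fix \<xi> :: real and f :: "real \<Rightarrow> complex"
  assume "\<xi> \<noteq> 0" "f \<in> L2w"
  then show "B_op \<xi> f \<in> L2w" "norm_L2w (B_op \<xi> f) \<le> op_const mult_const * norm_L2w f"
    by (rule B_op_L2w)+
qed

end
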